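(* Let $n\ge1$, let $\Omega\subset\mathbb{R}^{2n+1}$ be a bounded open set with smooth boundary and let $\psi:\mathbb{H}^n\to\mathbb{R}$ be a smooth function (more precisely, $\psi$ is supposed to have continuous derivatives of second order in the vector fields $X_j$ and $Y_j$). Then $2\in\mathcal{P}(\psi,\Omega)$.
   Context: **Heisenberg group.** $\mathbb{H}^n$ is $\mathbb{R}^{2n+1}$ with coordinates $(x,y,t)\in\mathbb{R}^n\times\mathbb{R}^n\times\mathbb{R}$ and group law $(x^{(1)},y^{(1)},t^{(1)})\circ(x^{(2)},y^{(2)},t^{(2)})=(x^{(1)}+x^{(2)},y^{(1)}+y^{(2)},t^{(1)}+t^{(2)}+2(x^{(2)}\cdot y^{(1)}-x^{(1)}\cdot y^{(2)}))$. For $j=1,\dots,n$, $X_j=\partial_{x_j}+2y_j\partial_t$, $Y_j=\partial_{y_j}-2x_j\partial_t$. The horizontal gradient is $\nabla_{\mathbb{H}^n}=(X_1,\dots,X_n,Y_1,\dots,Y_n)$ and $\operatorname{div}_{\mathbb{H}^n}V=\sum_{j=1}^n(X_jV_j+Y_jV_{n+j})$. $f^+=\max\{f,0\}$. $W^{1,p}_{\mathbb{H}^n}(\Omega)$ is the set of $u\in L^p(\Omega)$ whose distributional derivatives $X_ju,Y_ju$ belong to $L^p(\Omega)$ for all $j$, with norm $\|u\|_{L^p(\Omega)}+\sum_j(\|X_ju\|_{L^p(\Omega)}+\|Y_ju\|_{L^p(\Omega)})$; $W^{1,p}_{\mathbb{H}^n,0}(\Omega)$ is the closure of $C_0^\infty(\Omega)$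 in this norm. **The set $\mathcal{P}(\psi,\Omega)$.** For $p\in(1,+\infty)$, $p\in\mathcal{P}(\psi,\Omega)$ means that the following holds. For any $\varepsilon>0$, any $v\in W^{1,p}_{\mathbb{H}^n}(\Omega)$, any $M>0$, and any sequence $F_k=F_k(r,\xi)\in C([-M,M]\times\Omega)$ with $F_k(\cdot,\xi)\in C^1([-M,M])$ and $$0\le\partial_rF_k\le\Big(\operatorname{div}_{\mathbb{H}^n}\big((\varepsilon+|\nabla_{\mathbb{H}^n}\psi|^2)^{(p/2)-1}\nabla_{\mathbb{H}^n}\psi\big)\Big)^+,$$ if $u_k:\Omega\to[-M,M]$ is a sequence of minimizers of the functional $$\int_\Omega\frac1p(\varepsilon+|\nabla_{\mathbb{H}^n}u(\xi)|^2)^{p/2}+F_k(u(\xi),\xi)\,d\xi$$ over the functions $u\in W^{1,p}_{\mathbb{H}^n}(\Omega)$ with $u-v\in W^{1,p}_{\mathbb{H}^n,0}(\Omega)$, with the property that $u_k$ converges to some $u_\infty$ uniformly in $\Omega$, then $$0\le\operatorname{div}_{\mathbb{H}^n}\big((\varepsilon+|\nabla_{\mathbb{H}^n}u_\infty|^2)^{(p/2)-1}\nabla_{\mathbb{H}^n}u_\infty\big)\le h:=\Big(\operatorname{div}_{\mathbb{H}^n}\big((\varepsilon+|\nabla_{\mathbb{H}^n}\psi|^2)^{(p/2)-1}\nabla_{\mathbb{H}^n}\psi\big)\Big)^+$$ in the sense of distributions in $\Omega$, i.e. for all $\varphi\in C_0^\infty(\Omega,[0,+\infty))$, $$0\le-\int_\Omega(\varepsilon+|\nabla_{\mathbb{H}^n}u_\infty|^2)^{(p/2)-1}\nabla_{\mathbb{H}^n}u_\infty\cdot\nabla_{\mathbb{H}^n}\varphi\le\int_\Omega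 h\,\varphi .$$ *)

theory Defs
  imports "HOL-Analysis.Analysis"
begin

section \<open>The Heisenberg group and its horizontal vector fields\<close>

text \<open>Points of \<open>\<bbbH>\<^sup>n\<close> are triples \<open>(x, y, t)\<close>. The dimension \<open>n \<ge> 1\<close> is the cardinality of the finite
  index type \<open>'n\<close>. Horizontal vectors have \<open>2n\<close> entries indexed by \<open>'n + 'n\<close>: \<open>Inl j\<close> stands for
  \<open>X\<^sub>j\<close> and \<open>Inr j\<close> for \<open>Y\<^sub>j\<close>.\<close>

type_synonym 'n heis = "(real ^ 'n) \<times> (real ^ 'n) \<times> real"

type_synonym 'n hvec = "real ^ ('n + 'n)"

fun hfield :: "'n + 'n \<Rightarrow> 'n::finite heis \<Rightarrow> 'n heis" where
  "hfield (Inl j) (x, y, t) = (axis j 1, 0, 2 * y $ j)"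
| "hfield (Inr j) (x, y, t) = (0, axis j 1, - 2 * x $ j)"

text \<open>Each field is constant along the straight line that it spans at a point, so these lines are its
  integral curves. Differentiating along them is meaningful for functions that are differentiable
  only in the horizontal directions.\<close>

definition hderiv :: "'n + 'n \<Rightarrow> ('n::finite heis \<Rightarrow> real) \<Rightarrow> 'n heis \<Rightarrow> real" where
  "hderiv i f \<xi> = deriv (\<lambda>s. f (\<xi> + s *\<^sub>R hfield i \<xi>)) 0"

lemma hderiv_eq_frechet_derivative:
  fixes f :: "'n::finite heis \<Rightarrow> real"
  assumes "f differentiable (at \<xi>)"
  shows "hderiv i f \<xi> = frechet_derivative f (at \<xi>) (hfield i \<xi>)"
proof -
  let ?D = "frechet_derivative f (at \<xi>)"
  have D: "(f has_derivative ?D) (at \<xi>)"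
    using assms by (simp add: frechet_derivative_works)
  have L: "((\<lambda>s. \<xi> + s *\<^sub>R hfield i \<xi>) has_derivative (\<lambda>s. s *\<^sub>R hfield i \<xi>)) (at 0)"
    by (auto intro!: derivative_eq_intros)
  have "((\<lambda>s. f (\<xi> + s *\<^sub>R hfield i \<xi>)) has_derivative (\<lambda>s. ?D (s *\<^sub>R hfield i \<xi>))) (at 0)"
    using has_derivative_compose[OF L, of f ?D] D by simp
  moreover have "(\<lambda>s. ?D (s *\<^sub>R hfield i \<xi>)) = (*) (?D (hfield i \<xi>))"
    using linear_frechet_derivative[OF assms] by (auto simp: linear_cmul)
  ultimately have "((\<lambda>s. f (\<xi> + s *\<^sub>R hfield i \<xi>)) has_field_derivative ?D (hfield i \<xi>)) (at 0)"
    by (simp add: has_field_derivative_def)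
  then show ?thesis
    unfolding hderiv_def by (rule DERIV_imp_deriv)
qed

definition hgrad :: "('n::finite heis \<Rightarrow> real) \<Rightarrow> 'n heis \<Rightarrow> 'n hvec" where
  "hgrad f \<xi> = (\<chi> i. hderiv i f \<xi>)"

definition hdiv :: "('n::finite heis \<Rightarrow> 'n hvec) \<Rightarrow> 'n heis \<Rightarrow> real" where
  "hdiv V \<xi> = (\<Sum>i\<in>UNIV. hderiv i (\<lambda>\<eta>. V \<eta> $ i) \<xi>)"

definition hC1 :: "('n::finite heis \<Rightarrow> real) \<Rightarrow> bool" where
  "hC1 f \<longleftrightarrow> continuous_on UNIV f \<and>
    (\<forall>i. (\<forall>\<xi>. (\<lambda>s. f (\<xi> + s *\<^sub>R hfield i \<xi>)) differentiable (at 0)) \<and>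
         continuous_on UNIV (hderiv i f))"

definition hC2 :: "('n::finite heis \<Rightarrow> real) \<Rightarrow> bool" where
  "hC2 f \<longleftrightarrow> hC1 f \<and> (\<forall>i. hC1 (hderiv i f))"

section \<open>Smooth functions, test functions, smooth boundaries\<close>

text \<open>The following is the usual class \<open>C\<^sup>k(S)\<close> for open \<open>S\<close> in a finite-dimensional space.\<close>

primrec Ck_on :: "nat \<Rightarrow> 'a::euclidean_space set \<Rightarrow> ('a \<Rightarrow> real) \<Rightarrow> bool" where
  "Ck_on 0 S f \<longleftrightarrow> continuous_on S f"
| "Ck_on (Suc k) S f \<longleftrightarrow>
    (\<forall>x\<in>S. f differentiable (at x)) \<and> (\<forall>v. Ck_on k S (\<lambda>x. frechet_derivative f (at x) v))"

definition smooth_fun_on :: "'a::euclidean_space set \<Rightarrow> ('a \<Rightarrow> real) \<Rightarrow> bool" where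
  "smooth_fun_on S f \<longleftrightarrow> (\<forall>k. Ck_on k S f)"

text \<open>Functions in \<open>C\<^sub>0\<^sup>\<infinity>(\<Omega>)\<close> are represented by their extension by zero to the whole space.\<close>

definition test_functions :: "'a::euclidean_space set \<Rightarrow> ('a \<Rightarrow> real) set" where
  "test_functions \<Omega> = {\<phi>. smooth_fun_on UNIV \<phi> \<and>
    compact (closure {x. \<phi> x \<noteq> 0}) \<and> closure {x. \<phi> x \<noteq> 0} \<subseteq> \<Omega>}"

definition smooth_boundary :: "'a::euclidean_space set \<Rightarrow> bool" where
  "smooth_boundary \<Omega> \<longleftrightarrow> (\<forall>x\<in>frontier \<Omega>. \<exists>U \<rho>. open U \<and> x \<in> U \<and> smooth_fun_on U \<rho> \<and>
    (\<forall>y\<in>U. frechet_derivative \<rho> (at y) \<noteq> (\<lambda>_. 0)) \<and>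
    \<Omega> \<inter> U = {y \<in> U. \<rho> y < 0} \<and> frontier \<Omega> \<inter> U = {y \<in> U. \<rho> y = 0})"

section \<open>Horizontal Sobolev spaces\<close>

definition Lp :: "real \<Rightarrow> 'n::finite heis set \<Rightarrow> ('n heis \<Rightarrow> real) set" where
  "Lp p \<Omega> = {f \<in> borel_measurable (lebesgue_on \<Omega>).
    integrable (lebesgue_on \<Omega>) (\<lambda>\<xi>. \<bar>f \<xi>\<bar> powr p)}"

definition Lp_norm :: "real \<Rightarrow> 'n::finite heis set \<Rightarrow> ('n heis \<Rightarrow> real) \<Rightarrow> real" where
  "Lp_norm p \<Omega> f = (LINT \<xi>|lebesgue_on \<Omega>. \<bar>f \<xi>\<bar> powr p) powr (1 / p)"

definition loc_integrable :: "'n::finite heis set \<Rightarrow> ('n heis \<Rightarrow> real) \<Rightarrow> bool" where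
  "loc_integrable \<Omega> f \<longleftrightarrow> (\<forall>K. compact K \<and> K \<subseteq> \<Omega> \<longrightarrow> integrable (lebesgue_on K) f)"

text \<open>The fields \<open>X\<^sub>j\<close>, \<open>Y\<^sub>j\<close> are divergence free, so their formal adjoints are \<open>- X\<^sub>j\<close>, \<open>- Y\<^sub>j\<close>.\<close>

definition has_weak_hderiv ::
    "'n::finite heis set \<Rightarrow> 'n + 'n \<Rightarrow> ('n heis \<Rightarrow> real) \<Rightarrow> ('n heis \<Rightarrow> real) \<Rightarrow> bool" where
  "has_weak_hderiv \<Omega> i u g \<longleftrightarrow> loc_integrable \<Omega> u \<and> loc_integrable \<Omega> g \<and>
    (\<forall>\<phi>\<in>test_functions \<Omega>.
      (LINT \<xi>|lebesgue_on \<Omega>. u \<xi> * hderiv i \<phi> \<xi>) = - (LINT \<xi>|lebesgue_on \<Omega>. g \<xi> * \<phi> \<xi>))"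

text \<open>A weak derivative is unique up to null sets; the choice of representative is immaterial below,
  where it only occurs under integrals and only for functions that possess weak derivatives.\<close>

definition weak_hderiv :: "'n::finite heis set \<Rightarrow> 'n + 'n \<Rightarrow> ('n heis \<Rightarrow> real) \<Rightarrow> 'n heis \<Rightarrow> real" where
  "weak_hderiv \<Omega> i u = (SOME g. has_weak_hderiv \<Omega> i u g)"

definition weak_hgrad :: "'n::finite heis set \<Rightarrow> ('n heis \<Rightarrow> real) \<Rightarrow> 'n heis \<Rightarrow> 'n hvec" where
  "weak_hgrad \<Omega> u \<xi> = (\<chi> i. weak_hderiv \<Omega> i u \<xi>)"

definition W1p :: "real \<Rightarrow> 'n::finite heis set \<Rightarrow> ('n heis \<Rightarrow> real) set" where
  "W1p p \<Omega> = {u \<in> Lp p \<Omega>. \<forall>i. \<exists>g\<in>Lp p \<Omega>. has_weak_hderiv \<Omega> i u g}"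

definition W1p_norm :: "real \<Rightarrow> 'n::finite heis set \<Rightarrow> ('n heis \<Rightarrow> real) \<Rightarrow> real" where
  "W1p_norm p \<Omega> u = Lp_norm p \<Omega> u + (\<Sum>i\<in>UNIV. Lp_norm p \<Omega> (weak_hderiv \<Omega> i u))"

definition W1p_0 :: "real \<Rightarrow> 'n::finite heis set \<Rightarrow> ('n heis \<Rightarrow> real) set" where
  "W1p_0 p \<Omega> = {u \<in> W1p p \<Omega>.
    \<forall>e>0. \<exists>\<phi>\<in>test_functions \<Omega>. W1p_norm p \<Omega> (\<lambda>\<xi>. u \<xi> - \<phi> \<xi>) < e}"

section \<open>The set \<open>\<P>(\<psi>, \<Omega>)\<close>\<close>

text \<open>The vector \<open>(\<epsilon> + |q|\<^sup>2)\<^bsup>p/2 - 1\<^esup> q\<close>.\<close>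

definition flux :: "real \<Rightarrow> real \<Rightarrow> 'n::finite hvec \<Rightarrow> 'n hvec" where
  "flux p \<epsilon> q = ((\<epsilon> + (norm q)\<^sup>2) powr (p / 2 - 1)) *\<^sub>R q"

definition obstacle_bound :: "real \<Rightarrow> real \<Rightarrow> ('n::finite heis \<Rightarrow> real) \<Rightarrow> 'n heis \<Rightarrow> real" where
  "obstacle_bound p \<epsilon> \<psi> \<xi> = max (hdiv (\<lambda>\<eta>. flux p \<epsilon> (hgrad \<psi> \<eta>)) \<xi>) 0"

definition energy_density ::
    "real \<Rightarrow> real \<Rightarrow> 'n::finite heis set \<Rightarrow> (real \<Rightarrow> 'n heis \<Rightarrow> real) \<Rightarrow> ('n heis \<Rightarrow> real) \<Rightarrow> 'n heis \<Rightarrow> real"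
  where
  "energy_density p \<epsilon> \<Omega> F u \<xi> =
    1 / p * (\<epsilon> + (norm (weak_hgrad \<Omega> u \<xi>))\<^sup>2) powr (p / 2) + F (u \<xi>) \<xi>"

text \<open>The integrand \<open>F\<close> matters only on \<open>[-M, M] \<times> \<Omega>\<close>, so the functional is considered only at those
  functions of the class \<open>v + W\<^sub>0\<close> whose values lie in \<open>[-M, M]\<close>.\<close>

definition competitors ::
    "real \<Rightarrow> 'n::finite heis set \<Rightarrow> ('n heis \<Rightarrow> real) \<Rightarrow> real \<Rightarrow> ('n heis \<Rightarrow> real) set" where
  "competitors p \<Omega> v M = {u \<in> W1p p \<Omega>.
    (\<lambda>\<xi>. u \<xi> - v \<xi>) \<in> W1p_0 p \<Omega> \<and> (\<forall>\<xi>\<in>\<Omega>. u \<xi> \<in> {-M..M})}"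

text \<open>Integrability is part of being a minimizer: the energy at the minimizer is a well-defined finite
  number. Without it, every function would qualify whenever the functional is identically infinite
  (for instance if \<open>F r \<xi> = G \<xi>\<close> with \<open>G\<close> continuous on \<open>\<Omega>\<close> but not integrable).\<close>

definition is_minimizer ::
    "real \<Rightarrow> real \<Rightarrow> 'n::finite heis set \<Rightarrow> ('n heis \<Rightarrow> real) \<Rightarrow> real \<Rightarrow>
      (real \<Rightarrow> 'n heis \<Rightarrow> real) \<Rightarrow> ('n heis \<Rightarrow> real) \<Rightarrow> bool" where
  "is_minimizer p \<epsilon> \<Omega> v M F u \<longleftrightarrow>
    u \<in> competitors p \<Omega> v M \<and> integrable (lebesgue_on \<Omega>) (energy_density p \<epsilon> \<Omega> F u) \<and>
    (\<forall>w\<in>competitors p \<Omega> v M. integrable (lebesgue_on \<Omega>) (energy_density p \<epsilon> \<Omega> F w) \<longrightarrow>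
      (LINT \<xi>|lebesgue_on \<Omega>. energy_density p \<epsilon> \<Omega> F u \<xi>)
        \<le> (LINT \<xi>|lebesgue_on \<Omega>. energy_density p \<epsilon> \<Omega> F w \<xi>))"

text \<open>The \<open>F'\<close> below is the partial derivative of \<open>F\<close> in \<open>r\<close> (one-sided at \<open>r = \<plusminus>M\<close>).\<close>

definition admissible_integrand ::
    "real \<Rightarrow> real \<Rightarrow> 'n::finite heis set \<Rightarrow> ('n heis \<Rightarrow> real) \<Rightarrow> real \<Rightarrow>
      (real \<Rightarrow> 'n heis \<Rightarrow> real) \<Rightarrow> bool" where
  "admissible_integrand p \<epsilon> \<Omega> \<psi> M F \<longleftrightarrow>
    continuous_on ({-M..M} \<times> \<Omega>) (\<lambda>(r, \<xi>). F r \<xi>) \<and>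
    (\<forall>\<xi>\<in>\<Omega>. \<exists>F'. continuous_on {-M..M} F' \<and>
      (\<forall>r\<in>{-M..M}. ((\<lambda>r. F r \<xi>) has_real_derivative F' r) (at r within {-M..M}) \<and>
        0 \<le> F' r \<and> F' r \<le> obstacle_bound p \<epsilon> \<psi> \<xi>))"

text \<open>The membership \<open>u_inf \<in> W1p p \<Omega>\<close> in the conclusion makes the weak gradient of \<open>u_inf\<close> and the
  integrals containing it meaningful.\<close>

definition LS_exponents :: "('n::finite heis \<Rightarrow> real) \<Rightarrow> 'n heis set \<Rightarrow> real set" where
  "LS_exponents \<psi> \<Omega> = {p. 1 < p \<and>
    (\<forall>\<epsilon>>0. \<forall>v\<in>W1p p \<Omega>. \<forall>M>0. \<forall>(F :: nat \<Rightarrow> real \<Rightarrow> 'n heis \<Rightarrow> real) u u_inf.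
      (\<forall>k. admissible_integrand p \<epsilon> \<Omega> \<psi> M (F k)) \<longrightarrow>
      (\<forall>k. is_minimizer p \<epsilon> \<Omega> v M (F k) (u k)) \<longrightarrow>
      uniform_limit \<Omega> u u_inf sequentially \<longrightarrow>
      u_inf \<in> W1p p \<Omega> \<and>
      (\<forall>\<phi>\<in>test_functions \<Omega>. (\<forall>\<xi>. 0 \<le> \<phi> \<xi>) \<longrightarrow>
        0 \<le> - (LINT \<xi>|lebesgue_on \<Omega>. flux p \<epsilon> (weak_hgrad \<Omega> u_inf \<xi>) \<bullet> hgrad \<phi> \<xi>) \<and>
        - (LINT \<xi>|lebesgue_on \<Omega>. flux p \<epsilon> (weak_hgrad \<Omega> u_inf \<xi>) \<bullet> hgrad \<phi> \<xi>)
          \<le> (LINT \<xi>|lebesgue_on \<Omega>. obstacle_bound p \<epsilon> \<psi> \<xi> * \<phi> \<xi>)))}"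

end

theory Submission
  imports Defs
begin

text \<open>For \<open>p = 2\<close> the flux is the identity. Let \<open>u\<close> be a minimizer for \<open>F\<close> and \<open>\<phi> \<ge> 0\<close> a test function.
  The competitors \<open>max (u - t\<phi>) (- M)\<close> and \<open>min (u + t\<phi>) M\<close> respect the constraint \<open>\<bar>u\<bar> \<le> M\<close>, and
  truncation does not increase the Dirichlet energy. As \<open>0 \<le> \<partial>\<^sub>r F \<le> h\<close>, comparing energies and letting
  \<open>t \<rightarrow> 0\<close> gives \<open>0 \<le> - \<integral> \<nabla>u \<bullet> \<nabla>\<phi> \<le> \<integral> h\<phi>\<close> for every minimizer. Testing two minimizers with their
  midpoint, the parallelogram law bounds \<open>\<integral> \<bar>\<nabla>u\<^sub>k - \<nabla>u\<^sub>m\<bar>\<^sup>2\<close> by a multiple of \<open>sup \<bar>u\<^sub>k - u\<^sub>m\<bar>\<close>, so the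
  gradients converge strongly in \<open>L\<^sup>2\<close> and the bounds pass to the limit.

  That the truncated functions are competitors is proved by convolution on the group, which commutes
  with the left invariant fields: no commutator estimate is needed.\<close>

section \<open>The group law and Lebesgue measure\<close>

text \<open>No convergence of the \<open>F k\<close> or of their derivatives is assumed, so there is
  no Euler-Lagrange equation to pass to the limit. What survives is a pair of inequalities that
  holds for every minimizer with the same h. For the same reason two minimizers solve different
  problems, and each is compared with the midpoint in its own functional. The cost of this is a
  bound on increments of F, uniform in k because h is continuous and \<Omega> is bounded.

  The kernel of the convolution is evaluated at the product of \<xi> with the inverse of \<zeta>, so
  that left translates of f are averaged, and these commute with the fields. The coefficients of the
  fields depend on the point, which is what would create a commutator in Euclidean mollification.
  The flow of a field is a right translation. Invariance of Lebesgue measure under left and right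
  translations therefore supplies both the substitutions in convolutions and the integration by
  parts.

  For p = 2 the Dirichlet energy along u - t\<phi> is a quadratic polynomial in t, so the limit in t
  is elementary algebra.\<close>

definition hmul :: "'n::finite heis \<Rightarrow> 'n heis \<Rightarrow> 'n heis" where
  "hmul a b = (fst a + fst b, fst (snd a) + fst (snd b),
     snd (snd a) + snd (snd b) + 2 * (fst b \<bullet> fst (snd a) - fst a \<bullet> fst (snd b)))"

lemma hmul_assoc: "hmul (hmul a b) c = hmul a (hmul b c)"
  by (simp add: hmul_def algebra_simps inner_add_left inner_add_right)

lemma hmul_0 [simp]: "hmul 0 a = a" "hmul a 0 = a"
  by (simp_all add: hmul_def)

text \<open>The central term of the group law is antisymmetric and vanishes on the pair a, - a.
  Group inverses are thus Euclidean negatives, and \<open>- a\<close> serves as the inverse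
  throughout.\<close>

lemma hmul_minus [simp]: "hmul a (- a) = 0" "hmul (- a) a = 0"
  by (simp_all add: hmul_def inner_commute prod_eq_iff)

lemma minus_hmul: "- hmul a b = hmul (- b) (- a)"
  by (simp add: hmul_def prod_eq_iff algebra_simps inner_commute)

lemma hmul_cancel [simp]: "hmul (- a) (hmul a b) = b" "hmul a (hmul (- a) b) = b"
  by (simp_all flip: hmul_assoc)

lemma continuous_on_hmul [continuous_intros]:
  "continuous_on S f \<Longrightarrow> continuous_on S g \<Longrightarrow> continuous_on S (\<lambda>x. hmul (f x) (g x))"
  unfolding hmul_def by (intro continuous_intros)

lemma borel_measurable_hmul [measurable]:
  "f \<in> borel_measurable M \<Longrightarrow> g \<in> borel_measurable M \<Longrightarrow>
    (\<lambda>x. hmul (f x) (g x)) \<in> borel_measurable M"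
  by (rule borel_measurable_continuous_on[of "\<lambda>p. hmul (fst p) (snd p)" "\<lambda>x. (f x, g x)", simplified])
    (auto intro!: continuous_intros borel_measurable_Pair)

text \<open>Invariance is phrased through the image measure, so that integrals are transported
  without injectivity or a Jacobian, and compositions reduce to \<open>distr_distr\<close>.\<close>

definition mpres :: "('a::euclidean_space \<Rightarrow> 'a) \<Rightarrow> bool" where
  "mpres T \<longleftrightarrow> T \<in> borel_measurable borel \<and> distr lborel borel T = lborel"

lemma mpres_comp:
  assumes "mpres S" "mpres T"
  shows "mpres (\<lambda>x. S (T x))"
proof -
  have [measurable]: "S \<in> borel_measurable borel" "T \<in> borel_measurable borel"
    using assms by (auto simp: mpres_def)
  have "distr lborel borel (S \<circ> T) = distr (distr lborel borel T) borel S"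
    by (subst distr_distr) auto
  then show ?thesis using assms by (simp add: mpres_def o_def)
qed

lemma
  fixes F :: "'a::euclidean_space \<Rightarrow> ennreal" and f :: "'a \<Rightarrow> real"
  assumes T: "mpres T"
  shows nn_integral_mpres: "F \<in> borel_measurable borel \<Longrightarrow>
      (\<integral>\<^sup>+x. F (T x) \<partial>lborel) = (\<integral>\<^sup>+x. F x \<partial>lborel)"
    and integrable_mpres: "integrable lborel f \<Longrightarrow> integrable lborel (\<lambda>x. f (T x))"
    and integral_mpres: "f \<in> borel_measurable borel \<Longrightarrow>
      (LINT x|lborel. f (T x)) = (LINT x|lborel. f x)"
proof -
  have [measurable]: "T \<in> borel_measurable borel" and D: "distr lborel borel T = lborel"
    using assms by (auto simp: mpres_def)
  show "(\<integral>\<^sup>+x. F (T x) \<partial>lborel) = (\<integral>\<^sup>+x. F x \<partial>lborel)" if [measurable]: "F \<in> borel_measurable borel"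
    using nn_integral_distr[of T lborel borel F] D by simp
  show "integrable lborel (\<lambda>x. f (T x))" if "integrable lborel f"
    using integrable_distr[of T lborel borel f] D that by simp
  show "(LINT x|lborel. f (T x)) = (LINT x|lborel. f x)" if [measurable]: "f \<in> borel_measurable borel"
    using integral_distr[of T lborel borel f] D by simp
qed

lemma mpres_plus: "mpres (\<lambda>x. x + c)"
  using lborel_distr_plus[of c] by (simp add: mpres_def add.commute[of _ c])

lemma mpres_uminus: "mpres uminus"
  using lborel_affine[of "-1" "0::'a::euclidean_space"] by (simp add: mpres_def density_1)

lemma nn_integral_heis:
  fixes F :: "'n::finite heis \<Rightarrow> ennreal"
  assumes [measurable]: "F \<in> borel_measurable borel"
  shows "(\<integral>\<^sup>+\<xi>. F \<xi> \<partial>lborel) = (\<integral>\<^sup>+x. \<integral>\<^sup>+y. \<integral>\<^sup>+t. F (x, y, t) \<partial>lborel \<partial>lborel \<partial>lborel)"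
proof -
  have "(\<integral>\<^sup>+\<xi>. F \<xi> \<partial>lborel) = (\<integral>\<^sup>+x. \<integral>\<^sup>+z. F (x, z) \<partial>lborel \<partial>lborel)"
    by (subst lborel.nn_integral_fst) (simp_all add: lborel_prod)
  also have "\<dots> = (\<integral>\<^sup>+x. \<integral>\<^sup>+y. \<integral>\<^sup>+t. F (x, y, t) \<partial>lborel \<partial>lborel \<partial>lborel)"
  proof (rule nn_integral_cong)
    fix x :: "real ^ 'n"
    have "(\<lambda>z. F (x, z)) \<in> borel_measurable borel" by measurable
    then show "(\<integral>\<^sup>+z. F (x, z) \<partial>lborel) = (\<integral>\<^sup>+y. \<integral>\<^sup>+t. F (x, y, t) \<partial>lborel \<partial>lborel)"
      by (subst lborel.nn_integral_fst[where f="\<lambda>z. F (x, z)"]) (simp_all add: lborel_prod)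
  qed
  finally show ?thesis .
qed

text \<open>With t integrated first, the increment \<open>c x y\<close> is a constant translation of
  the line; the remaining two integrals are translated by a and b. Left and right multiplication are
  both of this form and differ only in the sign of the central term.\<close>

lemma mpres_shear:
  fixes c :: "real ^ 'n::finite \<Rightarrow> real ^ 'n \<Rightarrow> real"
  assumes c: "continuous_on UNIV (\<lambda>z. c (fst z) (snd z))"
  shows "mpres (\<lambda>\<xi>. (fst \<xi> + a, fst (snd \<xi>) + b, snd (snd \<xi>) + c (fst \<xi>) (fst (snd \<xi>))))"
    (is "mpres ?T")
proof -
  have "continuous_on UNIV (\<lambda>\<xi>::'n heis. c (fst \<xi>) (fst (snd \<xi>)))"
    by (rule continuous_on_compose2[OF c, of _ "\<lambda>\<xi>. (fst \<xi>, fst (snd \<xi>))", simplified])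
      (intro continuous_intros)
  then have "continuous_on UNIV ?T" by (intro continuous_intros)
  then have T[measurable]: "?T \<in> borel_measurable borel"
    by (rule borel_measurable_continuous_onI)
  have *: "(\<integral>\<^sup>+\<xi>. F (?T \<xi>) \<partial>lborel) = (\<integral>\<^sup>+\<xi>. F \<xi> \<partial>lborel)" if [measurable]: "F \<in> borel_measurable borel" for F
  proof -
    have "(\<integral>\<^sup>+\<xi>. F (?T \<xi>) \<partial>lborel)
      = (\<integral>\<^sup>+x. \<integral>\<^sup>+y. \<integral>\<^sup>+t. F (x + a, y + b, t + c x y) \<partial>lborel \<partial>lborel \<partial>lborel)"
      by (subst nn_integral_heis) auto
    also have "\<dots> = (\<integral>\<^sup>+x. \<integral>\<^sup>+y. \<integral>\<^sup>+t. F (x + a, y + b, t) \<partial>lborel \<partial>lborel \<partial>lborel)"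
    proof (rule nn_integral_cong, rule nn_integral_cong)
      fix x y :: "real ^ 'n"
      show "(\<integral>\<^sup>+t. F (x + a, y + b, t + c x y) \<partial>lborel) = (\<integral>\<^sup>+t. F (x + a, y + b, t) \<partial>lborel)"
        by (rule nn_integral_mpres[OF mpres_plus]) measurable
    qed
    also have "\<dots> = (\<integral>\<^sup>+x. \<integral>\<^sup>+y. \<integral>\<^sup>+t. F (x + a, y, t) \<partial>lborel \<partial>lborel \<partial>lborel)"
    proof (rule nn_integral_cong)
      fix x :: "real ^ 'n"
      show "(\<integral>\<^sup>+y. \<integral>\<^sup>+t. F (x + a, y + b, t) \<partial>lborel \<partial>lborel) = (\<integral>\<^sup>+y. \<integral>\<^sup>+t. F (x + a, y, t) \<partial>lborel \<partial>lborel)"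
        by (rule nn_integral_mpres[OF mpres_plus]) measurable
    qed
    also have "\<dots> = (\<integral>\<^sup>+x. \<integral>\<^sup>+y. \<integral>\<^sup>+t. F (x, y, t) \<partial>lborel \<partial>lborel \<partial>lborel)"
      by (rule nn_integral_mpres[OF mpres_plus]) measurable
    also have "\<dots> = (\<integral>\<^sup>+\<xi>. F \<xi> \<partial>lborel)"
      by (subst nn_integral_heis) auto
    finally show ?thesis .
  qed
  have "distr lborel borel ?T = lborel"
  proof (rule measure_eqI)
    fix A assume "A \<in> sets (distr lborel borel ?T)"
    then have A[measurable]: "A \<in> sets borel" by simp
    have "emeasure (distr lborel borel ?T) A = emeasure lborel (?T -` A)"
      by (subst emeasure_distr) auto
    also have "\<dots> = (\<integral>\<^sup>+\<xi>. indicator (?T -` A) \<xi> \<partial>lborel)"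
      using measurable_sets[OF T A] by (subst nn_integral_indicator) auto
    also have "\<dots> = (\<integral>\<^sup>+\<xi>. indicator A (?T \<xi>) \<partial>lborel)"
      by (intro nn_integral_cong) (auto simp: indicator_def)
    also have "\<dots> = (\<integral>\<^sup>+\<xi>. indicator A \<xi> \<partial>lborel)" by (rule *) measurable
    finally show "emeasure (distr lborel borel ?T) A = emeasure lborel A" by simp
  qed simp
  then show ?thesis using T by (simp add: mpres_def)
qed

lemma mpres_hmul_left: "mpres (hmul a)"
proof -
  have "mpres (\<lambda>\<xi>. (fst \<xi> + fst a, fst (snd \<xi>) + fst (snd a), snd (snd \<xi>) +
      (snd (snd a) + 2 * (fst \<xi> \<bullet> fst (snd a) - fst a \<bullet> fst (snd \<xi>)))))"
    by (rule mpres_shear) (intro continuous_intros)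
  also have "(\<lambda>\<xi>. (fst \<xi> + fst a, fst (snd \<xi>) + fst (snd a), snd (snd \<xi>) +
      (snd (snd a) + 2 * (fst \<xi> \<bullet> fst (snd a) - fst a \<bullet> fst (snd \<xi>))))) = hmul a"
    by (auto simp: hmul_def fun_eq_iff)
  finally show ?thesis .
qed

lemma mpres_hmul_right: "mpres (\<lambda>\<xi>. hmul \<xi> a)"
proof -
  have "mpres (\<lambda>\<xi>. (fst \<xi> + fst a, fst (snd \<xi>) + fst (snd a), snd (snd \<xi>) +
      (snd (snd a) + 2 * (fst a \<bullet> fst (snd \<xi>) - fst \<xi> \<bullet> fst (snd a)))))"
    by (rule mpres_shear) (intro continuous_intros)
  also have "(\<lambda>\<xi>. (fst \<xi> + fst a, fst (snd \<xi>) + fst (snd a), snd (snd \<xi>) +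
      (snd (snd a) + 2 * (fst a \<bullet> fst (snd \<xi>) - fst \<xi> \<bullet> fst (snd a))))) = (\<lambda>\<xi>. hmul \<xi> a)"
    by (auto simp: hmul_def fun_eq_iff)
  finally show ?thesis .
qed

lemma mpres_hmul_uminus: "mpres (\<lambda>\<zeta>. hmul a (- \<zeta>))" "mpres (\<lambda>\<zeta>. hmul (- \<zeta>) a)"
  by (rule mpres_comp[OF mpres_hmul_left mpres_uminus], rule mpres_comp[OF mpres_hmul_right mpres_uminus])

section \<open>Continuity of translations\<close>

text \<open>Left translation by a small element moves all points of a compact set by a uniformly
  small amount, although it is not a Euclidean isometry.\<close>

lemma hmul_compact_subset_open:
  fixes K :: "'n::finite heis set"
  assumes "compact K" "open U" "K \<subseteq> U"
  obtains d where "d > 0" "\<And>\<eta> \<xi>. norm \<eta> < d \<Longrightarrow> \<xi> \<in> K \<Longrightarrow> hmul \<eta> \<xi> \<in> U"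
proof (cases "K = {}")
  case True
  then show ?thesis using that[of 1] by auto
next
  case False
  obtain e where e: "e > 0" "(\<Union>x\<in>K. ball x e) \<subseteq> U"
    using compact_subset_open_imp_ball_epsilon_subset[OF assms] by auto
  \<comment> \<open>Restricting the translations to the closed unit ball makes the domain compact;
    this is why the radius below is \<open>min d 1\<close>.\<close>
  have "uniformly_continuous_on (cball 0 1 \<times> K) (\<lambda>z. hmul (fst z) (snd z))"
    using assms(1) by (intro compact_uniformly_continuous continuous_intros compact_Times) auto
  from this[unfolded uniformly_continuous_on_def, rule_format, OF e(1)]
  obtain d where d: "d > 0" "\<And>z w. z \<in> cball 0 1 \<times> K \<Longrightarrow> w \<in> cball 0 1 \<times> K \<Longrightarrow> dist w z < d \<Longrightarrow>
    dist (hmul (fst w) (snd w)) (hmul (fst z) (snd z)) < e" by auto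
  show ?thesis
  proof (rule that[of "min d 1"])
    fix \<eta> \<xi> :: "'n heis" assume *: "norm \<eta> < min d 1" "\<xi> \<in> K"
    then have "dist (hmul \<eta> \<xi>) (hmul 0 \<xi>) < e"
      using d(2)[of "(0, \<xi>)" "(\<eta>, \<xi>)"] by (simp add: dist_Pair_Pair)
    then show "hmul \<eta> \<xi> \<in> U" using e(2) * by (force simp: dist_commute)
  qed (use d in auto)
qed

lemma compact_open_approx:
  fixes A :: "'a::euclidean_space set"
  assumes A[measurable]: "A \<in> sets borel" and fin: "emeasure lborel A < \<infinity>" and e: "e > (0::real)"
  obtains K U where "compact K" "open U" "K \<subseteq> A" "A \<subseteq> U" "emeasure lborel (U - K) < e"
proof -
  obtain U where U: "open U" "A \<subseteq> U" "emeasure lborel (U - A) < ennreal (e/2)"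
    using outer_regular_lborel[OF A, of "e/2"] e by auto
  \<comment> \<open>Inner regularity is applied to a finite measure, so Lebesgue measure is first
    cut down to A.\<close>
  define M where "M = density lborel (indicator A :: 'a \<Rightarrow> ennreal)"
  have eM: "emeasure M X = emeasure lborel (A \<inter> X)" if "X \<in> sets borel" for X
    using that by (auto simp: M_def emeasure_density indicator_inter_arith[symmetric])
  have "emeasure M (space M) \<noteq> \<infinity>" using fin eM[of UNIV] by (simp add: M_def)
  from inner_regular[OF _ this A]
  have eq: "emeasure lborel A = (SUP K\<in>{K. K \<subseteq> A \<and> compact K}. emeasure M K)"
    by (simp add: eM) (simp add: M_def)
  have "\<exists>K. K \<subseteq> A \<and> compact K \<and> emeasure lborel (A - K) < ennreal (e/2)"
  proof (cases "emeasure lborel A = 0")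
    \<comment> \<open>For a null set, subtracting e/2 gives nothing strictly below its measure, so
      the supremum argument is reserved for the other case.\<close>
    case True
    then show ?thesis using e by (intro exI[of _ "{}"]) auto
  next
    case False
    then have "emeasure lborel A - ennreal (e/2) < emeasure lborel A"
      using e fin by (intro ennreal_between) (auto simp: zero_less_iff_neq_zero)
    then obtain K where K: "K \<subseteq> A" "compact K" "emeasure lborel A - ennreal (e/2) < emeasure M K"
      unfolding eq by (subst (asm) less_SUP_iff) auto
    have [measurable]: "K \<in> sets borel" using K(2) by (simp add: borel_compact)
    have 1: "emeasure lborel A - ennreal (e/2) < emeasure lborel K"
      using K eM[of K] by (simp add: Int_absorb1)
    have "emeasure lborel K \<le> emeasure lborel A" using K by (intro emeasure_mono) auto
    then have kf: "emeasure lborel K < \<infinity>" using fin by auto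
    have "emeasure lborel (A - K) = emeasure lborel A - emeasure lborel K"
      using K kf by (intro emeasure_Diff) auto
    also have "\<dots> < ennreal (e/2)"
    proof -
      obtain a where a: "emeasure lborel A = ennreal a" "a \<ge> 0" using fin by (cases "emeasure lborel A") auto
      obtain k where k: "emeasure lborel K = ennreal k" "k \<ge> 0" using kf by (cases "emeasure lborel K") auto
      have "ennreal (a - e / 2) < ennreal k" using 1 a k e by (simp add: ennreal_minus)
      then have "a - e / 2 < k" by (metis ennreal_leI not_le)
      then show ?thesis using a k e by (auto simp: ennreal_minus intro!: ennreal_lessI)
    qed
    finally show ?thesis using K by auto
  qed
  then obtain K where K: "K \<subseteq> A" "compact K" "emeasure lborel (A - K) < ennreal (e/2)" by auto
  have [measurable]: "K \<in> sets borel" "U \<in> sets borel" using K U by (auto simp: borel_compact)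
  have "emeasure lborel (U - K) \<le> emeasure lborel ((U - A) \<union> (A - K))" by (intro emeasure_mono) auto
  also have "\<dots> \<le> emeasure lborel (U - A) + emeasure lborel (A - K)"
    by (intro emeasure_subadditive) auto
  also have "\<dots> < ennreal (e/2) + ennreal (e/2)" by (intro add_strict_mono U K)
  also have "\<dots> = ennreal e" using e by (simp flip: ennreal_plus)
  finally show ?thesis using that K U by auto
qed

text \<open>For an indicator, A and its translate can differ only where the point or its image lies
  in the thin layer between a compact inner and an open outer approximation. Sums and dominated
  limits follow because translations are isometries of L1.\<close>

lemma L1_translation_continuous:
  fixes f :: "'n::finite heis \<Rightarrow> real"
  assumes "integrable lborel f" "e > 0"
  shows "\<exists>d>0. \<forall>\<eta>. norm \<eta> < d \<longrightarrow> (LINT \<xi>|lborel. \<bar>f (hmul \<eta> \<xi>) - f \<xi>\<bar>) < e"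
  using assms
proof (induction arbitrary: e rule: integrable_induct)
  case (base A c)
  then have A[measurable]: "A \<in> sets borel" by simp
  \<comment> \<open>The layer U - K is counted twice, once translated, and is weighted by |c|; the
    added 1 keeps the quotient defined for c = 0.\<close>
  obtain K U where KU: "compact K" "open U" "K \<subseteq> A" "A \<subseteq> U"
      "emeasure lborel (U - K) < ennreal (e / (2 * (\<bar>c\<bar> + 1)))"
    using compact_open_approx[OF A, of "e / (2 * (\<bar>c\<bar> + 1))"] base by auto
  have [measurable]: "K \<in> sets borel" "U \<in> sets borel" using KU by (auto simp: borel_compact)
  have fin: "emeasure lborel (U - K) < \<infinity>" using KU(5) less_trans by fastforce
  then have m: "measure lborel (U - K) < e / (2 * (\<bar>c\<bar> + 1))"
    using KU(5) base(3) by (simp add: emeasure_eq_ennreal_measure ennreal_less_iff)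
  obtain d where d: "d > 0" "\<And>\<eta> \<xi>. norm \<eta> < d \<Longrightarrow> \<xi> \<in> K \<Longrightarrow> hmul \<eta> \<xi> \<in> U"
    using hmul_compact_subset_open[OF KU(1,2)] KU by (metis subset_trans)
  let ?I = "indicator (U - K) :: 'n heis \<Rightarrow> real"
  have I: "integrable lborel ?I" using fin by auto
  show ?case
  proof (intro exI[of _ d] conjI allI impI)
    fix \<eta> :: "'n heis" assume \<eta>: "norm \<eta> < d"
    have *: "\<bar>indicator A (hmul \<eta> \<xi>) *\<^sub>R c - indicator A \<xi> *\<^sub>R c\<bar> \<le> \<bar>c\<bar> * (?I (hmul \<eta> \<xi>) + ?I \<xi>)" for \<xi>
    proof -
      have 1: "\<xi> \<in> K \<Longrightarrow> hmul \<eta> \<xi> \<in> U" using d \<eta> by auto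
      \<comment> \<open>The inverse translation - \<eta> has the same norm, so it also carries K
        into U.\<close>
      have 2: "hmul \<eta> \<xi> \<in> K \<Longrightarrow> \<xi> \<in> U" using d(2)[of "- \<eta>" "hmul \<eta> \<xi>"] \<eta> by auto
      have "\<bar>indicator A (hmul \<eta> \<xi>) - indicator A \<xi> :: real\<bar> \<le> ?I (hmul \<eta> \<xi>) + ?I \<xi>"
        using 1 2 KU by (auto simp: indicator_def)
      then have "\<bar>c\<bar> * \<bar>indicator A (hmul \<eta> \<xi>) - indicator A \<xi> :: real\<bar> \<le> \<bar>c\<bar> * (?I (hmul \<eta> \<xi>) + ?I \<xi>)"
        by (intro mult_left_mono) auto
      then show ?thesis by (simp add: abs_mult[symmetric] algebra_simps)
    qed
    have I': "integrable lborel (\<lambda>\<xi>. ?I (hmul \<eta> \<xi>))"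
      using integrable_mpres[OF mpres_hmul_left I] .
    have "(LINT \<xi>|lborel. \<bar>indicator A (hmul \<eta> \<xi>) *\<^sub>R c - indicator A \<xi> *\<^sub>R c\<bar>)
        \<le> (LINT \<xi>|lborel. \<bar>c\<bar> * (?I (hmul \<eta> \<xi>) + ?I \<xi>))"
      using * I I' by (intro integral_mono') auto
    also have "\<dots> = \<bar>c\<bar> * (measure lborel (U - K) + measure lborel (U - K))"
      using I I' integral_mpres[OF mpres_hmul_left, of ?I \<eta>] by simp
    also have "\<dots> \<le> (\<bar>c\<bar> + 1) * (2 * measure lborel (U - K))"
      by (simp add: algebra_simps)
    also have "\<dots> < (\<bar>c\<bar> + 1) * (2 * (e / (2 * (\<bar>c\<bar> + 1))))"
      using m by (intro mult_strict_left_mono) auto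
    also have "\<dots> = e" by (simp add: field_simps)
    finally show "(LINT \<xi>|lborel. \<bar>indicator A (hmul \<eta> \<xi>) *\<^sub>R c - indicator A \<xi> *\<^sub>R c\<bar>) < e" .
  qed (use d in auto)
next
  case (add f g)
  obtain d1 where d1: "d1 > 0" "\<And>\<eta>. norm \<eta> < d1 \<Longrightarrow> (LINT \<xi>|lborel. \<bar>f (hmul \<eta> \<xi>) - f \<xi>\<bar>) < e / 2"
    using add.IH(1)[of "e/2"] add.prems by auto
  obtain d2 where d2: "d2 > 0" "\<And>\<eta>. norm \<eta> < d2 \<Longrightarrow> (LINT \<xi>|lborel. \<bar>g (hmul \<eta> \<xi>) - g \<xi>\<bar>) < e / 2"
    using add.IH(2)[of "e/2"] add.prems by auto
  show ?case
  proof (intro exI[of _ "min d1 d2"] conjI allI impI)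
    fix \<eta> :: "'n heis" assume \<eta>: "norm \<eta> < min d1 d2"
    have I: "integrable lborel (\<lambda>\<xi>. \<bar>f (hmul \<eta> \<xi>) - f \<xi>\<bar>)" "integrable lborel (\<lambda>\<xi>. \<bar>g (hmul \<eta> \<xi>) - g \<xi>\<bar>)"
      using integrable_mpres[OF mpres_hmul_left add(1)] integrable_mpres[OF mpres_hmul_left add(2)] add(1,2)
      by auto
    have "(LINT \<xi>|lborel. \<bar>f (hmul \<eta> \<xi>) + g (hmul \<eta> \<xi>) - (f \<xi> + g \<xi>)\<bar>)
       \<le> (LINT \<xi>|lborel. \<bar>f (hmul \<eta> \<xi>) - f \<xi>\<bar> + \<bar>g (hmul \<eta> \<xi>) - g \<xi>\<bar>)"
      using I by (intro integral_mono') auto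
    also have "\<dots> = (LINT \<xi>|lborel. \<bar>f (hmul \<eta> \<xi>) - f \<xi>\<bar>) + (LINT \<xi>|lborel. \<bar>g (hmul \<eta> \<xi>) - g \<xi>\<bar>)"
      using I by simp
    finally show "(LINT \<xi>|lborel. \<bar>f (hmul \<eta> \<xi>) + g (hmul \<eta> \<xi>) - (f \<xi> + g \<xi>)\<bar>) < e"
      using d1(2)[of \<eta>] d2(2)[of \<eta>] \<eta> by simp
  qed (use d1 d2 in auto)
next
  case (lim f s)
  have fb[measurable]: "f \<in> borel_measurable borel" "\<And>i. s i \<in> borel_measurable borel"
    using lim(1,4) by auto
  have "(\<lambda>i. LINT \<xi>|lborel. \<bar>s i \<xi> - f \<xi>\<bar>) \<longlonglongrightarrow> (LINT \<xi>::'n heis|lborel. 0)"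
  \<comment> \<open>The approximants of the induction rule satisfy |s i| \<le> 2|f|, hence the
    factor 3.\<close>
  proof (rule integral_dominated_convergence[where w="\<lambda>\<xi>. 3 * \<bar>f \<xi>\<bar>"])
    have "(\<lambda>i. \<bar>s i \<xi> - f \<xi>\<bar>) \<longlonglongrightarrow> \<bar>f \<xi> - f \<xi>\<bar>" for \<xi>
      using lim(2)[of \<xi>] by (intro tendsto_intros) auto
    then show "AE \<xi> in lborel. (\<lambda>i. \<bar>s i \<xi> - f \<xi>\<bar>) \<longlonglongrightarrow> 0" by simp
    show "AE \<xi> in lborel. norm \<bar>s i \<xi> - f \<xi>\<bar> \<le> 3 * \<bar>f \<xi>\<bar>" for i
    proof (rule AE_I2)
      fix \<xi> show "norm \<bar>s i \<xi> - f \<xi>\<bar> \<le> 3 * \<bar>f \<xi>\<bar>"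
        using lim(3)[of \<xi> i] by simp
    qed
  qed (use lim in auto)
  then have "\<forall>\<^sub>F i in sequentially. (LINT \<xi>|lborel. \<bar>s i \<xi> - f \<xi>\<bar>) < e / 3"
    by (rule order_tendstoD(2)) (use lim.prems in simp)
  then obtain i where i: "(LINT \<xi>|lborel. \<bar>s i \<xi> - f \<xi>\<bar>) < e / 3"
    by (auto simp: eventually_sequentially)
  obtain d where d: "d > 0" "\<And>\<eta>. norm \<eta> < d \<Longrightarrow> (LINT \<xi>|lborel. \<bar>s i (hmul \<eta> \<xi>) - s i \<xi>\<bar>) < e / 3"
    using lim(5)[of "e/3" i] lim.prems by auto
  show ?case
  proof (intro exI[of _ d] conjI allI impI)
    fix \<eta> :: "'n heis" assume \<eta>: "norm \<eta> < d"
    have I: "integrable lborel (\<lambda>\<xi>. \<bar>s i \<xi> - f \<xi>\<bar>)" using lim(1)[of i] lim(4) by simp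
    have I': "integrable lborel (\<lambda>\<xi>. \<bar>s i (hmul \<eta> \<xi>) - f (hmul \<eta> \<xi>)\<bar>)"
      by (rule integrable_mpres[OF mpres_hmul_left I])
    have eq: "(LINT \<xi>|lborel. \<bar>s i (hmul \<eta> \<xi>) - f (hmul \<eta> \<xi>)\<bar>) = (LINT \<xi>|lborel. \<bar>s i \<xi> - f \<xi>\<bar>)"
      by (rule integral_mpres[OF mpres_hmul_left, of "\<lambda>\<xi>. \<bar>s i \<xi> - f \<xi>\<bar>"]) measurable
    have J: "integrable lborel (\<lambda>\<xi>. \<bar>s i (hmul \<eta> \<xi>) - s i \<xi>\<bar>)"
      using integrable_mpres[OF mpres_hmul_left lim(1)] lim(1) by auto
    have "(LINT \<xi>|lborel. \<bar>f (hmul \<eta> \<xi>) - f \<xi>\<bar>)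
       \<le> (LINT \<xi>|lborel. \<bar>s i (hmul \<eta> \<xi>) - f (hmul \<eta> \<xi>)\<bar> + \<bar>s i (hmul \<eta> \<xi>) - s i \<xi>\<bar> + \<bar>s i \<xi> - f \<xi>\<bar>)"
      using I I' J by (intro integral_mono' integrable_add) auto
    also have "\<dots> = (LINT \<xi>|lborel. \<bar>s i \<xi> - f \<xi>\<bar>) + (LINT \<xi>|lborel. \<bar>s i (hmul \<eta> \<xi>) - s i \<xi>\<bar>)
       + (LINT \<xi>|lborel. \<bar>s i \<xi> - f \<xi>\<bar>)"
      using I I' J eq by simp
    also have "\<dots> < e" using i d(2)[OF \<eta>] by simp
    finally show "(LINT \<xi>|lborel. \<bar>f (hmul \<eta> \<xi>) - f \<xi>\<bar>) < e" .
  qed (use d in auto)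
qed

text \<open>The map \<open>a \<mapsto> a\<bar>a\<bar>\<close> reduces \<open>L\<^sup>2\<close> to \<open>L\<^sup>1\<close>.\<close>

lemma power2_diff_le_signed_square: "(a - b)\<^sup>2 \<le> 2 * \<bar>a * \<bar>a\<bar> - b * \<bar>b\<bar>\<bar>" for a b :: real
proof -
  \<comment> \<open>For equal signs, |a - b| \<le> |a + b|. For opposite signs the square of a sum
    is at most twice the sum of squares, which is where the factor 2 comes from.\<close>
  have pos: "(a - b)\<^sup>2 \<le> \<bar>a * a - b * b\<bar>" if "a \<ge> 0" "b \<ge> 0" for a b :: real
  proof -
    have "\<bar>a - b\<bar> * \<bar>a - b\<bar> \<le> \<bar>a - b\<bar> * \<bar>a + b\<bar>" using that by (intro mult_left_mono) auto
    then show ?thesis by (simp add: power2_eq_square abs_mult[symmetric] algebra_simps)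
  qed
  have neg: "(a + b)\<^sup>2 \<le> 2 * \<bar>a * a + b * b\<bar>" for a b :: real
    using zero_le_power2[of "a - b"] by (simp add: power2_eq_square algebra_simps)
  consider "a \<ge> 0" "b \<ge> 0" | "a \<ge> 0" "b < 0" | "a < 0" "b \<ge> 0" | "a < 0" "b < 0" by linarith
  then show ?thesis
  proof cases
    case 1 then show ?thesis using order_trans[OF pos[of a b], of "2 * \<bar>a * a - b * b\<bar>"] by simp
  next
    case 2 then show ?thesis using neg[of a "-b"] by simp
  next
    case 3 then show ?thesis using neg[of "a" "- b"] by (simp add: abs_if algebra_simps split: if_splits)
  next
    case 4 then show ?thesis using order_trans[OF pos[of "- a" "- b"], of "2 * \<bar>a * a - b * b\<bar>"]
      by (simp add: power2_commute abs_minus_commute)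
  qed
qed

lemma L2_translation_continuous:
  fixes f :: "'n::finite heis \<Rightarrow> real"
  assumes [measurable]: "f \<in> borel_measurable borel"
    and f2: "integrable lborel (\<lambda>\<xi>. (f \<xi>)\<^sup>2)" and e: "e > 0"
  shows "\<exists>d>0. \<forall>\<eta>. norm \<eta> < d \<longrightarrow> (LINT \<xi>|lborel. (f (hmul \<eta> \<xi>) - f \<xi>)\<^sup>2) < e"
proof -
  have q: "integrable lborel (\<lambda>\<xi>. f \<xi> * \<bar>f \<xi>\<bar>)"
    by (rule Bochner_Integration.integrable_bound[OF f2]) (auto simp: abs_mult power2_eq_square)
  \<comment> \<open>The halving pays for the factor 2 in
    \<open>power2_diff_le_signed_square\<close>.\<close>
  obtain d where d: "d > 0" "\<And>\<eta>. norm \<eta> < d \<Longrightarrow>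
      (LINT \<xi>|lborel. \<bar>f (hmul \<eta> \<xi>) * \<bar>f (hmul \<eta> \<xi>)\<bar> - f \<xi> * \<bar>f \<xi>\<bar>\<bar>) < e / 2"
    using L1_translation_continuous[OF q, of "e/2"] e by auto
  show ?thesis
  proof (intro exI[of _ d] conjI allI impI)
    fix \<eta> :: "'n heis" assume \<eta>: "norm \<eta> < d"
    have "integrable lborel (\<lambda>\<xi>. f (hmul \<eta> \<xi>) * \<bar>f (hmul \<eta> \<xi>)\<bar>)"
      by (rule integrable_mpres[OF mpres_hmul_left q])
    then have "(LINT \<xi>|lborel. (f (hmul \<eta> \<xi>) - f \<xi>)\<^sup>2)
      \<le> (LINT \<xi>|lborel. 2 * \<bar>f (hmul \<eta> \<xi>) * \<bar>f (hmul \<eta> \<xi>)\<bar> - f \<xi> * \<bar>f \<xi>\<bar>\<bar>)"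
      using q power2_diff_le_signed_square by (intro integral_mono') auto
    also have "\<dots> < e" using d(2)[OF \<eta>] by simp
    finally show "(LINT \<xi>|lborel. (f (hmul \<eta> \<xi>) - f \<xi>)\<^sup>2) < e" .
  qed (use d in auto)
qed

section \<open>Smooth functions\<close>

text \<open>Allows an explicit formula for the derivative to replace the choice operator in
  \<open>frechet_derivative\<close>, so that inductions on k can use that formula.\<close>

lemma Ck_SucI:
  assumes "\<And>x. (f has_derivative D x) (at x)" "\<And>v. Ck_on k UNIV (\<lambda>x. D x v)"
  shows "Ck_on (Suc k) UNIV f"
proof -
  have "frechet_derivative f (at x) = D x" for x
    using frechet_derivative_at[OF assms(1)] by simp
  then show ?thesis using assms by (auto simp: differentiable_def)
qed

lemma Ck_SucD:
  assumes "Ck_on (Suc k) UNIV f"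
  shows "(f has_derivative frechet_derivative f (at x)) (at x)"
    "Ck_on k UNIV (\<lambda>x. frechet_derivative f (at x) v)"
proof -
  have "f differentiable (at x)" using assms by simp
  then show "(f has_derivative frechet_derivative f (at x)) (at x)"
    by (simp only: frechet_derivative_works)
qed (use assms in simp)

lemma Ck_Suc_imp_Ck: "Ck_on (Suc k) UNIV f \<Longrightarrow> Ck_on k UNIV f"
proof (induction k arbitrary: f)
  case 0
  have "f differentiable (at x)" for x using 0 by simp
  then show ?case
    by (simp add: continuous_at_imp_continuous_on differentiable_imp_continuous_within)
next
  case (Suc k)
  show ?case
    by (rule Ck_SucI[OF Ck_SucD(1)[OF Suc.prems] Suc.IH[OF Ck_SucD(2)[OF Suc.prems]]])
qed

lemma Ck_add: "Ck_on k UNIV f \<Longrightarrow> Ck_on k UNIV g \<Longrightarrow> Ck_on k UNIV (\<lambda>x. f x + g x)"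
proof (induction k arbitrary: f g)
  case 0
  then show ?case by (auto intro: continuous_intros)
next
  case (Suc k)
  show ?case
    by (rule Ck_SucI, rule has_derivative_add, (rule Ck_SucD(1)[OF Suc.prems(1)] Ck_SucD(1)[OF Suc.prems(2)])+,
      rule Suc.IH, (rule Ck_SucD(2)[OF Suc.prems(1)] Ck_SucD(2)[OF Suc.prems(2)])+)
qed

lemma Ck_const: "Ck_on k UNIV (\<lambda>x. c)"
proof (induction k arbitrary: c)
  case (Suc k)
  show ?case by (rule Ck_SucI, rule has_derivative_const, rule Suc)
qed simp

lemma Ck_mult: "Ck_on k UNIV f \<Longrightarrow> Ck_on k UNIV g \<Longrightarrow> Ck_on k UNIV (\<lambda>x. f x * g x)"
proof (induction k arbitrary: f g)
  case 0
  then show ?case by (auto intro: continuous_intros)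
next
  case (Suc k)
  note p = Suc.prems
  show ?case
    by (rule Ck_SucI, rule has_derivative_mult, (rule Ck_SucD(1)[OF p(1)] Ck_SucD(1)[OF p(2)])+,
      rule Ck_add; rule Suc.IH)
      (rule Ck_Suc_imp_Ck[OF p(1)] Ck_Suc_imp_Ck[OF p(2)] Ck_SucD(2)[OF p(1)] Ck_SucD(2)[OF p(2)])+
qed

lemma Ck_sum: "finite I \<Longrightarrow> (\<And>i. i \<in> I \<Longrightarrow> Ck_on k UNIV (f i)) \<Longrightarrow> Ck_on k UNIV (\<lambda>x. \<Sum>i\<in>I. f i x)"
  by (induction I rule: finite_induct) (auto intro: Ck_const Ck_add)

lemma Ck_prod: "finite I \<Longrightarrow> (\<And>i. i \<in> I \<Longrightarrow> Ck_on k UNIV (f i)) \<Longrightarrow> Ck_on k UNIV (\<lambda>x. \<Prod>i\<in>I. f i x)"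
  by (induction I rule: finite_induct) (auto intro: Ck_const Ck_mult)

text \<open>The derivative L of A is the same at every point, so a derivative of the composite is
  again a function composed with A. The induction closes on itself.\<close>

lemma Ck_compose_affine:
  assumes A: "\<And>x. (A has_derivative L) (at x)"
  shows "Ck_on k UNIV f \<Longrightarrow> Ck_on k UNIV (\<lambda>x. f (A x))"
proof (induction k arbitrary: f)
  case 0
  have "continuous_on UNIV A"
    by (rule has_derivative_continuous_on[where f'="\<lambda>_. L"]) (use A in auto)
  with 0 show ?case
    by (auto intro: continuous_on_compose2)
next
  case (Suc k)
  show ?case
  proof (rule Ck_SucI)
    show "((\<lambda>x. f (A x)) has_derivative (\<lambda>v. frechet_derivative f (at (A x)) (L v))) (at x)" for x
      by (rule has_derivative_compose[OF A Ck_SucD(1)[OF Suc.prems]])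
    show "Ck_on k UNIV (\<lambda>x. frechet_derivative f (at (A x)) (L v))" for v
      by (rule Suc.IH[OF Ck_SucD(2)[OF Suc.prems]])
  qed
qed

text \<open>The span of these functions is closed under differentiation, so \<open>bump_fun 1\<close> is smooth.\<close>

definition bump_fun :: "real poly \<Rightarrow> real \<Rightarrow> real" where
  "bump_fun p s = (if s > 0 then poly p (1 / s) * exp (- (1 / s)) else 0)"

lemma poly_times_exp_minus_tendsto_0: "((\<lambda>x::real. poly p x * exp (- x)) \<longlongrightarrow> 0) at_top"
proof -
  have "((\<lambda>x::real. \<Sum>i\<le>degree p. coeff p i * (x ^ i / exp x)) \<longlongrightarrow> (\<Sum>i\<le>degree p. coeff p i * 0)) at_top"
    by (intro tendsto_intros tendsto_power_div_exp_0)
  moreover have "(\<lambda>x. \<Sum>i\<le>degree p. coeff p i * (x ^ i / exp x)) = (\<lambda>x::real. poly p x * exp (- x))"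
    by (auto simp: poly_altdef exp_minus sum_distrib_right sum_distrib_left divide_inverse mult_ac)
  ultimately show ?thesis by simp
qed

lemma bump_fun_tendsto_0: "(bump_fun p \<longlongrightarrow> 0) (at 0)"
proof -
  have "((\<lambda>s. poly p (inverse s) * exp (- inverse s)) \<longlongrightarrow> 0) (at_right (0::real))"
    by (rule filterlim_compose[OF poly_times_exp_minus_tendsto_0 filterlim_inverse_at_top_right])
  then have "(bump_fun p \<longlongrightarrow> 0) (at_right 0)"
    by (rule Lim_transform_eventually)
      (auto simp: bump_fun_def eventually_at_filter inverse_eq_divide)
  moreover have "(bump_fun p \<longlongrightarrow> 0) (at_left 0)"
    by (rule Lim_transform_eventually[OF tendsto_const]) (auto simp: bump_fun_def eventually_at_filter)
  ultimately show ?thesis by (simp add: filterlim_split_at_real)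
qed

text \<open>Differentiating p(1/s) exp(-1/s) produces the factor 1/s squared times p - p', both
  evaluated at 1/s. Only the point s = 0 needs an argument: all these functions tend to 0
  there.\<close>

lemma DERIV_bump_fun:
  "(bump_fun p has_real_derivative bump_fun ([:0, 0, 1:] * (p - pderiv p)) s) (at s)"
proof -
  consider "s > 0" | "s < 0" | "s = 0" by linarith
  then show ?thesis
  proof cases
    case 1
    have "((\<lambda>s. poly p (1 / s) * exp (- (1 / s))) has_real_derivative
       bump_fun ([:0, 0, 1:] * (p - pderiv p)) s) (at s)"
      using 1 by (auto intro!: derivative_eq_intros simp: bump_fun_def field_simps power2_eq_square)
    then show ?thesis
      by (rule has_field_derivative_transform_within_open[where S="{0<..}"]) (use 1 in \<open>auto simp: bump_fun_def\<close>)
  next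
    case 2
    then have "((\<lambda>s. 0) has_real_derivative bump_fun ([:0, 0, 1:] * (p - pderiv p)) s) (at s)"
      by (simp add: bump_fun_def)
    then show ?thesis
      by (rule has_field_derivative_transform_within_open[where S="{..<0}"]) (use 2 in \<open>auto simp: bump_fun_def\<close>)
  next
    case 3
    \<comment> \<open>Dividing by h multiplies the polynomial by its variable 1/h, so the difference
      quotient is again a \<open>bump_fun\<close>.\<close>
    have "((\<lambda>h. (bump_fun p (0 + h) - bump_fun p 0) / h) \<longlongrightarrow> 0) (at 0)"
      by (rule Lim_transform_eventually[OF bump_fun_tendsto_0[of "[:0, 1:] * p"]])
        (auto simp: bump_fun_def eventually_at_filter)
    then show ?thesis using 3 by (simp add: DERIV_def bump_fun_def)
  qed
qed

lemma Ck_bump_fun: "Ck_on k UNIV (bump_fun p)"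
proof (induction k arbitrary: p)
  case 0
  show ?case using DERIV_bump_fun[of p] DERIV_isCont continuous_at_imp_continuous_on by (auto intro!: continuous_at_imp_continuous_on)
next
  case (Suc k)
  show ?case
    by (rule Ck_SucI, rule DERIV_bump_fun[unfolded has_field_derivative_def])
      (intro Ck_mult Ck_const Suc)
qed

lemma bump_fun_1: "bump_fun 1 s \<ge> 0" "bump_fun 1 s > 0 \<longleftrightarrow> s > 0"
  by (auto simp: bump_fun_def)


section \<open>Smooth and compactly supported functions on the whole space\<close>

lemma smooth_CkD: "smooth_fun_on UNIV f \<Longrightarrow> Ck_on k UNIV f"
  by (simp add: smooth_fun_on_def)

lemma smooth_has_derivative:
  "smooth_fun_on UNIV f \<Longrightarrow> (f has_derivative frechet_derivative f (at x)) (at x)"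
  by (rule Ck_SucD(1)[OF smooth_CkD[of f "Suc 0"]])

lemma smooth_frechet: "smooth_fun_on UNIV f \<Longrightarrow> smooth_fun_on UNIV (\<lambda>x. frechet_derivative f (at x) v)"
  unfolding smooth_fun_on_def[of _ "\<lambda>x. frechet_derivative f (at x) v"]
  by (intro allI Ck_SucD(2) smooth_CkD)

lemma smooth_continuous: "smooth_fun_on UNIV f \<Longrightarrow> continuous_on UNIV f"
  using smooth_CkD[of f 0] by simp

lemma test_functionsI:
  assumes "smooth_fun_on UNIV \<phi>" "compact K" "K \<subseteq> \<Omega>" "\<And>x. x \<notin> K \<Longrightarrow> \<phi> x = 0"
  shows "\<phi> \<in> test_functions \<Omega>"
proof -
  have "closure {x. \<phi> x \<noteq> 0} \<subseteq> K"
    by (rule closure_minimal) (use assms compact_imp_closed in auto)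
  moreover from this have "compact (closure {x. \<phi> x \<noteq> 0})"
    using compact_Int_closed[OF assms(2) closed_closure[of "{x. \<phi> x \<noteq> 0}"]] by (simp add: Int_absorb1)
  ultimately show ?thesis using assms by (auto simp: test_functions_def)
qed

lemma test_functions_mono: "U \<subseteq> \<Omega> \<Longrightarrow> test_functions U \<subseteq> test_functions \<Omega>"
  by (auto simp: test_functions_def)

lemma test_smooth: "\<phi> \<in> test_functions \<Omega> \<Longrightarrow> smooth_fun_on UNIV \<phi>"
  by (simp add: test_functions_def)

lemma frechet_derivative_eq_0:
  assumes "closed K" "\<And>x. x \<notin> K \<Longrightarrow> f x = 0" "x \<notin> K"
  shows "frechet_derivative f (at x) = (\<lambda>_. 0)"
proof -
  have "(f has_derivative (\<lambda>_. 0)) (at x)"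
    by (rule has_derivative_transform_within_open[of "\<lambda>_. 0" _ _ _ "- K"]) (use assms in auto)
  then show ?thesis by (rule frechet_derivative_at[symmetric])
qed

lemma test_support:
  assumes "\<phi> \<in> test_functions \<Omega>"
  obtains K where "compact K" "K \<subseteq> \<Omega>" "\<And>x. x \<notin> K \<Longrightarrow> \<phi> x = 0"
    "\<And>x. x \<notin> K \<Longrightarrow> frechet_derivative \<phi> (at x) = (\<lambda>_. 0)"
proof (rule that[of "closure {x. \<phi> x \<noteq> 0}"])
  show 1: "\<phi> x = 0" if "x \<notin> closure {x. \<phi> x \<noteq> 0}" for x
    using that closure_subset[of "{x. \<phi> x \<noteq> 0}"] by auto
  show "frechet_derivative \<phi> (at x) = (\<lambda>_. 0)" if "x \<notin> closure {x. \<phi> x \<noteq> 0}" for x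
    using frechet_derivative_eq_0[OF closed_closure 1 that] by simp
qed (use assms in \<open>auto simp: test_functions_def\<close>)

lemma test_lincomb:
  assumes "\<phi> \<in> test_functions \<Omega>" "\<psi> \<in> test_functions \<Omega>"
  shows "(\<lambda>x. a * \<phi> x + b * \<psi> x) \<in> test_functions \<Omega>"
proof -
  obtain K where K: "compact K" "K \<subseteq> \<Omega>" "\<And>x. x \<notin> K \<Longrightarrow> \<phi> x = 0" by (rule test_support[OF assms(1)]) (rule that)
  obtain L where L: "compact L" "L \<subseteq> \<Omega>" "\<And>x. x \<notin> L \<Longrightarrow> \<psi> x = 0" by (rule test_support[OF assms(2)]) (rule that)
  have "smooth_fun_on UNIV (\<lambda>x. a * \<phi> x + b * \<psi> x)"
    unfolding smooth_fun_on_def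
    by (intro allI Ck_add Ck_mult Ck_const smooth_CkD test_smooth[OF assms(1)] test_smooth[OF assms(2)])
  then show ?thesis by (rule test_functionsI[of _ "K \<union> L"]) (use K L in auto)
qed

lemma test_frechet:
  assumes "\<phi> \<in> test_functions \<Omega>"
  shows "(\<lambda>x. frechet_derivative \<phi> (at x) v) \<in> test_functions \<Omega>"
proof -
  obtain K where K: "compact K" "K \<subseteq> \<Omega>" "\<And>x. x \<notin> K \<Longrightarrow> frechet_derivative \<phi> (at x) = (\<lambda>_. 0)"
    by (rule test_support[OF assms]) (rule that)
  show ?thesis
    by (rule test_functionsI[OF smooth_frechet[OF test_smooth[OF assms]] K(1,2)]) (use K(3) in \<open>simp add: fun_eq_iff\<close>)
qed

lemma compact_support_bounded:
  fixes g :: "'a::euclidean_space \<Rightarrow> real"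
  assumes "continuous_on UNIV g" "compact K" "\<And>x. x \<notin> K \<Longrightarrow> g x = 0"
  obtains B where "B \<ge> 0" "\<And>x. \<bar>g x\<bar> \<le> B"
proof -
  have "bounded (g ` K)"
    using assms by (intro compact_imp_bounded compact_continuous_image) (auto intro: continuous_on_subset)
  then obtain B where "B > 0" "\<And>x. x \<in> K \<Longrightarrow> \<bar>g x\<bar> \<le> B" unfolding bounded_pos by auto
  moreover from this have "\<bar>g x\<bar> \<le> B" for x using assms(3)[of x] by (cases "x \<in> K") auto
  ultimately show ?thesis by (intro that[of B]) auto
qed

lemma compact_support_integrable:
  fixes g :: "'a::euclidean_space \<Rightarrow> real"
  assumes "continuous_on UNIV g" "compact K" "\<And>x. x \<notin> K \<Longrightarrow> g x = 0"
  shows "integrable lborel g"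
proof -
  have "integrable lborel (\<lambda>x. indicator K x *\<^sub>R g x)"
    using assms by (intro borel_integrable_compact) (auto intro: continuous_on_subset)
  also have "(\<lambda>x. indicator K x *\<^sub>R g x) = g" using assms(3) by (force simp: indicator_def)
  finally show ?thesis .
qed

lemma compact_support_uniformly_continuous:
  fixes g :: "'a::euclidean_space \<Rightarrow> real"
  assumes "continuous_on UNIV g" "compact K" "\<And>x. x \<notin> K \<Longrightarrow> g x = 0"
  shows "uniformly_continuous_on UNIV g"
proof -
  obtain R where R: "K \<subseteq> cball 0 R" using bounded_subset_ballD[OF compact_imp_bounded[OF assms(2)], of 0] by (meson ball_subset_cball order_trans)
  \<comment> \<open>The margin 1 ensures that two points at distance less than 1 either both lie in
    this ball or both lie off K.\<close>
  have u: "uniformly_continuous_on (cball 0 (R + 1)) g"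
    using assms by (intro compact_uniformly_continuous) (auto intro: continuous_on_subset)
  show ?thesis unfolding uniformly_continuous_on_def
  proof (intro allI impI)
    fix e :: real assume e: "e > 0"
    obtain d where d: "d > 0" "\<And>x y. x \<in> cball 0 (R + 1) \<Longrightarrow> y \<in> cball 0 (R + 1) \<Longrightarrow> dist y x < d \<Longrightarrow> dist (g y) (g x) < e"
      using u[unfolded uniformly_continuous_on_def, rule_format, OF e] by auto
    have "dist (g y) (g x) < e" if "dist y x < min d 1" for x y
    proof (cases "x \<in> cball 0 (R + 1) \<and> y \<in> cball 0 (R + 1)")
      case True
      then show ?thesis using d that by auto
    next
      case False
      have "norm x \<le> norm y + dist y x" "norm y \<le> norm x + dist y x"
        using norm_triangle_ineq[of y "x - y"] norm_triangle_ineq[of x "y - x"]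
        by (simp_all add: dist_norm norm_minus_commute)
      with False that have "x \<notin> cball 0 R" "y \<notin> cball 0 R" by auto
      then have "x \<notin> K" "y \<notin> K" using R by blast+
      then show ?thesis using assms(3) e by simp
    qed
    then show "\<exists>d>0. \<forall>x\<in>UNIV. \<forall>x'\<in>UNIV. dist x' x < d \<longrightarrow> dist (g x') (g x) < e"
      using d(1) by (intro exI[of _ "min d 1"]) auto
  qed
qed

lemma obtain_kernel:
  assumes "d > 0"
  obtains \<rho> :: "'a::euclidean_space \<Rightarrow> real" where "\<rho> \<in> test_functions UNIV" "\<And>x. \<rho> x \<ge> 0"
    "(LINT x|lborel. \<rho> x) = 1" "\<And>x. d \<le> norm x \<Longrightarrow> \<rho> x = 0"
proof -
  \<comment> \<open>Coordinates bounded by \<delta> give an l1 norm of at most d/2, which keeps the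
    support strictly inside the ball of radius d.\<close>
  define \<delta> where "\<delta> = d / (2 * DIM('a))"
  have \<delta>: "\<delta> > 0" using assms by (simp add: \<delta>_def)
  \<comment> \<open>A product over the coordinates, positive exactly on an open cube of half side
    \<delta>. It avoids composing the bump with a norm.\<close>
  define r :: "'a \<Rightarrow> real" where "r x = (\<Prod>b\<in>Basis. bump_fun 1 (\<delta> + x \<bullet> b) * bump_fun 1 (\<delta> - x \<bullet> b))" for x
  have Ck: "Ck_on k UNIV r" for k
    unfolding r_def
    by (intro Ck_prod Ck_mult finite_Basis Ck_compose_affine[OF _ Ck_bump_fun]; (rule derivative_eq_intros refl)+)
  have pos: "r x > 0" if "norm x < \<delta>" for x
    unfolding r_def
  proof (intro prod_pos mult_pos_pos)
    fix b :: 'a assume "b \<in> Basis"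
    then have "\<bar>x \<bullet> b\<bar> < \<delta>" using that Basis_le_norm[of b x] by linarith
    then show "bump_fun 1 (\<delta> + x \<bullet> b) > 0" "bump_fun 1 (\<delta> - x \<bullet> b) > 0"
      by (auto simp: bump_fun_1)
  qed
  have supp: "norm x \<le> d / 2" if rx: "r x \<noteq> 0" for x
  proof -
    have "\<bar>x \<bullet> b\<bar> \<le> \<delta>" if "b \<in> Basis" for b
    proof -
      have "bump_fun 1 (\<delta> + x \<bullet> b) * bump_fun 1 (\<delta> - x \<bullet> b) \<noteq> 0"
        using rx that unfolding r_def by (simp add: prod_zero_iff)
      then show ?thesis by (auto simp: bump_fun_def split: if_splits)
    qed
    then have "(\<Sum>b\<in>Basis. \<bar>x \<bullet> b\<bar>) \<le> of_nat (DIM('a)) * \<delta>" by (intro sum_bounded_above) auto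
    then show ?thesis using norm_le_l1[of x] by (simp add: \<delta>_def)
  qed
  have nn: "r x \<ge> 0" for x unfolding r_def by (intro prod_nonneg mult_nonneg_nonneg) (auto simp: bump_fun_1)
  have cont: "continuous_on UNIV r" using Ck[of 0] by simp
  have int: "integrable lborel r"
    by (rule compact_support_integrable[OF cont, of "cball 0 (d/2)"]) (use supp in \<open>auto simp: dist_norm\<close>)
  define I where "I = (LINT x|lborel. r x)"
  \<comment> \<open>A vanishing integral of the nonnegative r would make the ball of radius
    \<delta>, on which r is positive, a null set.\<close>
  have "I \<noteq> 0"
  proof
    assume "I = 0"
    then have "AE x in lborel. r x = 0"
      using integral_nonneg_eq_0_iff_AE[OF int] nn by (auto simp: I_def)
    then have "AE x in lborel. x \<notin> ball (0::'a) \<delta>"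
    proof (rule eventually_mono)
      fix x :: 'a assume "r x = 0"
      then show "x \<notin> ball 0 \<delta>" using pos[of x] by (auto simp: dist_norm)
    qed
    then have "ball 0 \<delta> \<in> null_sets (lborel :: 'a measure)"
      by (subst (asm) AE_iff_null_sets[symmetric]) auto
    then have "negligible (ball (0::'a) \<delta>)"
      by (simp add: negligible_iff_null_sets null_sets_completionI)
    then show False using open_not_negligible[of "ball (0::'a) \<delta>"] \<delta> by auto
  qed
  moreover have "I \<ge> 0" unfolding I_def using nn by simp
  ultimately have I: "I > 0" by simp
  show ?thesis
  proof (rule that[of "\<lambda>x. 1 / I * r x"])
    show "(\<lambda>x. 1 / I * r x) \<in> test_functions UNIV"
    proof (rule test_functionsI[of _ "cball 0 (d/2)"])
      show "smooth_fun_on UNIV (\<lambda>x. 1 / I * r x)"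
        unfolding smooth_fun_on_def by (intro allI Ck_mult Ck_const Ck)
    qed (use supp in \<open>auto simp: dist_norm\<close>)
    show "(LINT x|lborel. 1 / I * r x) = 1" using I by (simp add: I_def)
    show "1 / I * r x = 0" if "d \<le> norm x" for x using supp[of x] that assms by auto
  qed (use nn I in auto)
qed

section \<open>Group convolution\<close>

text \<open>The order of the factors matters. Substituting \<eta> for
  \<open>hmul \<xi> (- \<zeta>)\<close> turns this into an average, with weight \<rho> \<eta>, of
  the left translates f (- \<eta> \<xi>), and left translations commute with the fields.\<close>

definition moll :: "('n::finite heis \<Rightarrow> real) \<Rightarrow> ('n heis \<Rightarrow> real) \<Rightarrow> 'n heis \<Rightarrow> real" where
  "moll \<rho> f \<xi> = (LINT \<zeta>|lborel. \<rho> (hmul \<xi> (- \<zeta>)) * f \<zeta>)"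

text \<open>The differential of \<xi> \<mapsto> \<open>hmul \<xi> (- \<zeta>)\<close>. The group law
  is affine in its first factor, so it does not depend on \<xi>, and the expansion below has no
  remainder.\<close>

definition hlin :: "'n::finite heis \<Rightarrow> 'n heis \<Rightarrow> 'n heis" where
  "hlin \<zeta> v = (fst v, fst (snd v), snd (snd v) + 2 * (fst v \<bullet> fst (snd \<zeta>) - fst \<zeta> \<bullet> fst (snd v)))"

lemma hmul_add_left: "hmul (\<xi> + v) (- \<zeta>) = hmul \<xi> (- \<zeta>) + hlin \<zeta> v"
  by (simp add: hmul_def hlin_def algebra_simps inner_add_left inner_add_right)

lemma linear_hlin: "linear (hlin \<zeta>)"
  by (rule linearI) (simp_all add: hlin_def algebra_simps inner_add_left inner_add_right)

lemma norm_hlin_le: "norm (hlin \<zeta> v) \<le> (3 + 4 * norm \<zeta>) * norm v"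
proof -
  have f: "norm (fst v) \<le> norm v" "norm (fst (snd v)) \<le> norm v" "\<bar>snd (snd v)\<bar> \<le> norm v"
    using norm_fst_le[of "fst v" "snd v"] norm_snd_le[of "snd v" "fst v"]
      norm_fst_le[of "fst (snd v)" "snd (snd v)"] norm_snd_le[of "snd (snd v)" "fst (snd v)"] by auto
  have z: "norm (fst \<zeta>) \<le> norm \<zeta>" "norm (fst (snd \<zeta>)) \<le> norm \<zeta>"
    using norm_fst_le[of "fst \<zeta>" "snd \<zeta>"] norm_snd_le[of "snd \<zeta>" "fst \<zeta>"]
      norm_fst_le[of "fst (snd \<zeta>)" "snd (snd \<zeta>)"] by auto
  have "\<bar>fst v \<bullet> fst (snd \<zeta>)\<bar> \<le> norm v * norm \<zeta>" "\<bar>fst \<zeta> \<bullet> fst (snd v)\<bar> \<le> norm \<zeta> * norm v"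
    by (meson Cauchy_Schwarz_ineq2 f z mult_mono norm_ge_zero order_trans)+
  then have "\<bar>snd (snd v) + 2 * (fst v \<bullet> fst (snd \<zeta>) - fst \<zeta> \<bullet> fst (snd v))\<bar> \<le> norm v + 4 * (norm \<zeta> * norm v)"
    using f(3) by (simp add: mult.commute)
  moreover have "norm (hlin \<zeta> v) \<le> norm (fst v) + (norm (fst (snd v)) +
      \<bar>snd (snd v) + 2 * (fst v \<bullet> fst (snd \<zeta>) - fst \<zeta> \<bullet> fst (snd v))\<bar>)"
    unfolding hlin_def by (rule order_trans[OF norm_Pair_le]) (use norm_Pair_le in \<open>simp flip: real_norm_def\<close>)
  ultimately show ?thesis using f by (simp add: algebra_simps)
qed

lemma continuous_on_hlin: "continuous_on UNIV (\<lambda>\<zeta>. hlin \<zeta> v)"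
  unfolding hlin_def by (intro continuous_intros)

text \<open>The fields are left invariant, so differentiating \<open>\<xi>\<zeta>\<inverse>\<close> along them in \<open>\<xi>\<close> or in \<open>\<zeta>\<close>
  gives the same result up to sign.\<close>

lemma hmul_minus_flow:
  "hmul \<xi> (- (\<zeta> + s *\<^sub>R hfield i \<zeta>)) = hmul \<xi> (- \<zeta>) - s *\<^sub>R hlin \<zeta> (hfield i \<xi>)"
  by (cases i; cases \<xi>; cases \<zeta>)
    (simp_all add: hmul_def hlin_def algebra_simps inner_add_left inner_add_right inner_axis inner_axis'
       inner_diff_right inner_diff_left)

lemma moll_alt:
  assumes "\<rho> \<in> borel_measurable borel" "f \<in> borel_measurable borel"
  shows "moll \<rho> f \<xi> = (LINT \<eta>|lborel. \<rho> \<eta> * f (hmul (- \<eta>) \<xi>))"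
proof -
  note [measurable] = assms
  have "moll \<rho> f \<xi> = (LINT \<eta>|lborel. \<rho> (hmul \<xi> (- hmul (- \<eta>) \<xi>)) * f (hmul (- \<eta>) \<xi>))"
    unfolding moll_def
    by (rule integral_mpres[OF mpres_hmul_uminus(2), symmetric]) measurable
  also have "\<dots> = (LINT \<eta>|lborel. \<rho> \<eta> * f (hmul (- \<eta>) \<xi>))"
    by (simp add: minus_hmul)
  finally show ?thesis .
qed

section \<open>Integrability and smoothness of convolutions\<close>

lemma test_kernel:
  assumes "\<rho> \<in> test_functions UNIV"
  shows "continuous_on UNIV \<rho>" "\<rho> \<in> borel_measurable borel" "integrable lborel \<rho>"
    "\<exists>B\<ge>0. \<forall>x. \<bar>\<rho> x\<bar> \<le> B"
proof -
  obtain K where K: "compact K" "\<And>x. x \<notin> K \<Longrightarrow> \<rho> x = 0" by (rule test_support[OF assms]) (rule that)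
  show c: "continuous_on UNIV \<rho>" using assms smooth_continuous test_smooth by metis
  then show "\<rho> \<in> borel_measurable borel" by (rule borel_measurable_continuous_onI)
  show "integrable lborel \<rho>" by (rule compact_support_integrable[OF c K])
  obtain B where "B \<ge> 0" "\<And>x. \<bar>\<rho> x\<bar> \<le> B" by (rule compact_support_bounded[OF c K]) (assumption, rule that)
  then show "\<exists>B\<ge>0. \<forall>x. \<bar>\<rho> x\<bar> \<le> B" by blast
qed

lemma integrable_pointwise_bound:
  fixes f g :: "'a \<Rightarrow> real"
  assumes "integrable M f" "g \<in> borel_measurable M" "\<And>x. norm (g x) \<le> norm (f x)"
  shows "integrable M g"
  by (rule Bochner_Integration.integrable_bound[OF assms(1,2)]) (simp only: assms(3) AE_I2)

lemma moll_integrable: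
  assumes "\<rho> \<in> test_functions UNIV" "integrable lborel f"
  shows "integrable lborel (\<lambda>\<zeta>. \<rho> (hmul \<xi> (- \<zeta>)) * f \<zeta>)"
proof -
  note [measurable] = test_kernel(2)[OF assms(1)] borel_measurable_integrable[OF assms(2), simplified]
  obtain B where B: "B \<ge> 0" "\<And>x. \<bar>\<rho> x\<bar> \<le> B" using test_kernel(4)[OF assms(1)] by blast
  have "norm (\<rho> (hmul \<xi> (- \<zeta>)) * f \<zeta>) \<le> norm (B * f \<zeta>)" for \<zeta>
    using B by (simp add: abs_mult mult_right_mono)
  moreover have "integrable lborel (\<lambda>\<zeta>. B * f \<zeta>)" using assms(2) by simp
  moreover have "(\<lambda>\<zeta>. \<rho> (hmul \<xi> (- \<zeta>)) * f \<zeta>) \<in> borel_measurable lborel" by measurable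
  ultimately show ?thesis by (rule integrable_pointwise_bound[rotated 2])
qed

text \<open>Differentiating a convolution brings out the entries of \<open>hlin \<zeta> v\<close>,
  which are unbounded in \<zeta>; bounded support of f keeps the products integrable.\<close>

lemma integrable_continuous_mult:
  fixes f :: "'a::euclidean_space \<Rightarrow> real"
  assumes "integrable lborel f" "bounded {\<zeta>. f \<zeta> \<noteq> 0}" "continuous_on UNIV c"
  shows "integrable lborel (\<lambda>\<zeta>. c \<zeta> * f \<zeta>)"
proof -
  have [measurable]: "c \<in> borel_measurable borel" using assms(3) by (rule borel_measurable_continuous_onI)
  note [measurable] = borel_measurable_integrable[OF assms(1), simplified]
  obtain R where R: "norm \<zeta> \<le> R" if "f \<zeta> \<noteq> 0" for \<zeta>
    using assms(2) unfolding bounded_iff by auto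
  have "bounded (c ` cball 0 R)"
    using assms by (intro compact_imp_bounded compact_continuous_image) (auto intro: continuous_on_subset)
  then obtain B where B: "B > 0" "\<And>x. x \<in> cball 0 R \<Longrightarrow> \<bar>c x\<bar> \<le> B" unfolding bounded_pos by auto
  have "\<bar>c x * f x\<bar> \<le> B * \<bar>f x\<bar>" for x
    using B(2)[of x] R[of x] by (cases "f x = 0") (auto simp: abs_mult intro!: mult_right_mono)
  then have "norm (c x * f x) \<le> norm (B * f x)" for x using B(1) by (simp add: abs_mult)
  moreover have "integrable lborel (\<lambda>\<zeta>. B * f \<zeta>)" using assms(1) by simp
  moreover have "(\<lambda>\<zeta>. c \<zeta> * f \<zeta>) \<in> borel_measurable lborel" by measurable
  ultimately show ?thesis by (rule integrable_pointwise_bound[rotated 2])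
qed

text \<open>Separates a direction that varies with the point from the partial derivatives along
  fixed basis vectors, which are functions of the original class.\<close>

lemma frechet_derivative_expand:
  fixes f :: "'a::euclidean_space \<Rightarrow> real"
  assumes "smooth_fun_on UNIV f"
  shows "frechet_derivative f (at x) v = (\<Sum>b\<in>Basis. (v \<bullet> b) * frechet_derivative f (at x) b)"
proof -
  have "linear (frechet_derivative f (at x))"
    using smooth_has_derivative[OF assms] has_derivative_linear by blast
  then have "frechet_derivative f (at x) (\<Sum>b\<in>Basis. (v \<bullet> b) *\<^sub>R b) = (\<Sum>b\<in>Basis. (v \<bullet> b) * frechet_derivative f (at x) b)"
    by (simp add: linear_sum linear_cmul)
  then show ?thesis by (simp add: euclidean_representation)
qed

text \<open>The partial derivatives of a test function are uniformly continuous, so the remainder of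
  the linearization is small uniformly in the base point. This uniformity is what passes under the
  integral.\<close>

lemma test_uniform_diff:
  fixes \<rho> :: "'a::euclidean_space \<Rightarrow> real"
  assumes "\<rho> \<in> test_functions UNIV" "e > 0"
  obtains d where "d > 0"
    "\<And>y h. norm h < d \<Longrightarrow> \<bar>\<rho> (y + h) - \<rho> y - frechet_derivative \<rho> (at y) h\<bar> \<le> e * norm h"
proof -
  note sm = test_smooth[OF assms(1)]
  \<comment> \<open>The operator norm is estimated by summing over the basis, each vector
    contributing \<open>e'\<close>.\<close>
  define e' where "e' = e / DIM('a)"
  have e': "e' > 0" using assms by (simp add: e'_def)
  have "\<exists>d>0. \<forall>x y. dist y x < d \<longrightarrow> \<bar>frechet_derivative \<rho> (at y) b - frechet_derivative \<rho> (at x) b\<bar> < e'" for b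
  proof -
    obtain K where K: "compact K" "\<And>x. x \<notin> K \<Longrightarrow> frechet_derivative \<rho> (at x) b = 0"
      by (rule test_support[OF test_frechet[OF assms(1), of b]]) (rule that)
    have "uniformly_continuous_on UNIV (\<lambda>x. frechet_derivative \<rho> (at x) b)"
      by (rule compact_support_uniformly_continuous[OF smooth_continuous[OF smooth_frechet[OF sm]] K])
    from this[unfolded uniformly_continuous_on_def, rule_format, OF e']
    show ?thesis by (auto simp: dist_real_def)
  qed
  then obtain D where D: "\<And>b. D b > 0"
      "\<And>b x y. dist y x < D b \<Longrightarrow> \<bar>frechet_derivative \<rho> (at y) b - frechet_derivative \<rho> (at x) b\<bar> < e'"
    by metis
  define d where "d = Min (D ` Basis)"
  have d: "d > 0" "\<And>b. b \<in> Basis \<Longrightarrow> d \<le> D b" using D(1) by (auto simp: d_def)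
  show ?thesis
  proof (rule that[OF d(1)])
    fix y h :: 'a assume h: "norm h < d"
    have "norm (\<rho> (y + h) - \<rho> y - frechet_derivative \<rho> (at y) ((y + h) - y)) \<le> norm ((y + h) - y) * e"
    proof (rule differentiable_bound_linearization[where S="ball y d"])
      show "y + t *\<^sub>R (y + h - y) \<in> ball y d" if "t \<in> {0..1}" for t
      proof -
        have "\<bar>t\<bar> * norm h \<le> 1 * norm h" using that by (intro mult_right_mono) auto
        then show ?thesis using h by (simp add: dist_norm)
      qed
      show "(\<rho> has_derivative frechet_derivative \<rho> (at x)) (at x within ball y d)" for x
        by (rule has_derivative_at_withinI[OF smooth_has_derivative[OF sm]])
      show "onorm (frechet_derivative \<rho> (at x) - frechet_derivative \<rho> (at y)) \<le> e" if x: "x \<in> ball y d" for x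
      proof (rule onorm_bound)
        fix v :: 'a
        have "(frechet_derivative \<rho> (at x) - frechet_derivative \<rho> (at y)) v
           = (\<Sum>b\<in>Basis. (v \<bullet> b) * (frechet_derivative \<rho> (at x) b - frechet_derivative \<rho> (at y) b))"
          using frechet_derivative_expand[OF sm, of x v] frechet_derivative_expand[OF sm, of y v]
          by (simp add: algebra_simps sum_subtractf)
        also have "norm \<dots> \<le> (\<Sum>b\<in>(Basis::'a set). norm v * e')"
        proof (rule sum_norm_le)
          fix b :: 'a assume b: "b \<in> Basis"
          have "\<bar>frechet_derivative \<rho> (at x) b - frechet_derivative \<rho> (at y) b\<bar> \<le> e'"
            using D(2)[of x y b] d(2)[OF b] x by (simp add: dist_commute)
          then show "norm ((v \<bullet> b) * (frechet_derivative \<rho> (at x) b - frechet_derivative \<rho> (at y) b)) \<le> norm v * e'"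
            using Basis_le_norm[OF b, of v] by (auto simp: abs_mult intro!: mult_mono)
        qed
        also have "\<dots> = e * norm v" by (simp add: e'_def)
        finally show "norm ((frechet_derivative \<rho> (at x) - frechet_derivative \<rho> (at y)) v) \<le> e * norm v" .
      qed (use assms in simp)
    qed (use d in auto)
    then show "\<bar>\<rho> (y + h) - \<rho> y - frechet_derivative \<rho> (at y) h\<bar> \<le> e * norm h" by (simp add: mult.commute)
  qed
qed

text \<open>A derivative of a convolution is a finite sum of convolutions of the same kind: partial
  derivatives of \<rho> against f times linear entries of \<open>hlin\<close>. Iterating this yields
  smoothness.\<close>

lemma
  fixes f :: "'n::finite heis \<Rightarrow> real"
  assumes \<rho>: "\<rho> \<in> test_functions UNIV" and f: "integrable lborel f" and R: "bounded {\<zeta>. f \<zeta> \<noteq> 0}"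
  shows moll_derivative_integrable:
      "integrable lborel (\<lambda>\<zeta>. frechet_derivative \<rho> (at (hmul \<xi> (- \<zeta>))) (hlin \<zeta> v) * f \<zeta>)"
    and moll_derivative_expand:
      "(LINT \<zeta>|lborel. frechet_derivative \<rho> (at (hmul \<xi> (- \<zeta>))) (hlin \<zeta> v) * f \<zeta>)
        = (\<Sum>b\<in>Basis. moll (\<lambda>x. frechet_derivative \<rho> (at x) b) (\<lambda>\<zeta>. (hlin \<zeta> v \<bullet> b) * f \<zeta>) \<xi>)"
proof -
  have eq: "(\<lambda>\<zeta>. frechet_derivative \<rho> (at (hmul \<xi> (- \<zeta>))) (hlin \<zeta> v) * f \<zeta>)
     = (\<lambda>\<zeta>. \<Sum>b\<in>Basis. frechet_derivative \<rho> (at (hmul \<xi> (- \<zeta>))) b * ((hlin \<zeta> v \<bullet> b) * f \<zeta>))"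
    by (subst frechet_derivative_expand[OF test_smooth[OF \<rho>]]) (simp add: sum_distrib_left mult_ac)
  have i: "integrable lborel (\<lambda>\<zeta>. frechet_derivative \<rho> (at (hmul \<xi> (- \<zeta>))) b * ((hlin \<zeta> v \<bullet> b) * f \<zeta>))" for b
    by (rule moll_integrable[OF test_frechet[OF \<rho>] integrable_continuous_mult[OF f R]])
      (intro continuous_intros continuous_on_hlin)
  show "integrable lborel (\<lambda>\<zeta>. frechet_derivative \<rho> (at (hmul \<xi> (- \<zeta>))) (hlin \<zeta> v) * f \<zeta>)"
    unfolding eq by (intro Bochner_Integration.integrable_sum i)
  show "(LINT \<zeta>|lborel. frechet_derivative \<rho> (at (hmul \<xi> (- \<zeta>))) (hlin \<zeta> v) * f \<zeta>)
        = (\<Sum>b\<in>Basis. moll (\<lambda>x. frechet_derivative \<rho> (at x) b) (\<lambda>\<zeta>. (hlin \<zeta> v \<bullet> b) * f \<zeta>) \<xi>)"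
    unfolding eq moll_def by (rule Bochner_Integration.integral_sum[OF i])
qed

lemma moll_has_derivative:
  fixes f :: "'n::finite heis \<Rightarrow> real"
  assumes \<rho>: "\<rho> \<in> test_functions UNIV" and f: "integrable lborel f" and R: "bounded {\<zeta>. f \<zeta> \<noteq> 0}"
  shows "(moll \<rho> f has_derivative
    (\<lambda>v. LINT \<zeta>|lborel. frechet_derivative \<rho> (at (hmul \<xi> (- \<zeta>))) (hlin \<zeta> v) * f \<zeta>)) (at \<xi>)"
    (is "(_ has_derivative ?D) _")
proof -
  note i = moll_derivative_integrable[OF \<rho> f R]
  have lin: "linear (frechet_derivative \<rho> (at x))" for x
    using smooth_has_derivative[OF test_smooth[OF \<rho>]] has_derivative_linear by blast
  have "linear ?D"
  proof (rule linearI)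
    fix v w show "?D (v + w) = ?D v + ?D w"
      by (subst Bochner_Integration.integral_add[OF i i, symmetric])
        (simp add: linear_add[OF linear_hlin] linear_add[OF lin] algebra_simps)
  next
    fix c v show "?D (c *\<^sub>R v) = c *\<^sub>R ?D v"
      by (simp add: linear_cmul[OF linear_hlin] linear_cmul[OF lin] algebra_simps)
  qed
  then have "bounded_linear ?D" by (rule linear_conv_bounded_linear[THEN iffD1])
  moreover have "\<exists>d>0. \<forall>y. norm (y - \<xi>) < d \<longrightarrow> norm (moll \<rho> f y - moll \<rho> f \<xi> - ?D (y - \<xi>)) \<le> e * norm (y - \<xi>)"
    if e: "e > 0" for e
  proof -
    obtain R where R: "norm \<zeta> \<le> R" if "f \<zeta> \<noteq> 0" for \<zeta>
      using assms(3) unfolding bounded_iff by auto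
    \<comment> \<open>The factor of \<open>norm_hlin_le\<close> on the support of f; the absolute
      value covers f = 0, where R may be negative. The 1 in N keeps the divisor of \<open>e'\<close>
      positive.\<close>
    define C where "C = 3 + 4 * \<bar>R\<bar>"
    define N where "N = (LINT \<zeta>|lborel. \<bar>f \<zeta>\<bar>) + 1"
    have C: "C > 0" by (simp add: C_def)
    have N: "N > 0" "(LINT \<zeta>|lborel. \<bar>f \<zeta>\<bar>) \<le> N" unfolding N_def by (auto intro: add_nonneg_pos)
    have hC: "norm (hlin \<zeta> v) \<le> C * norm v" if "f \<zeta> \<noteq> 0" for \<zeta> v
    proof -
      have "norm \<zeta> \<le> \<bar>R\<bar>" using R[OF that] by simp
      then have "(3 + 4 * norm \<zeta>) * norm v \<le> C * norm v" by (intro mult_right_mono) (auto simp: C_def)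
      then show ?thesis using norm_hlin_le[of \<zeta> v] by linarith
    qed
    define e' where "e' = e / (C * N)"
    have e': "e' > 0" using e C N by (simp add: e'_def)
    obtain d where d: "d > 0" "\<And>y h. norm h < d \<Longrightarrow> \<bar>\<rho> (y + h) - \<rho> y - frechet_derivative \<rho> (at y) h\<bar> \<le> e' * norm h"
      by (rule test_uniform_diff[OF \<rho> e']) (rule that)
    show ?thesis
    proof (intro exI[of _ "d / C"] conjI allI impI)
      fix y assume y: "norm (y - \<xi>) < d / C"
      define v where "v = y - \<xi>"
      have Cv: "C * norm v < d" using y C by (simp add: v_def field_simps)
      let ?r = "\<lambda>\<zeta>. (\<rho> (hmul \<xi> (- \<zeta>) + hlin \<zeta> v) - \<rho> (hmul \<xi> (- \<zeta>)) - frechet_derivative \<rho> (at (hmul \<xi> (- \<zeta>))) (hlin \<zeta> v))"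
      have I: "integrable lborel (\<lambda>\<zeta>. \<rho> (hmul \<xi> (- \<zeta>) + hlin \<zeta> v) * f \<zeta>)"
        using moll_integrable[OF \<rho> f, of "\<xi> + v"] by (simp add: hmul_add_left)
      have "moll \<rho> f y - moll \<rho> f \<xi> - ?D (y - \<xi>) = moll \<rho> f (\<xi> + v) - moll \<rho> f \<xi> - ?D v"
        by (simp add: v_def)
      also have "\<dots> = (LINT \<zeta>|lborel. ?r \<zeta> * f \<zeta>)"
        unfolding moll_def hmul_add_left left_diff_distrib
        using I moll_integrable[OF \<rho> f, of \<xi>] i[of \<xi> v] by simp
      also have "norm \<dots> \<le> (LINT \<zeta>|lborel. (e' * (C * norm v)) * \<bar>f \<zeta>\<bar>)"
      proof -
        have b: "\<bar>?r \<zeta> * f \<zeta>\<bar> \<le> (e' * (C * norm v)) * \<bar>f \<zeta>\<bar>" for \<zeta>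
        proof (cases "f \<zeta> = 0")
          case False
          have "norm (hlin \<zeta> v) < d" using hC[OF False, of v] Cv by linarith
          from d(2)[OF this, of "hmul \<xi> (- \<zeta>)"]
          have "\<bar>?r \<zeta>\<bar> \<le> e' * norm (hlin \<zeta> v)" .
          also have "\<dots> \<le> e' * (C * norm v)" using hC[OF False, of v] e' by (intro mult_left_mono) auto
          finally show ?thesis by (simp add: abs_mult mult_right_mono)
        qed simp
        have i1: "integrable lborel (\<lambda>\<zeta>. (e' * (C * norm v)) * \<bar>f \<zeta>\<bar>)" using f by simp
        have i2: "integrable lborel (\<lambda>\<zeta>. ?r \<zeta> * f \<zeta>)"
          unfolding left_diff_distrib using I moll_integrable[OF \<rho> f, of \<xi>] i[of \<xi> v] by simp
        show ?thesis unfolding real_norm_def by (rule integral_abs_bound_integral[OF i2 i1 b])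
      qed
      also have "\<dots> = (e' * C * norm v) * (LINT \<zeta>|lborel. \<bar>f \<zeta>\<bar>)" by simp
      also have "\<dots> \<le> (e' * C * norm v) * N" using N e' C by (intro mult_left_mono) auto
      also have "\<dots> = e * norm v" using C N by (simp add: e'_def)
      finally show "norm (moll \<rho> f y - moll \<rho> f \<xi> - ?D (y - \<xi>)) \<le> e * norm (y - \<xi>)" by (simp add: v_def)
    qed (use d C in auto)
  qed
  ultimately show ?thesis unfolding has_derivative_at_alt by blast
qed

text \<open>The induction runs over all \<rho> and f at once, because one differentiation changes
  both while preserving their hypotheses.\<close>

lemma smooth_moll:
  fixes f :: "'n::finite heis \<Rightarrow> real"
  assumes "\<rho> \<in> test_functions UNIV" "integrable lborel f" "bounded {\<zeta>. f \<zeta> \<noteq> 0}"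
  shows "smooth_fun_on UNIV (moll \<rho> f)"
proof -
  have "Ck_on k UNIV (moll \<rho> f)" for k
    using assms
  proof (induction k arbitrary: \<rho> f)
    case 0
    have "isCont (moll \<rho> f) x" for x by (rule has_derivative_continuous[OF moll_has_derivative[OF 0]])
    then show ?case by (simp add: continuous_at_imp_continuous_on)
  next
    case (Suc k)
    show ?case
    proof (rule Ck_SucI[OF moll_has_derivative[OF Suc.prems]])
      fix v
      show "Ck_on k UNIV (\<lambda>x. LINT \<zeta>|lborel. frechet_derivative \<rho> (at (hmul x (- \<zeta>))) (hlin \<zeta> v) * f \<zeta>)"
        unfolding moll_derivative_expand[OF Suc.prems]
      proof (intro Ck_sum finite_Basis Suc.IH)
        fix b :: "'n heis"
        show "(\<lambda>x. frechet_derivative \<rho> (at x) b) \<in> test_functions UNIV"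
          by (rule test_frechet[OF Suc.prems(1)])
        show "integrable lborel (\<lambda>\<zeta>. (hlin \<zeta> v \<bullet> b) * f \<zeta>)"
          by (rule integrable_continuous_mult[OF Suc.prems(2,3)]) (intro continuous_intros continuous_on_hlin)
        show "bounded {\<zeta>. (hlin \<zeta> v \<bullet> b) * f \<zeta> \<noteq> 0}"
          by (rule bounded_subset[OF Suc.prems(3)]) auto
      qed
    qed
  qed
  then show ?thesis by (simp add: smooth_fun_on_def)
qed

section \<open>Horizontal derivatives of convolutions\<close>

lemma hderiv_smooth: "smooth_fun_on UNIV f \<Longrightarrow> hderiv i f \<xi> = frechet_derivative f (at \<xi>) (hfield i \<xi>)"
  using smooth_has_derivative[of f \<xi>] by (intro hderiv_eq_frechet_derivative) (auto simp: differentiable_def)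

lemma smooth_kernel_section: "\<rho> \<in> test_functions UNIV \<Longrightarrow> smooth_fun_on UNIV (\<lambda>\<zeta>. \<rho> (hmul \<xi> (- \<zeta>)))"
proof -
  assume \<rho>: "\<rho> \<in> test_functions UNIV"
  have "((\<lambda>\<zeta>. hmul \<xi> (- \<zeta>)) has_derivative (\<lambda>v. (- fst v, - fst (snd v), - snd (snd v) +
      2 * (- fst v \<bullet> fst (snd \<xi>) + fst \<xi> \<bullet> fst (snd v))))) (at x)" for x
    unfolding hmul_def by (auto intro!: derivative_eq_intros simp: inner_diff_left)
  from Ck_compose_affine[OF this, OF smooth_CkD[OF test_smooth[OF \<rho>]]]
  show ?thesis by (simp add: smooth_fun_on_def)
qed

lemma hderiv_kernel_section:
  assumes \<rho>: "\<rho> \<in> test_functions UNIV"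
  shows "hderiv i (\<lambda>\<zeta>. \<rho> (hmul \<xi> (- \<zeta>))) \<zeta> = - frechet_derivative \<rho> (at (hmul \<xi> (- \<zeta>))) (hlin \<zeta> (hfield i \<xi>))"
proof -
  let ?h = "hlin \<zeta> (hfield i \<xi>)" and ?y = "hmul \<xi> (- \<zeta>)"
  have hd: "(\<rho> has_derivative frechet_derivative \<rho> (at ?y)) (at (?y - 0 *\<^sub>R ?h))"
    using smooth_has_derivative[OF test_smooth[OF \<rho>]] by simp
  have "((\<lambda>s. ?y - s *\<^sub>R ?h) has_derivative (\<lambda>s. - (s *\<^sub>R ?h))) (at 0)"
    by (auto intro!: derivative_eq_intros)
  from has_derivative_compose[OF this hd]
  have "((\<lambda>s. \<rho> (?y - s *\<^sub>R ?h)) has_derivative (\<lambda>s. frechet_derivative \<rho> (at ?y) (- (s *\<^sub>R ?h)))) (at 0)" .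
  moreover have "(\<lambda>s. frechet_derivative \<rho> (at ?y) (- (s *\<^sub>R ?h))) = (*) (- frechet_derivative \<rho> (at ?y) ?h)"
    using has_derivative_linear[OF smooth_has_derivative[OF test_smooth[OF \<rho>], of ?y]]
    by (auto simp: linear_neg linear_cmul)
  ultimately show ?thesis
    unfolding hderiv_def hmul_minus_flow by (intro DERIV_imp_deriv) (simp add: has_field_derivative_def)
qed

text \<open>Left invariance has moved the derivative from \<xi> to the integration variable. In this
  form the kernel can serve as the test function in the definition of a weak derivative.\<close>

lemma hderiv_moll:
  fixes f :: "'n::finite heis \<Rightarrow> real"
  assumes "\<rho> \<in> test_functions UNIV" "integrable lborel f" "bounded {\<zeta>. f \<zeta> \<noteq> 0}"
  shows "hderiv i (moll \<rho> f) \<xi> = - (LINT \<zeta>|lborel. hderiv i (\<lambda>\<zeta>. \<rho> (hmul \<xi> (- \<zeta>))) \<zeta> * f \<zeta>)"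
  unfolding hderiv_kernel_section[OF assms(1)] hderiv_smooth[OF smooth_moll[OF assms]]
  by (subst frechet_derivative_at[OF moll_has_derivative[OF assms], symmetric]) simp_all


section \<open>Convergence of mollifications in L1 and L2\<close>

lemma power2_diff_le: "(a - b)\<^sup>2 \<le> 2 * a\<^sup>2 + 2 * b\<^sup>2" for a b :: real
  using zero_le_power2[of "a + b"] by (simp add: power2_eq_square algebra_simps)

text \<open>The variance of h under the probability density \<rho> is nonnegative.\<close>

lemma jensen_square:
  fixes \<rho> h :: "'a \<Rightarrow> real"
  assumes nn: "\<And>x. \<rho> x \<ge> 0" and \<rho>: "integrable M \<rho>" "(LINT x|M. \<rho> x) = 1"
    and i: "integrable M (\<lambda>x. \<rho> x * h x)" "integrable M (\<lambda>x. \<rho> x * (h x)\<^sup>2)"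
  shows "(LINT x|M. \<rho> x * h x)\<^sup>2 \<le> (LINT x|M. \<rho> x * (h x)\<^sup>2)"
proof -
  define m where "m = (LINT x|M. \<rho> x * h x)"
  have "0 \<le> (LINT x|M. \<rho> x * (h x - m)\<^sup>2)" using nn by (intro Bochner_Integration.integral_nonneg) simp
  also have "\<dots> = (LINT x|M. \<rho> x * (h x)\<^sup>2 - 2 * m * (\<rho> x * h x) + m\<^sup>2 * \<rho> x)"
    by (simp add: power2_eq_square algebra_simps)
  also have "\<dots> = (LINT x|M. \<rho> x * (h x)\<^sup>2) - 2 * m * m + m\<^sup>2"
    using \<rho> i by (simp add: m_def)
  finally show ?thesis unfolding m_def by (simp add: power2_eq_square)
qed

lemma borel_measurable_moll [measurable]:
  fixes f :: "'a::finite heis \<Rightarrow> real"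
  shows "\<rho> \<in> borel_measurable borel \<Longrightarrow> f \<in> borel_measurable borel \<Longrightarrow> moll \<rho> f \<in> borel_measurable borel"
proof -
  assume [measurable]: "\<rho> \<in> borel_measurable borel" "f \<in> borel_measurable borel"
  have [measurable]: "(fst :: 'a heis \<times> 'a heis \<Rightarrow> _) \<in> borel_measurable borel"
      "(snd :: 'a heis \<times> 'a heis \<Rightarrow> _) \<in> borel_measurable borel"
    by (intro borel_measurable_continuous_onI continuous_intros)+
  have "(\<lambda>x. \<rho> (hmul (fst x) (- snd x)) * f (snd x)) \<in> borel_measurable borel"
    by measurable
  then have "(\<lambda>(\<xi>, \<zeta>). \<rho> (hmul \<xi> (- \<zeta>)) * f \<zeta>) \<in> borel_measurable (lborel \<Otimes>\<^sub>M lborel)"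
    by (simp add: lborel_prod case_prod_unfold)
  then have "(\<lambda>\<xi>. LINT \<zeta>|lborel. \<rho> (hmul \<xi> (- \<zeta>)) * f \<zeta>) \<in> borel_measurable lborel"
    by (rule lborel.borel_measurable_lebesgue_integral)
  then show ?thesis by (simp add: moll_def[abs_def])
qed

text \<open>\<open>P\<close> is \<open>a \<mapsto> \<bar>a\<bar>\<close> or \<open>a \<mapsto> a\<^sup>2\<close>; the last hypothesis is Jensen's inequality for it.\<close>

lemma moll_translation_bound:
  fixes f :: "'n::finite heis \<Rightarrow> real" and P :: "real \<Rightarrow> real"
  assumes [measurable]: "\<rho> \<in> borel_measurable borel" "f \<in> borel_measurable borel" "P \<in> borel_measurable borel"
    and nn: "\<And>\<eta>. \<rho> \<eta> \<ge> 0" and \<rho>: "integrable lborel \<rho>" "(LINT \<eta>|lborel. \<rho> \<eta>) = 1"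
    and \<rho>0: "\<And>\<eta>. d \<le> norm \<eta> \<Longrightarrow> \<rho> \<eta> = 0"
    and tr: "\<And>\<eta>. norm \<eta> < d \<Longrightarrow> (\<integral>\<^sup>+\<xi>. ennreal (P (f (hmul \<eta> \<xi>) - f \<xi>)) \<partial>lborel) \<le> ennreal e"
    and J: "\<And>\<xi>. ennreal (P (moll \<rho> f \<xi> - f \<xi>)) \<le> (\<integral>\<^sup>+\<eta>. ennreal (\<rho> \<eta>) * ennreal (P (f (hmul (- \<eta>) \<xi>) - f \<xi>)) \<partial>lborel)"
  shows "(\<integral>\<^sup>+\<xi>. ennreal (P (moll \<rho> f \<xi> - f \<xi>)) \<partial>lborel) \<le> ennreal e"
proof -
  let ?g = "\<lambda>\<eta> \<xi>. ennreal (\<rho> \<eta>) * ennreal (P (f (hmul (- \<eta>) \<xi>) - f \<xi>))"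
  have "(\<integral>\<^sup>+\<xi>. ennreal (P (moll \<rho> f \<xi> - f \<xi>)) \<partial>lborel) \<le> (\<integral>\<^sup>+\<xi>. \<integral>\<^sup>+\<eta>. ?g \<eta> \<xi> \<partial>lborel \<partial>lborel)"
    by (intro nn_integral_mono J)
  also have "\<dots> = (\<integral>\<^sup>+\<eta>. \<integral>\<^sup>+\<xi>. ?g \<eta> \<xi> \<partial>lborel \<partial>lborel)"
  proof (rule lborel_pair.Fubini')
    have [measurable]: "(fst :: 'n heis \<times> 'n heis \<Rightarrow> _) \<in> borel_measurable borel"
        "(snd :: 'n heis \<times> 'n heis \<Rightarrow> _) \<in> borel_measurable borel"
      by (intro borel_measurable_continuous_onI continuous_intros)+
    have "(\<lambda>x. ?g (fst x) (snd x)) \<in> borel_measurable borel" by measurable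
    then show "(\<lambda>(\<eta>, \<xi>). ?g \<eta> \<xi>) \<in> borel_measurable (lborel \<Otimes>\<^sub>M lborel)"
      by (simp add: lborel_prod case_prod_unfold)
  qed
  also have "\<dots> = (\<integral>\<^sup>+\<eta>. ennreal (\<rho> \<eta>) * (\<integral>\<^sup>+\<xi>. ennreal (P (f (hmul (- \<eta>) \<xi>) - f \<xi>)) \<partial>lborel) \<partial>lborel)"
    by (intro nn_integral_cong nn_integral_cmult) measurable
  also have "\<dots> \<le> (\<integral>\<^sup>+\<eta>. ennreal (\<rho> \<eta>) * ennreal e \<partial>lborel)"
  proof (rule nn_integral_mono)
    fix \<eta> :: "'n heis"
    show "ennreal (\<rho> \<eta>) * (\<integral>\<^sup>+\<xi>. ennreal (P (f (hmul (- \<eta>) \<xi>) - f \<xi>)) \<partial>lborel) \<le> ennreal (\<rho> \<eta>) * ennreal e"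
    \<comment> \<open>The kernel has weight only for norm below d; the bound \<open>tr\<close> is
      used at - \<eta>, which has the same norm.\<close>
    proof (cases "norm \<eta> < d")
      case True
      then show ?thesis by (intro mult_left_mono tr) simp_all
    next
      case False
      then show ?thesis using \<rho>0[of \<eta>] by simp
    qed
  qed
  also have "\<dots> = (\<integral>\<^sup>+\<eta>. ennreal (\<rho> \<eta>) \<partial>lborel) * ennreal e"
    by (rule nn_integral_multc) measurable
  also have "(\<integral>\<^sup>+\<eta>. ennreal (\<rho> \<eta>) \<partial>lborel) = 1"
    using nn_integral_eq_integral[OF \<rho>(1)] nn \<rho>(2) by simp
  finally show ?thesis by simp
qed

text \<open>As \<rho> has integral 1, the value f \<xi> is itself an average with weight \<rho>, so
  the error is an average of left translation differences.\<close>

lemma moll_diff: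
  assumes \<rho>: "\<rho> \<in> test_functions UNIV" "(LINT \<eta>|lborel. \<rho> \<eta>) = 1" and f: "integrable lborel f"
  shows "integrable lborel (\<lambda>\<eta>. \<rho> \<eta> * f (hmul (- \<eta>) \<xi>))"
    "integrable lborel (\<lambda>\<eta>. \<rho> \<eta> * (f (hmul (- \<eta>) \<xi>) - f \<xi>))"
    "moll \<rho> f \<xi> - f \<xi> = (LINT \<eta>|lborel. \<rho> \<eta> * (f (hmul (- \<eta>) \<xi>) - f \<xi>))"
proof -
  have fm: "f \<in> borel_measurable borel" using f by simp
  from integrable_mpres[OF mpres_hmul_uminus(2) moll_integrable[OF \<rho>(1) f, of \<xi>], of \<xi>]
  show i: "integrable lborel (\<lambda>\<eta>. \<rho> \<eta> * f (hmul (- \<eta>) \<xi>))" by (simp add: minus_hmul)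
  show "integrable lborel (\<lambda>\<eta>. \<rho> \<eta> * (f (hmul (- \<eta>) \<xi>) - f \<xi>))"
    using i test_kernel(3)[OF \<rho>(1)] by (simp add: right_diff_distrib)
  show "moll \<rho> f \<xi> - f \<xi> = (LINT \<eta>|lborel. \<rho> \<eta> * (f (hmul (- \<eta>) \<xi>) - f \<xi>))"
    unfolding moll_alt[OF test_kernel(2)[OF \<rho>(1)] fm] using i test_kernel(3)[OF \<rho>(1)] \<rho>(2)
    by (simp add: right_diff_distrib)
qed

text \<open>The radius d is only an upper bound for the support, so one kernel can meet several
  smallness requirements at once through \<open>mollifier_mono\<close>.\<close>

definition mollifier :: "real \<Rightarrow> ('a::euclidean_space \<Rightarrow> real) \<Rightarrow> bool" where
  "mollifier d \<rho> \<longleftrightarrow> \<rho> \<in> test_functions UNIV \<and> (\<forall>\<eta>. \<rho> \<eta> \<ge> 0) \<and> (LINT \<eta>|lborel. \<rho> \<eta>) = 1 \<and>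
      (\<forall>\<eta>. d \<le> norm \<eta> \<longrightarrow> \<rho> \<eta> = 0)"

lemma mollifier_exists:
  assumes "d > 0"
  obtains \<rho> :: "'a::euclidean_space \<Rightarrow> real" where "mollifier d \<rho>"
proof -
  obtain \<rho> :: "'a \<Rightarrow> real" where "\<rho> \<in> test_functions UNIV" "\<And>x. \<rho> x \<ge> 0"
    "(LINT x|lborel. \<rho> x) = 1" "\<And>x. d \<le> norm x \<Longrightarrow> \<rho> x = 0"
    by (rule obtain_kernel[OF assms]) (rule that)
  then show ?thesis by (intro that[of \<rho>]) (simp add: mollifier_def)
qed

lemma mollifier_mono: "mollifier d \<rho> \<Longrightarrow> d \<le> d' \<Longrightarrow> mollifier d' \<rho>"
  by (simp add: mollifier_def)

lemma moll_L1:
  fixes f :: "'n::finite heis \<Rightarrow> real"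
  assumes f: "integrable lborel f" and e: "e > 0"
  shows "\<exists>d>0. \<forall>\<rho>. mollifier d \<rho> \<longrightarrow> (\<integral>\<^sup>+\<xi>. ennreal \<bar>moll \<rho> f \<xi> - f \<xi>\<bar> \<partial>lborel) \<le> ennreal e"
proof -
  have fm[measurable]: "f \<in> borel_measurable borel" using f by simp
  obtain d where d: "d > 0" "\<And>\<eta>. norm \<eta> < d \<Longrightarrow> (LINT \<xi>|lborel. \<bar>f (hmul \<eta> \<xi>) - f \<xi>\<bar>) < e"
    using L1_translation_continuous[OF f e] by metis
  show ?thesis unfolding mollifier_def
  proof (intro exI[of _ d] conjI allI impI; (elim conjE)?)
    fix \<rho> :: "'n heis \<Rightarrow> real"
    assume \<rho>: "\<rho> \<in> test_functions UNIV" and nn: "\<forall>\<eta>. 0 \<le> \<rho> \<eta>" and \<rho>1: "(LINT \<eta>|lborel. \<rho> \<eta>) = 1"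
      and \<rho>0: "\<forall>\<eta>. d \<le> norm \<eta> \<longrightarrow> \<rho> \<eta> = 0"
    note nn = nn[rule_format] and \<rho>0 = \<rho>0[rule_format]
    note [measurable] = test_kernel(2)[OF \<rho>]
    show "(\<integral>\<^sup>+\<xi>. ennreal \<bar>moll \<rho> f \<xi> - f \<xi>\<bar> \<partial>lborel) \<le> ennreal e"
    proof (rule moll_translation_bound[where P=abs and d=d])
      fix \<eta> :: "'n heis" assume \<eta>: "norm \<eta> < d"
      have "integrable lborel (\<lambda>\<xi>. \<bar>f (hmul \<eta> \<xi>) - f \<xi>\<bar>)"
        using f integrable_mpres[OF mpres_hmul_left f] by simp
      then show "(\<integral>\<^sup>+\<xi>. ennreal \<bar>f (hmul \<eta> \<xi>) - f \<xi>\<bar> \<partial>lborel) \<le> ennreal e"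
        using d(2)[OF \<eta>] by (subst nn_integral_eq_integral) (simp_all add: ennreal_leI)
    next
      fix \<xi> :: "'n heis"
      show "ennreal \<bar>moll \<rho> f \<xi> - f \<xi>\<bar> \<le> (\<integral>\<^sup>+\<eta>. ennreal (\<rho> \<eta>) * ennreal \<bar>f (hmul (- \<eta>) \<xi>) - f \<xi>\<bar> \<partial>lborel)"
        using integral_norm_bound_ennreal[OF moll_diff(2)[OF \<rho> \<rho>1 f, of \<xi>]] nn
        by (simp add: moll_diff(3)[OF \<rho> \<rho>1 f] abs_mult ennreal_mult)
    qed (use \<rho>1 test_kernel(3)[OF \<rho>] in \<open>simp_all add: nn \<rho>0\<close>)
  qed (use d in simp)
qed

lemma moll_L2:
  fixes f :: "'n::finite heis \<Rightarrow> real"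
  assumes f: "integrable lborel f" and f2: "integrable lborel (\<lambda>\<xi>. (f \<xi>)\<^sup>2)" and e: "e > 0"
  shows "\<exists>d>0. \<forall>\<rho>. mollifier d \<rho> \<longrightarrow> (\<integral>\<^sup>+\<xi>. ennreal ((moll \<rho> f \<xi> - f \<xi>)\<^sup>2) \<partial>lborel) \<le> ennreal e"
proof -
  have fm[measurable]: "f \<in> borel_measurable borel" using f by simp
  obtain d where d: "d > 0" "\<And>\<eta>. norm \<eta> < d \<Longrightarrow> (LINT \<xi>|lborel. (f (hmul \<eta> \<xi>) - f \<xi>)\<^sup>2) < e"
    using L2_translation_continuous[OF fm f2 e] by auto
  show ?thesis unfolding mollifier_def
  proof (intro exI[of _ d] conjI allI impI; (elim conjE)?)
    fix \<rho> :: "'n heis \<Rightarrow> real"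
    assume \<rho>: "\<rho> \<in> test_functions UNIV" and nn: "\<forall>\<eta>. 0 \<le> \<rho> \<eta>" and \<rho>1: "(LINT \<eta>|lborel. \<rho> \<eta>) = 1"
      and \<rho>0: "\<forall>\<eta>. d \<le> norm \<eta> \<longrightarrow> \<rho> \<eta> = 0"
    note nn = nn[rule_format] and \<rho>0 = \<rho>0[rule_format]
    note [measurable] = test_kernel(2)[OF \<rho>]
    obtain B where B: "B \<ge> 0" "\<And>x. \<bar>\<rho> x\<bar> \<le> B" using test_kernel(4)[OF \<rho>] by blast
    show "(\<integral>\<^sup>+\<xi>. ennreal ((moll \<rho> f \<xi> - f \<xi>)\<^sup>2) \<partial>lborel) \<le> ennreal e"
    proof (rule moll_translation_bound[where P="\<lambda>a. a\<^sup>2" and d=d])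
      fix \<eta> :: "'n heis" assume \<eta>: "norm \<eta> < d"
      have "integrable lborel (\<lambda>\<xi>. 2 * (f (hmul \<eta> \<xi>))\<^sup>2 + 2 * (f \<xi>)\<^sup>2)"
        using f2 integrable_mpres[OF mpres_hmul_left f2] by simp
      then have "integrable lborel (\<lambda>\<xi>. (f (hmul \<eta> \<xi>) - f \<xi>)\<^sup>2)"
      proof (rule integrable_pointwise_bound)
        fix \<xi> show "norm ((f (hmul \<eta> \<xi>) - f \<xi>)\<^sup>2) \<le> norm (2 * (f (hmul \<eta> \<xi>))\<^sup>2 + 2 * (f \<xi>)\<^sup>2)"
          using power2_diff_le[of "f (hmul \<eta> \<xi>)" "f \<xi>"] by simp
      qed measurable
      then show "(\<integral>\<^sup>+\<xi>. ennreal ((f (hmul \<eta> \<xi>) - f \<xi>)\<^sup>2) \<partial>lborel) \<le> ennreal e"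
        using d(2)[OF \<eta>] by (subst nn_integral_eq_integral) (simp_all add: ennreal_leI)
    next
      fix \<xi> :: "'n heis"
      have mp: "mpres (\<lambda>\<eta>. hmul (- \<eta>) \<xi>)" by (rule mpres_hmul_uminus)
      have i2: "integrable lborel (\<lambda>\<eta>. \<rho> \<eta> * (f (hmul (- \<eta>) \<xi>) - f \<xi>)\<^sup>2)"
      proof (rule integrable_pointwise_bound)
        \<comment> \<open>The translated square is integrable, so there \<rho> may be replaced by
          its bound B. The constant square of f \<xi> must keep the factor \<rho> to stay integrable
          on the whole space.\<close>
        show "integrable lborel (\<lambda>\<eta>. 2 * B * (f (hmul (- \<eta>) \<xi>))\<^sup>2 + 2 * (f \<xi>)\<^sup>2 * \<rho> \<eta>)"
          using integrable_mpres[OF mp f2] test_kernel(3)[OF \<rho>] by simp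
        fix \<eta>
        have "(f (hmul (- \<eta>) \<xi>) - f \<xi>)\<^sup>2 \<le> 2 * (f (hmul (- \<eta>) \<xi>))\<^sup>2 + 2 * (f \<xi>)\<^sup>2"
          by (rule power2_diff_le)
        then have "\<rho> \<eta> * (f (hmul (- \<eta>) \<xi>) - f \<xi>)\<^sup>2 \<le> \<rho> \<eta> * (2 * (f (hmul (- \<eta>) \<xi>))\<^sup>2 + 2 * (f \<xi>)\<^sup>2)"
          using nn by (intro mult_left_mono) auto
        also have "\<dots> = \<rho> \<eta> * (2 * (f (hmul (- \<eta>) \<xi>))\<^sup>2) + 2 * (f \<xi>)\<^sup>2 * \<rho> \<eta>" by (simp add: algebra_simps)
        also have "\<dots> \<le> B * (2 * (f (hmul (- \<eta>) \<xi>))\<^sup>2) + 2 * (f \<xi>)\<^sup>2 * \<rho> \<eta>"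
          using B(2)[of \<eta>] by (intro add_right_mono mult_right_mono) auto
        finally show "norm (\<rho> \<eta> * (f (hmul (- \<eta>) \<xi>) - f \<xi>)\<^sup>2) \<le> norm (2 * B * (f (hmul (- \<eta>) \<xi>))\<^sup>2 + 2 * (f \<xi>)\<^sup>2 * \<rho> \<eta>)"
          using nn B(1) by (simp add: mult_ac)
      qed measurable
      have "(moll \<rho> f \<xi> - f \<xi>)\<^sup>2 \<le> (LINT \<eta>|lborel. \<rho> \<eta> * (f (hmul (- \<eta>) \<xi>) - f \<xi>)\<^sup>2)"
        unfolding moll_diff(3)[OF \<rho> \<rho>1 f]
        by (rule jensen_square[OF _ test_kernel(3)[OF \<rho>] \<rho>1 moll_diff(2)[OF \<rho> \<rho>1 f] i2]) (use nn in simp)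
      then have "ennreal ((moll \<rho> f \<xi> - f \<xi>)\<^sup>2) \<le> ennreal (LINT \<eta>|lborel. \<rho> \<eta> * (f (hmul (- \<eta>) \<xi>) - f \<xi>)\<^sup>2)"
        by (rule ennreal_leI)
      also have "\<dots> = (\<integral>\<^sup>+\<eta>. ennreal (\<rho> \<eta> * (f (hmul (- \<eta>) \<xi>) - f \<xi>)\<^sup>2) \<partial>lborel)"
        using nn by (intro nn_integral_eq_integral[symmetric] i2) simp
      finally show "ennreal ((moll \<rho> f \<xi> - f \<xi>)\<^sup>2) \<le> (\<integral>\<^sup>+\<eta>. ennreal (\<rho> \<eta>) * ennreal ((f (hmul (- \<eta>) \<xi>) - f \<xi>)\<^sup>2) \<partial>lborel)"
        using nn by (simp add: ennreal_mult)
    qed (use \<rho>1 test_kernel(3)[OF \<rho>] in \<open>simp_all add: nn \<rho>0\<close>)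
  qed (use d in simp)
qed

section \<open>Borel representatives\<close>

text \<open>The Sobolev spaces use Lebesgue measurable functions on S, while convolution and Fubini
  are carried out with Borel functions on \<open>lborel\<close>. A representative extended by zero
  links the two settings.\<close>

definition borel_rep :: "'a::euclidean_space set \<Rightarrow> ('a \<Rightarrow> real) \<Rightarrow> ('a \<Rightarrow> real) \<Rightarrow> bool" where
  "borel_rep S u v \<longleftrightarrow> u \<in> borel_measurable (lebesgue_on S) \<and> v \<in> borel_measurable borel \<and>
    (\<forall>x. x \<notin> S \<longrightarrow> v x = 0) \<and> (AE x in lebesgue_on S. u x = v x)"

lemma AE_lebesgue_on:
  assumes [measurable]: "S \<in> sets borel"
  shows "(AE x in lebesgue_on S. P x) \<longleftrightarrow> (AE x in lebesgue. x \<in> S \<longrightarrow> P x)"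
  by (subst AE_restrict_space_iff) auto

lemma borel_rep_exists:
  assumes S[measurable]: "S \<in> sets borel" and u: "u \<in> borel_measurable (lebesgue_on S)"
  obtains v where "borel_rep S u v"
proof -
  have "(\<lambda>x. indicator S x *\<^sub>R u x) \<in> borel_measurable lebesgue"
    using u S by (subst (asm) borel_measurable_restrict_space_iff) auto
  then obtain g where g: "g \<in> borel_measurable lborel" "AE x in lborel. indicator S x *\<^sub>R u x = g x"
    using completion_ex_borel_measurable_real by blast
  have "AE x in lebesgue_on S. u x = indicator S x * g x"
    unfolding AE_lebesgue_on[OF S] using AE_completion[OF g(2)] by eventually_elim auto
  then show ?thesis using u g(1) by (intro that[of "\<lambda>x. indicator S x * g x"]) (simp add: borel_rep_def)
qed

lemma
  assumes S[measurable]: "S \<in> sets borel" and r: "borel_rep S u v"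
  shows borel_rep_integrable: "integrable (lebesgue_on S) u \<longleftrightarrow> integrable lborel v"
    and borel_rep_integral: "(LINT x|lebesgue_on S. u x) = (LINT x|lborel. v x)"
    and borel_rep_AE: "AE x in lebesgue. x \<in> S \<longrightarrow> u x = v x"
proof -
  have v[measurable]: "v \<in> borel_measurable borel" and u[measurable]: "u \<in> borel_measurable (lebesgue_on S)"
    and ae: "AE x in lebesgue_on S. u x = v x" and z: "\<And>x. x \<notin> S \<Longrightarrow> v x = 0"
    using r by (auto simp: borel_rep_def)
  have vl: "v \<in> borel_measurable lborel" using v by simp
  have v': "v \<in> borel_measurable (lebesgue_on S)"
    by (rule measurable_restrict_space1[OF measurable_completion[OF vl]])
  have eq: "(\<lambda>x. indicator S x * v x) = v" using z by (force simp: indicator_def)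
  have "integrable (lebesgue_on S) u \<longleftrightarrow> integrable (lebesgue_on S) v"
    by (rule integrable_cong_AE[OF u v' ae])
  also have "\<dots> \<longleftrightarrow> integrable lebesgue v"
    by (subst integrable_restrict_space) (simp_all add: eq)
  also have "\<dots> \<longleftrightarrow> integrable lborel v" by (rule integrable_completion[OF vl])
  finally show "integrable (lebesgue_on S) u \<longleftrightarrow> integrable lborel v" .
  have "(LINT x|lebesgue_on S. u x) = (LINT x|lebesgue_on S. v x)"
    by (rule integral_cong_AE[OF u v' ae])
  also have "\<dots> = integral\<^sup>L lebesgue v"
    by (subst integral_restrict_space) (simp_all add: eq)
  also have "\<dots> = integral\<^sup>L lborel v" by (rule integral_completion[OF vl])
  finally show "(LINT x|lebesgue_on S. u x) = (LINT x|lborel. v x)" .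
  show "AE x in lebesgue. x \<in> S \<longrightarrow> u x = v x" using ae by (simp add: AE_lebesgue_on)
qed

lemma borel_measurable_lebesgue_on: "f \<in> borel_measurable borel \<Longrightarrow> f \<in> borel_measurable (lebesgue_on S)"
  by (rule measurable_restrict_space1[OF measurable_completion]) simp

lemma continuous_measurable_lebesgue_on: "continuous_on UNIV f \<Longrightarrow> f \<in> borel_measurable (lebesgue_on S)"
  by (rule borel_measurable_lebesgue_on[OF borel_measurable_continuous_onI])

lemma borel_rep_mult:
  assumes "borel_rep S u v" "h \<in> borel_measurable borel"
  shows "borel_rep S (\<lambda>x. u x * h x) (\<lambda>x. v x * h x)"
proof -
  have "AE x in lebesgue_on S. u x * h x = v x * h x"
    using assms(1) unfolding borel_rep_def by (elim conjE eventually_mono) auto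
  then show ?thesis using assms borel_measurable_lebesgue_on[OF assms(2), of S]
    by (auto simp: borel_rep_def)
qed

lemma borel_rep_diff_square:
  assumes "borel_rep S u v" "borel_rep S u' v'"
  shows "borel_rep S (\<lambda>x. (u x - u' x)\<^sup>2) (\<lambda>x. (v x - v' x)\<^sup>2)"
proof -
  have "AE x in lebesgue_on S. u x = v x" "AE x in lebesgue_on S. u' x = v' x"
    using assms unfolding borel_rep_def by auto
  then have "AE x in lebesgue_on S. (u x - u' x)\<^sup>2 = (v x - v' x)\<^sup>2"
    by eventually_elim auto
  then show ?thesis using assms by (auto simp: borel_rep_def)
qed

lemma borel_rep_square: "borel_rep S u v \<Longrightarrow> borel_rep S (\<lambda>x. (u x)\<^sup>2) (\<lambda>x. (v x)\<^sup>2)"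
  using borel_rep_diff_square[of S u v "\<lambda>_. 0" "\<lambda>_. 0"] by (simp add: borel_rep_def)

lemma borel_rep_indicator:
  assumes [measurable]: "S \<in> sets borel" and "h \<in> borel_measurable borel"
  shows "borel_rep S h (\<lambda>x. indicator S x * h x)"
proof -
  have "AE x in lebesgue_on S. h x = indicator S x * h x"
    by (rule AE_I2) (simp add: space_restrict_space)
  moreover have "(\<lambda>x. indicator S x * h x) \<in> borel_measurable borel" using assms(2) by measurable
  moreover have "h \<in> borel_measurable (lebesgue_on S)" by (rule borel_measurable_lebesgue_on[OF assms(2)])
  ultimately show ?thesis by (simp add: borel_rep_def)
qed

section \<open>Integration by parts along the fields\<close>

lemma hfield_eq: "hfield (Inl j) \<xi> = (axis j 1, 0, 2 * fst (snd \<xi>) $ j)"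
    "hfield (Inr j) \<xi> = (0, axis j 1, - 2 * fst \<xi> $ j)"
  by (cases \<xi>; simp)+

lemma continuous_on_hfield: "continuous_on UNIV (hfield i)"
  by (cases i) (auto simp: hfield_eq[abs_def] intro!: continuous_intros)

text \<open>The flow of a left invariant field is right multiplication by a one-parameter subgroup;
  in particular it preserves Lebesgue measure.\<close>

lemma flow_eq_hmul: "\<xi> + s *\<^sub>R hfield i \<xi> = hmul \<xi> (s *\<^sub>R hfield i 0)"
  by (cases i) (auto simp: hfield_eq hmul_def prod_eq_iff inner_axis inner_axis' algebra_simps)

lemma hfield_flow: "hfield i (\<xi> + s *\<^sub>R hfield i \<xi>) = hfield i \<xi>"
  by (cases i) (auto simp: hfield_eq axis_def)

lemma continuous_on_flow: "continuous_on S (\<lambda>z. snd z + fst z *\<^sub>R hfield i (snd z))"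
  by (intro continuous_intros continuous_on_compose2[OF continuous_on_hfield]) auto

text \<open>The field is constant along its own line, so differentiability at time 0 from every base
  point gives it at every time.\<close>

lemma flow_has_real_derivative:
  assumes D: "\<And>\<xi>. ((\<lambda>s. F (\<xi> + s *\<^sub>R hfield i \<xi>)) has_real_derivative G \<xi>) (at 0)"
  shows "((\<lambda>s. F (\<xi> + s *\<^sub>R hfield i \<xi>)) has_real_derivative G (\<xi> + r *\<^sub>R hfield i \<xi>)) (at r)"
proof -
  have "((\<lambda>s. F (\<xi> + r *\<^sub>R hfield i \<xi> + s *\<^sub>R hfield i \<xi>)) has_real_derivative G (\<xi> + r *\<^sub>R hfield i \<xi>)) (at 0)"
    using D[of "\<xi> + r *\<^sub>R hfield i \<xi>"] by (simp add: hfield_flow)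
  then have "((\<lambda>s. F (\<xi> + (s + r) *\<^sub>R hfield i \<xi>)) has_real_derivative G (\<xi> + r *\<^sub>R hfield i \<xi>)) (at 0)"
    by (simp add: scaleR_add_left add_ac)
  then show ?thesis using DERIV_shift[of "\<lambda>s. F (\<xi> + s *\<^sub>R hfield i \<xi>)" _ 0 r] by (simp add: add.commute)
qed

text \<open>Every difference quotient of F along the flow has integral zero, because the flow
  preserves measure. Dominated convergence passes to the derivative, with no use of
  coordinates.\<close>

lemma integral_flow_derivative_eq_0:
  fixes F :: "'n::finite heis \<Rightarrow> real"
  assumes D: "\<And>\<xi>. ((\<lambda>s. F (\<xi> + s *\<^sub>R hfield i \<xi>)) has_real_derivative G \<xi>) (at 0)"
    and F: "continuous_on UNIV F" and G: "continuous_on UNIV G"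
    and K: "compact K" "\<And>\<xi>. \<xi> \<notin> K \<Longrightarrow> F \<xi> = 0" "\<And>\<xi>. \<xi> \<notin> K \<Longrightarrow> G \<xi> = 0"
  shows "(LINT \<xi>|lborel. G \<xi>) = 0"
proof -
  let ?\<tau> = "\<lambda>s \<xi>. \<xi> + s *\<^sub>R hfield i \<xi> :: 'n heis"
  obtain B where B: "B \<ge> 0" "\<And>\<xi>. \<bar>G \<xi>\<bar> \<le> B"
    by (rule compact_support_bounded[OF G K(1,3)]) (assumption, rule that)
  \<comment> \<open>K moved backwards for times up to 1: a compact set outside which all difference
    quotients with step at most 1 vanish.\<close>
  define L where "L = (\<lambda>z. snd z + fst z *\<^sub>R hfield i (snd z)) ` ({-1..0} \<times> K)"
  have L: "compact L" unfolding L_def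
    by (intro compact_continuous_image continuous_on_flow compact_Times K) simp
  have inv: "?\<tau> (- s) (?\<tau> s \<xi>) = \<xi>" for s \<xi> by (simp add: hfield_flow)
  have inL: "\<xi> \<in> L" if "s \<in> {0..1}" "?\<tau> s \<xi> \<in> K" for s \<xi>
    unfolding L_def using that inv[of \<xi> s] by (intro image_eqI[of _ _ "(- s, ?\<tau> s \<xi>)"]) auto
  have FI: "integrable lborel F" by (rule compact_support_integrable[OF F K(1,2)])
  have [measurable]: "F \<in> borel_measurable borel" "G \<in> borel_measurable borel"
    using F G by (auto intro: borel_measurable_continuous_onI)
  have [measurable]: "L \<in> sets borel" using L by (simp add: borel_compact)
  let ?q = "\<lambda>n \<xi>. (F (?\<tau> (1 / Suc n) \<xi>) - F \<xi>) / (1 / Suc n)"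
  have "(\<lambda>n. LINT \<xi>|lborel. ?q n \<xi>) \<longlonglongrightarrow> (LINT \<xi>|lborel. G \<xi>)"
  proof (rule integral_dominated_convergence[where w="\<lambda>\<xi>. B * indicator L \<xi>"])
    have "emeasure lborel L < \<infinity>" by (rule emeasure_compact_finite[OF L])
    then show "integrable lborel (\<lambda>\<xi>. B * indicator L \<xi>)" by simp
    show "AE \<xi> in lborel. (\<lambda>n. ?q n \<xi>) \<longlonglongrightarrow> G \<xi>"
    proof (rule AE_I2)
      fix \<xi>
      have "((\<lambda>h. (F (?\<tau> h \<xi>) - F \<xi>) / h) \<longlongrightarrow> G \<xi>) (at 0)"
        using D[of \<xi>] by (simp add: DERIV_def)
      moreover have "filterlim (\<lambda>n. 1 / real (Suc n)) (at 0) sequentially"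
        unfolding filterlim_at using LIMSEQ_inverse_real_of_nat by (auto simp: inverse_eq_divide)
      ultimately show "(\<lambda>n. ?q n \<xi>) \<longlonglongrightarrow> G \<xi>" by (rule filterlim_compose)
    qed
    show "AE \<xi> in lborel. norm (?q n \<xi>) \<le> B * indicator L \<xi>" for n
    proof (rule AE_I2)
      fix \<xi>
      have s: "1 / real (Suc n) \<in> {0..1}" by simp
      show "norm (?q n \<xi>) \<le> B * indicator L \<xi>"
      proof (cases "\<xi> \<in> L")
        case False
        then have "?\<tau> (1 / Suc n) \<xi> \<notin> K" "?\<tau> 0 \<xi> \<notin> K" using inL[OF s, of \<xi>] inL[of 0 \<xi>] by auto
        then show ?thesis using K(2) False by simp
      next
        case True
        have divide_bound: "\<bar>a / c\<bar> \<le> B" if "c > 0" "\<bar>a\<bar> \<le> B * c" for a c :: real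
          using that by (simp add: pos_divide_le_eq)
        have "\<bar>F (?\<tau> (1 / Suc n) \<xi>) - F (?\<tau> 0 \<xi>)\<bar> \<le> B * \<bar>1 / Suc n - 0\<bar>"
          using field_differentiable_bound[of UNIV "\<lambda>s. F (?\<tau> s \<xi>)" "\<lambda>s. G (?\<tau> s \<xi>)" B "1 / Suc n" 0]
            flow_has_real_derivative[OF D] B by simp
        then have *: "\<bar>F (?\<tau> (1 / Suc n) \<xi>) - F \<xi>\<bar> \<le> B * (1 / real (Suc n))" by simp
        have "norm (?q n \<xi>) \<le> B" unfolding real_norm_def by (rule divide_bound[OF _ *]) simp
        then show ?thesis by (simp only: indicator_simps(1)[OF True] mult_1_right)
      qed
    qed
    have "(\<lambda>\<xi>. ?\<tau> (1 / real (Suc n)) \<xi>) \<in> borel_measurable borel" for n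
      unfolding flow_eq_hmul by measurable
    then show "?q n \<in> borel_measurable lborel" for n by measurable
  qed simp
  moreover have "(LINT \<xi>|lborel. ?q n \<xi>) = 0" for n
  proof -
    have mp: "mpres (?\<tau> (1 / real (Suc n)))" unfolding flow_eq_hmul by (rule mpres_hmul_right)
    have "(LINT \<xi>|lborel. F (?\<tau> (1 / Suc n) \<xi>) - F \<xi>) = 0"
      using integral_mpres[OF mp, of F] integrable_mpres[OF mp FI] FI by simp
    then show ?thesis by simp
  qed
  ultimately show ?thesis by (simp add: LIMSEQ_const_iff)
qed

lemma smooth_flow_derivative:
  fixes f :: "'n::finite heis \<Rightarrow> real"
  assumes "smooth_fun_on UNIV f"
  shows "((\<lambda>s. f (\<xi> + s *\<^sub>R hfield i \<xi>)) has_real_derivative hderiv i f \<xi>) (at 0)"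
proof -
  have hd: "(f has_derivative frechet_derivative f (at \<xi>)) (at (\<xi> + 0 *\<^sub>R hfield i \<xi>))"
    using smooth_has_derivative[OF assms] by simp
  have "((\<lambda>s. \<xi> + s *\<^sub>R hfield i \<xi>) has_derivative (\<lambda>s. s *\<^sub>R hfield i \<xi>)) (at 0)"
    by (auto intro!: derivative_eq_intros)
  from has_derivative_compose[OF this hd]
  have "((\<lambda>s. f (\<xi> + s *\<^sub>R hfield i \<xi>)) has_derivative (\<lambda>s. frechet_derivative f (at \<xi>) (s *\<^sub>R hfield i \<xi>))) (at 0)" .
  moreover have "(\<lambda>s. frechet_derivative f (at \<xi>) (s *\<^sub>R hfield i \<xi>)) = (*) (hderiv i f \<xi>)"
    using has_derivative_linear[OF smooth_has_derivative[OF assms, of \<xi>]]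
    by (auto simp: linear_cmul hderiv_smooth[OF assms])
  ultimately show ?thesis by (simp add: has_field_derivative_def)
qed

lemma continuous_on_hderiv_smooth:
  fixes f :: "'n::finite heis \<Rightarrow> real"
  assumes "smooth_fun_on UNIV f"
  shows "continuous_on UNIV (hderiv i f)"
proof -
  have "continuous_on UNIV (\<lambda>\<xi>. \<Sum>b\<in>Basis. (hfield i \<xi> \<bullet> b) * frechet_derivative f (at \<xi>) b)"
    by (intro continuous_intros continuous_on_hfield smooth_continuous smooth_frechet assms)
  also have "(\<lambda>\<xi>. \<Sum>b\<in>Basis. (hfield i \<xi> \<bullet> b) * frechet_derivative f (at \<xi>) b) = hderiv i f"
    by (simp add: hderiv_smooth[OF assms] fun_eq_iff flip: frechet_derivative_expand[OF assms])
  finally show ?thesis .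
qed

lemma test_hderiv:
  fixes \<phi> :: "'n::finite heis \<Rightarrow> real"
  assumes "\<phi> \<in> test_functions \<Omega>"
  obtains K B where "compact K" "K \<subseteq> \<Omega>" "\<And>\<xi>. \<xi> \<notin> K \<Longrightarrow> \<phi> \<xi> = 0" "\<And>\<xi> i. \<xi> \<notin> K \<Longrightarrow> hderiv i \<phi> \<xi> = 0"
    "B \<ge> 0" "\<And>\<xi>. \<bar>\<phi> \<xi>\<bar> \<le> B" "\<And>\<xi> i. \<bar>hderiv i \<phi> \<xi>\<bar> \<le> B"
    "continuous_on UNIV \<phi>" "\<And>i. continuous_on UNIV (hderiv i \<phi>)"
proof -
  note sm = test_smooth[OF assms]
  obtain K where K: "compact K" "K \<subseteq> \<Omega>" "\<And>x. x \<notin> K \<Longrightarrow> \<phi> x = 0"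
    "\<And>x. x \<notin> K \<Longrightarrow> frechet_derivative \<phi> (at x) = (\<lambda>_. 0)"
    by (rule test_support[OF assms]) (rule that)
  have h0: "hderiv i \<phi> \<xi> = 0" if "\<xi> \<notin> K" for i \<xi> using K(4)[OF that] by (simp add: hderiv_smooth[OF sm])
  have c: "continuous_on UNIV \<phi>" "continuous_on UNIV (hderiv i \<phi>)" for i
    by (rule smooth_continuous[OF sm], rule continuous_on_hderiv_smooth[OF sm])
  obtain B where B: "B \<ge> 0" "\<And>x. \<bar>\<phi> x\<bar> \<le> B"
    by (rule compact_support_bounded[OF c(1) K(1,3)]) (assumption, rule that)
  have "\<exists>C\<ge>0. \<forall>x. \<bar>hderiv i \<phi> x\<bar> \<le> C" for i
  proof -
    obtain C where "C \<ge> 0" "\<And>x. \<bar>hderiv i \<phi> x\<bar> \<le> C"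
      by (rule compact_support_bounded[OF c(2) K(1) h0]) (assumption, rule that)
    then show ?thesis by blast
  qed
  then obtain C where C: "\<And>i. C i \<ge> 0" "\<And>i x. \<bar>hderiv i \<phi> x\<bar> \<le> C i" by metis
  have CS: "C i \<le> B + sum C UNIV" for i
    using C(1) B(1) member_le_sum[of i UNIV C] by simp
  show ?thesis
  proof (rule that[OF K(1-3) h0 _ _ _ c])
    show "B + sum C UNIV \<ge> 0" using B C by (simp add: sum_nonneg)
    show "\<bar>\<phi> \<xi>\<bar> \<le> B + sum C UNIV" for \<xi> using B(2)[of \<xi>] sum_nonneg[of UNIV C] C(1) by simp
    show "\<bar>hderiv i \<phi> \<xi>\<bar> \<le> B + sum C UNIV" for \<xi> i using C(2)[of i \<xi>] CS[of i] by linarith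
  qed
qed


lemma mollifierD:
  assumes "mollifier d \<rho>"
  shows "\<rho> \<in> test_functions UNIV" "\<rho> \<eta> \<ge> 0" "(LINT \<eta>|lborel. \<rho> \<eta>) = 1" "d \<le> norm \<eta> \<Longrightarrow> \<rho> \<eta> = 0"
  using assms unfolding mollifier_def by blast+

section \<open>Uniqueness of weak derivatives\<close>

text \<open>Room for mollification: for \<xi> in K, a kernel of radius d centred at \<xi> stays in
  K', hence in \<Omega>. Halving the radius replaces an open ball by a compact one.\<close>

lemma hmul_enlarge:
  fixes K :: "'n::finite heis set"
  assumes K: "compact K" "open \<Omega>" "K \<subseteq> \<Omega>"
  obtains d K' where "d > 0" "compact K'" "K \<subseteq> K'" "K' \<subseteq> \<Omega>"
    "\<And>\<eta> \<xi>. norm \<eta> \<le> d \<Longrightarrow> \<xi> \<in> K \<Longrightarrow> hmul \<eta> \<xi> \<in> K'"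
proof -
  obtain d where d: "d > 0" "\<And>\<eta> \<xi>. norm \<eta> < d \<Longrightarrow> \<xi> \<in> K \<Longrightarrow> hmul \<eta> \<xi> \<in> \<Omega>"
    by (rule hmul_compact_subset_open[OF K]) (rule that)
  let ?K' = "(\<lambda>z. hmul (fst z) (snd z)) ` (cball 0 (d/2) \<times> K)"
  show ?thesis
  proof (rule that[of "d/2" ?K'])
    show "compact ?K'"
      by (intro compact_continuous_image continuous_intros compact_Times compact_cball K)
    show *: "hmul \<eta> \<xi> \<in> ?K'" if "norm \<eta> \<le> d/2" "\<xi> \<in> K" for \<eta> \<xi>
      by (rule image_eqI[of _ _ "(\<eta>, \<xi>)"]) (use that in auto)
    show "K \<subseteq> ?K'"
    proof
      fix \<xi> assume "\<xi> \<in> K"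
      from *[of 0, OF _ this] show "\<xi> \<in> ?K'" using d(1) by simp
    qed
    show "?K' \<subseteq> \<Omega>"
    proof (rule image_subsetI)
      fix z :: "'n heis \<times> 'n heis" assume "z \<in> cball 0 (d/2) \<times> K"
      then show "hmul (fst z) (snd z) \<in> \<Omega>" using d by (intro d(2)) (simp_all add: mem_Times_iff)
    qed
  qed (use d in simp)
qed

text \<open>The element - (\<xi> (- \<zeta>)) carries \<xi> to \<zeta>. If \<zeta> is outside K',
  its norm exceeds d, and so the kernel vanishes there.\<close>

lemma kernel_section_eq_0:
  assumes "mollifier d \<rho>" "\<And>\<eta>. norm \<eta> \<le> d \<Longrightarrow> hmul \<eta> \<xi> \<in> K'" "\<zeta> \<notin> K'"
  shows "\<rho> (hmul \<xi> (- \<zeta>)) = 0"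
proof -
  have "hmul (- hmul \<xi> (- \<zeta>)) \<xi> = \<zeta>" by (simp add: minus_hmul hmul_assoc)
  then have "\<not> norm (- hmul \<xi> (- \<zeta>)) \<le> d" using assms(2)[of "- hmul \<xi> (- \<zeta>)"] assms(3) by metis
  then show ?thesis by (intro mollifierD(4)[OF assms(1)]) simp
qed

lemma kernel_section_test:
  assumes "mollifier d \<rho>" "\<And>\<eta>. norm \<eta> \<le> d \<Longrightarrow> hmul \<eta> \<xi> \<in> K'" "compact K'" "K' \<subseteq> \<Omega>"
  shows "(\<lambda>\<zeta>. \<rho> (hmul \<xi> (- \<zeta>))) \<in> test_functions \<Omega>"
  by (rule test_functionsI[OF smooth_kernel_section[OF mollifierD(1)[OF assms(1)]] assms(3,4)])
    (rule kernel_section_eq_0[OF assms(1,2)])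

lemma loc_integrable_mult:
  fixes c :: "'n::finite heis \<Rightarrow> real"
  assumes g: "loc_integrable \<Omega> g" and K: "compact K" "K \<subseteq> \<Omega>" and \<Omega>: "\<Omega> \<in> sets borel"
    and c: "continuous_on UNIV c" "\<And>\<xi>. \<xi> \<notin> K \<Longrightarrow> c \<xi> = 0"
  shows "integrable (lebesgue_on \<Omega>) (\<lambda>\<xi>. g \<xi> * c \<xi>)"
    "(LINT \<xi>|lebesgue_on \<Omega>. g \<xi> * c \<xi>) = (LINT \<xi>|lebesgue_on K. g \<xi> * c \<xi>)"
proof -
  obtain B where B: "B \<ge> 0" "\<And>x. \<bar>c x\<bar> \<le> B"
    by (rule compact_support_bounded[OF c(1) K(1) c(2)]) (assumption, rule that)
  have Kb: "K \<in> sets borel" using K by (simp add: borel_compact)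
  have gi: "integrable (lebesgue_on K) g" using g K by (simp add: loc_integrable_def)
  have "integrable (lebesgue_on K) (\<lambda>\<xi>. g \<xi> * c \<xi>)"
  proof (rule integrable_pointwise_bound)
    show "integrable (lebesgue_on K) (\<lambda>\<xi>. B * g \<xi>)" using gi by simp
    show "(\<lambda>\<xi>. g \<xi> * c \<xi>) \<in> borel_measurable (lebesgue_on K)"
      using borel_measurable_integrable[OF gi] continuous_measurable_lebesgue_on[OF c(1)]
      by (rule borel_measurable_times)
    show "norm (g \<xi> * c \<xi>) \<le> norm (B * g \<xi>)" for \<xi>
      using mult_right_mono[OF B(2)[of \<xi>], of "\<bar>g \<xi>\<bar>"] B(1) by (simp add: abs_mult mult.commute)
  qed
  moreover have eq: "indicator \<Omega> \<xi> *\<^sub>R (g \<xi> * c \<xi>) = indicator K \<xi> *\<^sub>R (g \<xi> * c \<xi>)" for \<xi>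
    using c(2)[of \<xi>] K(2) by (auto simp: indicator_def)
  ultimately show "integrable (lebesgue_on \<Omega>) (\<lambda>\<xi>. g \<xi> * c \<xi>)"
    using Kb \<Omega> by (simp add: integrable_restrict_space eq del: real_scaleR_def)
  show "(LINT \<xi>|lebesgue_on \<Omega>. g \<xi> * c \<xi>) = (LINT \<xi>|lebesgue_on K. g \<xi> * c \<xi>)"
    using Kb \<Omega> by (simp add: integral_restrict_space eq del: real_scaleR_def)
qed

text \<open>The sections of a mollifier at points of K are test functions, so the mollified g
  vanishes on K, while it converges to g in L1. This is the fundamental lemma of the calculus of
  variations, with group translates as tests.\<close>

lemma loc_integrable_AE_0:
  fixes g :: "'n::finite heis \<Rightarrow> real"
  assumes \<Omega>: "open \<Omega>" and g: "loc_integrable \<Omega> g"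
    and z: "\<And>\<phi>. \<phi> \<in> test_functions \<Omega> \<Longrightarrow> (LINT \<xi>|lebesgue_on \<Omega>. g \<xi> * \<phi> \<xi>) = 0"
  shows "AE \<xi> in lebesgue_on \<Omega>. g \<xi> = 0"
proof -
  have \<Omega>b: "\<Omega> \<in> sets borel" using \<Omega> by simp
  have local: "AE \<xi> in lebesgue. \<xi> \<in> K \<longrightarrow> g \<xi> = 0" if K: "compact K" "K \<subseteq> \<Omega>" for K
  proof -
    obtain d K' where K': "d > 0" "compact K'" "K \<subseteq> K'" "K' \<subseteq> \<Omega>"
        "\<And>\<eta> \<xi>. norm \<eta> \<le> d \<Longrightarrow> \<xi> \<in> K \<Longrightarrow> hmul \<eta> \<xi> \<in> K'"
      by (rule hmul_enlarge[OF K(1) \<Omega> K(2)]) (rule that)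
    have K'b[measurable]: "K' \<in> sets borel" "K \<in> sets borel" using K' K by (auto simp: borel_compact)
    have gi: "integrable (lebesgue_on K') g" using g K' by (simp add: loc_integrable_def)
    obtain g' where g': "borel_rep K' g g'"
      by (rule borel_rep_exists[OF K'b(1) borel_measurable_integrable[OF gi]]) (rule that)
    have g'i: "integrable lborel g'" using borel_rep_integrable[OF K'b(1) g'] gi by simp
    have [measurable]: "g' \<in> borel_measurable borel" using g' by (simp add: borel_rep_def)
    have "(\<integral>\<^sup>+\<xi>. ennreal (indicator K \<xi> * \<bar>g' \<xi>\<bar>) \<partial>lborel) \<le> ennreal e" if e: "e > 0" for e
    proof -
      obtain d1 where d1: "d1 > 0" "\<And>\<rho>. mollifier d1 \<rho> \<Longrightarrow> (\<integral>\<^sup>+\<xi>. ennreal \<bar>moll \<rho> g' \<xi> - g' \<xi>\<bar> \<partial>lborel) \<le> ennreal e"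
        using moll_L1[OF g'i e] by auto
      \<comment> \<open>Radius d keeps the sections inside K', radius d1 makes the L1 error at most
        e.\<close>
      obtain \<rho> :: "'n heis \<Rightarrow> real" where \<rho>: "mollifier (min d d1) \<rho>"
        by (rule mollifier_exists[of "min d d1"]) (use K' d1 in simp, rule that)
      have \<rho>m: "\<rho> \<in> borel_measurable borel" by (rule test_kernel(2)[OF mollifierD(1)[OF \<rho>]])
      have "moll \<rho> g' \<xi> = 0" if \<xi>: "\<xi> \<in> K" for \<xi>
      proof -
        let ?\<phi> = "\<lambda>\<zeta>. \<rho> (hmul \<xi> (- \<zeta>))"
        have in': "hmul \<eta> \<xi> \<in> K'" if "norm \<eta> \<le> min d d1" for \<eta> using K'(5) \<xi> that by simp
        have t: "?\<phi> \<in> test_functions \<Omega>" by (rule kernel_section_test[OF \<rho> in' K'(2,4)])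
        have z': "?\<phi> \<zeta> = 0" if "\<zeta> \<notin> K'" for \<zeta> by (rule kernel_section_eq_0[OF \<rho> in' that])
        have m: "?\<phi> \<in> borel_measurable borel" using \<rho>m by measurable
        have "moll \<rho> g' \<xi> = (LINT \<zeta>|lborel. g' \<zeta> * ?\<phi> \<zeta>)" by (simp add: moll_def mult.commute)
        also have "\<dots> = (LINT \<zeta>|lebesgue_on K'. g \<zeta> * ?\<phi> \<zeta>)"
          by (rule borel_rep_integral[OF K'b(1) borel_rep_mult[OF g' m], symmetric])
        also have "\<dots> = (LINT \<zeta>|lebesgue_on \<Omega>. g \<zeta> * ?\<phi> \<zeta>)"
          by (rule loc_integrable_mult(2)[OF g K'(2,4) \<Omega>b smooth_continuous[OF test_smooth[OF t]] z', symmetric])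
        also have "\<dots> = 0" by (rule z[OF t])
        finally show ?thesis .
      qed
      then have "indicator K \<xi> * \<bar>g' \<xi>\<bar> \<le> \<bar>moll \<rho> g' \<xi> - g' \<xi>\<bar>" for \<xi>
        by (cases "\<xi> \<in> K") simp_all
      then have "(\<integral>\<^sup>+\<xi>. ennreal (indicator K \<xi> * \<bar>g' \<xi>\<bar>) \<partial>lborel) \<le> (\<integral>\<^sup>+\<xi>. ennreal \<bar>moll \<rho> g' \<xi> - g' \<xi>\<bar> \<partial>lborel)"
        by (intro nn_integral_mono ennreal_leI)
      also have "\<dots> \<le> ennreal e" by (rule d1(2)[OF mollifier_mono[OF \<rho>]]) simp
      finally show ?thesis .
    qed
    note small = this
    have "(\<integral>\<^sup>+\<xi>. ennreal (indicator K \<xi> * \<bar>g' \<xi>\<bar>) \<partial>lborel) \<le> 0"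
      by (rule ennreal_le_epsilon) (simp add: small)
    then have "AE \<xi> in lborel. ennreal (indicator K \<xi> * \<bar>g' \<xi>\<bar>) = 0"
      by (subst (asm) le_zero_eq, subst (asm) nn_integral_0_iff_AE) simp_all
    then have "AE \<xi> in lebesgue. ennreal (indicator K \<xi> * \<bar>g' \<xi>\<bar>) = 0" by (rule AE_completion)
    moreover have "AE \<xi> in lebesgue. \<xi> \<in> K' \<longrightarrow> g \<xi> = g' \<xi>" by (rule borel_rep_AE[OF K'b(1) g'])
    ultimately show ?thesis
    proof eventually_elim
      case (elim \<xi>)
      then show ?case using K'(3) by (auto simp: ennreal_eq_0_iff)
    qed
  qed
  \<comment> \<open>A countable exhaustion by compact sets, so that the exceptional null sets can be
    united.\<close>
  obtain C :: "nat \<Rightarrow> 'n heis set" where C: "\<And>n. compact (C n)" "\<And>n. C n \<subseteq> \<Omega>" "\<Omega> = (\<Union>n. C n)"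
    using open_Union_compact_subsets[OF \<Omega>] by metis
  have "AE \<xi> in lebesgue. \<forall>n. \<xi> \<in> C n \<longrightarrow> g \<xi> = 0"
    unfolding AE_all_countable using local[OF C(1,2)] by blast
  then show ?thesis
    unfolding AE_lebesgue_on[OF \<Omega>b] by eventually_elim (use C(3) in blast)
qed

lemma has_weak_hderiv_unique:
  assumes \<Omega>: "open \<Omega>" and g: "has_weak_hderiv \<Omega> i u g" "has_weak_hderiv \<Omega> i u g'"
  shows "AE \<xi> in lebesgue_on \<Omega>. g \<xi> = g' \<xi>"
proof -
  have l: "loc_integrable \<Omega> g" "loc_integrable \<Omega> g'" using g by (auto simp: has_weak_hderiv_def)
  have \<Omega>b: "\<Omega> \<in> sets borel" using \<Omega> by simp
  have "AE \<xi> in lebesgue_on \<Omega>. g \<xi> - g' \<xi> = 0"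
  proof (rule loc_integrable_AE_0[OF \<Omega>])
    show "loc_integrable \<Omega> (\<lambda>\<xi>. g \<xi> - g' \<xi>)" using l by (simp add: loc_integrable_def)
    fix \<phi> assume \<phi>: "\<phi> \<in> test_functions \<Omega>"
    obtain K where K: "compact K" "K \<subseteq> \<Omega>" "\<And>x. x \<notin> K \<Longrightarrow> \<phi> x = 0"
      by (rule test_support[OF \<phi>]) (rule that)
    have "integrable (lebesgue_on \<Omega>) (\<lambda>\<xi>. g \<xi> * \<phi> \<xi>)" "integrable (lebesgue_on \<Omega>) (\<lambda>\<xi>. g' \<xi> * \<phi> \<xi>)"
      by (rule loc_integrable_mult[OF _ K(1,2) \<Omega>b smooth_continuous[OF test_smooth[OF \<phi>]] K(3)], rule l, assumption)+
    then have "(LINT \<xi>|lebesgue_on \<Omega>. (g \<xi> - g' \<xi>) * \<phi> \<xi>)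
        = (LINT \<xi>|lebesgue_on \<Omega>. g \<xi> * \<phi> \<xi>) - (LINT \<xi>|lebesgue_on \<Omega>. g' \<xi> * \<phi> \<xi>)"
      by (simp add: left_diff_distrib)
    also have "\<dots> = 0" using g \<phi> by (simp add: has_weak_hderiv_def)
    finally show "(LINT \<xi>|lebesgue_on \<Omega>. (g \<xi> - g' \<xi>) * \<phi> \<xi>) = 0" .
  qed
  then show ?thesis by eventually_elim simp
qed

lemma borel_rep_outside: "borel_rep S u v \<Longrightarrow> x \<notin> S \<Longrightarrow> v x = 0"
  unfolding borel_rep_def by blast

section \<open>Square integrable functions\<close>

definition L2 :: "'a measure \<Rightarrow> ('a \<Rightarrow> real) \<Rightarrow> bool" where
  "L2 M f \<longleftrightarrow> f \<in> borel_measurable M \<and> integrable M (\<lambda>x. (f x)\<^sup>2)"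

lemma L2_measurable [measurable_dest]: "L2 M f \<Longrightarrow> f \<in> borel_measurable M"
  by (simp add: L2_def)

lemma L2_integrable_square: "L2 M f \<Longrightarrow> integrable M (\<lambda>x. (f x)\<^sup>2)"
  by (simp add: L2_def)

lemma L2_bound:
  assumes "L2 M f" "g \<in> borel_measurable M" "\<And>x. \<bar>g x\<bar> \<le> C * \<bar>f x\<bar>"
  shows "L2 M g"
proof -
  have "integrable M (\<lambda>x. (g x)\<^sup>2)"
  proof (rule integrable_pointwise_bound)
    show "integrable M (\<lambda>x. C\<^sup>2 * (f x)\<^sup>2)" using assms(1) by (simp add: L2_def)
    show "(\<lambda>x. (g x)\<^sup>2) \<in> borel_measurable M" using assms(2) by simp
    show "norm ((g x)\<^sup>2) \<le> norm (C\<^sup>2 * (f x)\<^sup>2)" for x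
      using power_mono[OF assms(3)[of x], of 2] by (simp add: power_mult_distrib)
  qed
  then show ?thesis using assms(2) by (simp add: L2_def)
qed

lemma L2_lincomb:
  assumes "L2 M f" "L2 M g"
  shows "L2 M (\<lambda>x. a * f x + b * g x)"
proof -
  have m: "(\<lambda>x. a * f x + b * g x) \<in> borel_measurable M" using assms by measurable
  have "integrable M (\<lambda>x. (a * f x + b * g x)\<^sup>2)"
  proof (rule integrable_pointwise_bound)
    show "integrable M (\<lambda>x. 2 * a\<^sup>2 * (f x)\<^sup>2 + 2 * b\<^sup>2 * (g x)\<^sup>2)" using assms by (simp add: L2_def)
    show "(\<lambda>x. (a * f x + b * g x)\<^sup>2) \<in> borel_measurable M" using m by simp
    show "norm ((a * f x + b * g x)\<^sup>2) \<le> norm (2 * a\<^sup>2 * (f x)\<^sup>2 + 2 * b\<^sup>2 * (g x)\<^sup>2)" for x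
      using power2_diff_le[of "a * f x" "- (b * g x)"] by (simp add: power_mult_distrib)
  qed
  with m show ?thesis by (simp add: L2_def)
qed

lemma L2_add: "L2 M f \<Longrightarrow> L2 M g \<Longrightarrow> L2 M (\<lambda>x. f x + g x)"
  using L2_lincomb[of M f g 1 1] by simp

lemma L2_diff: "L2 M f \<Longrightarrow> L2 M g \<Longrightarrow> L2 M (\<lambda>x. f x - g x)"
  using L2_lincomb[of M f g 1 "-1"] by simp

lemma L2_cmult: "L2 M f \<Longrightarrow> L2 M (\<lambda>x. c * f x)"
  using L2_lincomb[of M f f c 0] by simp

lemma L2_integrable_mult:
  assumes "L2 M f" "L2 M g"
  shows "integrable M (\<lambda>x. f x * g x)"
proof (rule integrable_pointwise_bound)
  show "integrable M (\<lambda>x. (f x)\<^sup>2 + (g x)\<^sup>2)" using assms by (simp add: L2_def)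
  show "(\<lambda>x. f x * g x) \<in> borel_measurable M" using assms by measurable
  fix x
  have "2 * (\<bar>f x\<bar> * \<bar>g x\<bar>) \<le> (f x)\<^sup>2 + (g x)\<^sup>2"
    using sum_squares_bound[of "\<bar>f x\<bar>" "\<bar>g x\<bar>"] by simp
  moreover have "0 \<le> \<bar>f x\<bar> * \<bar>g x\<bar>" by simp
  ultimately have "\<bar>f x\<bar> * \<bar>g x\<bar> \<le> (f x)\<^sup>2 + (g x)\<^sup>2" by linarith
  then show "norm (f x * g x) \<le> norm ((f x)\<^sup>2 + (g x)\<^sup>2)" by (simp add: abs_mult)
qed

lemma L2_Cauchy_Schwarz:
  assumes f: "L2 M f" and g: "L2 M g"
  shows "\<bar>LINT x|M. f x * g x\<bar> \<le> sqrt (LINT x|M. (f x)\<^sup>2) * sqrt (LINT x|M. (g x)\<^sup>2)"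
proof -
  define A B P where "A = (LINT x|M. (f x)\<^sup>2)" and "B = (LINT x|M. (g x)\<^sup>2)" and "P = (LINT x|M. f x * g x)"
  note i = L2_integrable_mult[OF f g] L2_integrable_square[OF f] L2_integrable_square[OF g]
  have q: "0 \<le> a\<^sup>2 * A + 2 * a * b * P + b\<^sup>2 * B" for a b
  proof -
    have "0 \<le> (LINT x|M. (a * f x + b * g x)\<^sup>2)" by simp
    also have "(\<lambda>x. (a * f x + b * g x)\<^sup>2) = (\<lambda>x. a\<^sup>2 * (f x)\<^sup>2 + 2 * a * b * (f x * g x) + b\<^sup>2 * (g x)\<^sup>2)"
      by (auto simp: power2_eq_square algebra_simps)
    finally show ?thesis using i by (simp add: A_def B_def P_def)
  qed
  have AB: "A \<ge> 0" "B \<ge> 0" by (simp_all add: A_def B_def)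
  have "P\<^sup>2 \<le> A * B"
  proof (cases "B = 0")
    case True
    have "P = 0"
    proof (rule ccontr)
      assume "P \<noteq> 0"
      \<comment> \<open>With B = 0 this choice gives the quadratic form the value A - (A + 1) =
        -1.\<close>
      then show False using q[of 1 "- (A + 1) / (2 * P)"] True by (simp add: field_simps)
    qed
    then show ?thesis using True by simp
  next
    case False
    then have "B > 0" using AB by simp
    \<comment> \<open>The minimizing ratio a : b = B : - P of the quadratic form.\<close>
    then have "0 \<le> B * (A * B - P\<^sup>2)" using q[of B "- P"] by (simp add: power2_eq_square algebra_simps)
    then show ?thesis using \<open>B > 0\<close> by (simp add: zero_le_mult_iff)
  qed
  then have "\<bar>P\<bar> \<le> sqrt (A * B)" by (intro real_le_rsqrt) simp
  then show ?thesis by (simp add: A_def B_def P_def real_sqrt_mult)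
qed

lemma L2_Cauchy_Schwarz_abs:
  assumes f: "L2 M f" and g: "L2 M g"
  shows "(LINT x|M. \<bar>f x\<bar> * \<bar>g x\<bar>) \<le> sqrt (LINT x|M. (f x)\<^sup>2) * sqrt (LINT x|M. (g x)\<^sup>2)"
proof -
  have a: "L2 M (\<lambda>x. \<bar>h x\<bar>)" if "L2 M h" for h
  proof (rule L2_bound[OF that, of _ 1])
    show "(\<lambda>x. \<bar>h x\<bar>) \<in> borel_measurable M" using that by measurable
  qed simp
  show ?thesis using L2_Cauchy_Schwarz[OF a[OF f] a[OF g]] by simp
qed

lemma (in finite_measure) L2_const: "L2 M (\<lambda>_. c)"
  by (simp add: L2_def)

lemma (in finite_measure) L2_integrable: "L2 M f \<Longrightarrow> integrable M f"
  using L2_integrable_mult[OF _ L2_const[of 1]] by simp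

lemma (in finite_measure) L2_bounded:
  assumes "f \<in> borel_measurable M" "\<And>x. \<bar>f x\<bar> \<le> B"
  shows "L2 M f"
  by (rule L2_bound[OF L2_const[of 1], of _ B]) (use assms in simp_all)

lemma L2_cong_AE:
  assumes "L2 M f" "g \<in> borel_measurable M" "AE x in M. f x = g x"
  shows "L2 M g" "(LINT x|M. (f x)\<^sup>2) = (LINT x|M. (g x)\<^sup>2)"
proof -
  have ae: "AE x in M. (f x)\<^sup>2 = (g x)\<^sup>2" using assms(3) by eventually_elim simp
  have m: "(\<lambda>x. (f x)\<^sup>2) \<in> borel_measurable M" "(\<lambda>x. (g x)\<^sup>2) \<in> borel_measurable M"
    using assms(1,2) by measurable
  show "L2 M g" using integrable_cong_AE[OF m ae] assms by (simp add: L2_def)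
  show "(LINT x|M. (f x)\<^sup>2) = (LINT x|M. (g x)\<^sup>2)" by (rule integral_cong_AE[OF m ae])
qed

section \<open>Functions with square integrable weak derivatives\<close>

text \<open>The derivatives are carried as an explicit family g, which permits computing with
  concrete formulas. The chosen \<open>weak_hderiv\<close> is exchanged for g by uniqueness when
  energies are evaluated.\<close>

definition sobolev ::
    "'n::finite heis set \<Rightarrow> ('n heis \<Rightarrow> real) \<Rightarrow> ('n + 'n \<Rightarrow> 'n heis \<Rightarrow> real) \<Rightarrow> bool" where
  "sobolev \<Omega> u g \<longleftrightarrow> L2 (lebesgue_on \<Omega>) u \<and>
    (\<forall>i. L2 (lebesgue_on \<Omega>) (g i) \<and> has_weak_hderiv \<Omega> i u (g i))"

lemma sobolevD:
  assumes "sobolev \<Omega> u g"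
  shows "L2 (lebesgue_on \<Omega>) u" "L2 (lebesgue_on \<Omega>) (g i)" "has_weak_hderiv \<Omega> i u (g i)"
    "\<phi> \<in> test_functions \<Omega> \<Longrightarrow>
      (LINT \<xi>|lebesgue_on \<Omega>. u \<xi> * hderiv i \<phi> \<xi>) = - (LINT \<xi>|lebesgue_on \<Omega>. g i \<xi> * \<phi> \<xi>)"
  using assms by (auto simp: sobolev_def has_weak_hderiv_def)

lemma finite_measure_open_bounded: "open \<Omega> \<Longrightarrow> bounded \<Omega> \<Longrightarrow> finite_measure (lebesgue_on \<Omega>)"
  by (simp add: finite_measure_lebesgue_on lmeasurable_open)

lemma integrable_lebesgue_on_subset:
  fixes u :: "'a::euclidean_space \<Rightarrow> real"
  assumes "integrable (lebesgue_on S) u" "K \<subseteq> S" and [measurable]: "S \<in> sets borel" "K \<in> sets borel"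
  shows "integrable (lebesgue_on K) u"
proof -
  have "integrable lebesgue (\<lambda>x. indicator S x *\<^sub>R u x)"
    using assms(1) by (subst (asm) integrable_restrict_space) simp_all
  then have "integrable lebesgue (\<lambda>x. indicator K x *\<^sub>R (indicator S x *\<^sub>R u x))"
    by (rule integrable_mult_indicator[rotated]) simp
  also have "(\<lambda>x. indicator K x *\<^sub>R (indicator S x *\<^sub>R u x)) = (\<lambda>x. indicator K x *\<^sub>R u x)"
    using assms(2) by (auto simp: indicator_def fun_eq_iff)
  finally show ?thesis by (subst integrable_restrict_space) simp_all
qed

text \<open>Of a weak derivative picked by choice only local integrability is known; gluing over a
  compact exhaustion makes it measurable on all of \<Omega>.\<close>

lemma loc_integrable_measurable:
  assumes "open \<Omega>" "loc_integrable \<Omega> u"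
  shows "u \<in> borel_measurable (lebesgue_on \<Omega>)"
proof -
  obtain C :: "nat \<Rightarrow> 'a heis set" where C: "\<And>n. compact (C n)" "\<And>n. C n \<subseteq> \<Omega>" "\<Omega> = (\<Union>n. C n)"
    using open_Union_compact_subsets[OF assms(1)] by metis
  have Cb: "C n \<in> sets borel" for n using C(1) by (simp add: borel_compact)
  have "(\<lambda>x. if x \<in> \<Omega> then u x else 0) \<in> borel_measurable lebesgue"
  proof (rule measurable_piecewise_restrict[where C="insert (- \<Omega>) (range C)"])
    fix S assume "S \<in> insert (- \<Omega>) (range C)"
    then consider "S = - \<Omega>" | n where "S = C n" by auto
    then show "(\<lambda>x. if x \<in> \<Omega> then u x else 0) \<in> borel_measurable (lebesgue_on S)"
    proof cases
      case 1
      then have "(\<lambda>x. if x \<in> \<Omega> then u x else 0) \<in> borel_measurable (lebesgue_on S) \<longleftrightarrow>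
          (\<lambda>x. 0::real) \<in> borel_measurable (lebesgue_on S)"
        by (intro measurable_cong) (auto simp: space_restrict_space)
      then show ?thesis by simp
    next
      case 2
      then have "(\<lambda>x. if x \<in> \<Omega> then u x else 0) \<in> borel_measurable (lebesgue_on S) \<longleftrightarrow>
          u \<in> borel_measurable (lebesgue_on S)"
        using C(2) by (intro measurable_cong) (auto simp: space_restrict_space)
      moreover have "integrable (lebesgue_on S) u"
        using assms(2) C(1,2) 2 by (simp add: loc_integrable_def)
      then have "u \<in> borel_measurable (lebesgue_on S)" by (rule borel_measurable_integrable)
      ultimately show ?thesis by blast
    qed
  qed (use Cb assms(1) C(3) in auto)
  then have "(\<lambda>x. if x \<in> \<Omega> then u x else 0) \<in> borel_measurable (lebesgue_on \<Omega>)"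
    by (rule measurable_restrict_space1)
  moreover have "(\<lambda>x. if x \<in> \<Omega> then u x else 0) \<in> borel_measurable (lebesgue_on \<Omega>) \<longleftrightarrow>
      u \<in> borel_measurable (lebesgue_on \<Omega>)"
    by (intro measurable_cong) (auto simp: space_restrict_space)
  ultimately show ?thesis by simp
qed

locale bounded_open =
  fixes \<Omega> :: "'n::finite heis set"
  assumes open_\<Omega>: "open \<Omega>" and bounded_\<Omega>: "bounded \<Omega>"
begin

sublocale \<Omega>: finite_measure "lebesgue_on \<Omega>"
  by (rule finite_measure_open_bounded[OF open_\<Omega> bounded_\<Omega>])

lemma \<Omega>_borel: "\<Omega> \<in> sets borel"
  using open_\<Omega> by simp

lemma L2_loc_integrable:
  assumes "L2 (lebesgue_on \<Omega>) u"
  shows "loc_integrable \<Omega> u"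
  unfolding loc_integrable_def
  using integrable_lebesgue_on_subset[OF \<Omega>.L2_integrable[OF assms] _ \<Omega>_borel] by (simp add: borel_compact)

lemma L2_continuous:
  assumes "continuous_on UNIV c"
  shows "L2 (lebesgue_on \<Omega>) c"
proof -
  have "bounded (c ` closure \<Omega>)"
    using assms bounded_\<Omega> by (intro compact_imp_bounded compact_continuous_image) (auto intro: continuous_on_subset)
  then obtain B where B: "B > 0" "\<And>x. x \<in> closure \<Omega> \<Longrightarrow> \<bar>c x\<bar> \<le> B" unfolding bounded_pos by auto
  have cm: "c \<in> borel_measurable (lebesgue_on \<Omega>)" by (rule continuous_measurable_lebesgue_on[OF assms])
  \<comment> \<open>\<open>\<Omega>.L2_bounded\<close> asks for a bound at every point of the type,
    so c is clamped; on \<Omega> nothing changes.\<close>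
  have "L2 (lebesgue_on \<Omega>) (\<lambda>x. max (- B) (min B (c x)))"
    by (rule \<Omega>.L2_bounded[of _ B]) (use cm B in auto)
  moreover have "AE x in lebesgue_on \<Omega>. max (- B) (min B (c x)) = c x"
  proof (rule AE_I2)
    fix x assume "x \<in> space (lebesgue_on \<Omega>)"
    then have "\<bar>c x\<bar> \<le> B" using B(2)[of x] closure_subset[of \<Omega>] by (auto simp: space_restrict_space)
    then show "max (- B) (min B (c x)) = c x" by auto
  qed
  ultimately show ?thesis using L2_cong_AE(1) cm by blast
qed

lemma sobolevI:
  assumes "L2 (lebesgue_on \<Omega>) u" "\<And>i. L2 (lebesgue_on \<Omega>) (g i)"
    "\<And>i \<phi>. \<phi> \<in> test_functions \<Omega> \<Longrightarrow>
      (LINT \<xi>|lebesgue_on \<Omega>. u \<xi> * hderiv i \<phi> \<xi>) = - (LINT \<xi>|lebesgue_on \<Omega>. g i \<xi> * \<phi> \<xi>)"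
  shows "sobolev \<Omega> u g"
  using assms by (simp add: sobolev_def has_weak_hderiv_def L2_loc_integrable)

lemma L2_test:
  assumes "\<phi> \<in> test_functions U"
  shows "L2 (lebesgue_on \<Omega>) \<phi>" "L2 (lebesgue_on \<Omega>) (hderiv i \<phi>)"
  using smooth_continuous continuous_on_hderiv_smooth test_smooth[OF assms] by (auto intro: L2_continuous)

lemma sobolev_lincomb:
  assumes u: "sobolev \<Omega> u g" and v: "sobolev \<Omega> v h"
  shows "sobolev \<Omega> (\<lambda>\<xi>. a * u \<xi> + b * v \<xi>) (\<lambda>i \<xi>. a * g i \<xi> + b * h i \<xi>)"
proof (rule sobolevI)
  fix i \<phi> assume \<phi>: "\<phi> \<in> test_functions \<Omega>"
  note i = L2_integrable_mult[OF sobolevD(1)[OF u] L2_test(2)[OF \<phi>]] L2_integrable_mult[OF sobolevD(1)[OF v] L2_test(2)[OF \<phi>]]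
    L2_integrable_mult[OF sobolevD(2)[OF u] L2_test(1)[OF \<phi>]] L2_integrable_mult[OF sobolevD(2)[OF v] L2_test(1)[OF \<phi>]]
  have "(LINT \<xi>|lebesgue_on \<Omega>. (a * u \<xi> + b * v \<xi>) * hderiv i \<phi> \<xi>)
    = a * (LINT \<xi>|lebesgue_on \<Omega>. u \<xi> * hderiv i \<phi> \<xi>) + b * (LINT \<xi>|lebesgue_on \<Omega>. v \<xi> * hderiv i \<phi> \<xi>)"
    using i by (simp add: distrib_right mult.assoc)
  also have "\<dots> = - (a * (LINT \<xi>|lebesgue_on \<Omega>. g i \<xi> * \<phi> \<xi>) + b * (LINT \<xi>|lebesgue_on \<Omega>. h i \<xi> * \<phi> \<xi>))"
    using sobolevD(4)[OF u \<phi>] sobolevD(4)[OF v \<phi>] by simp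
  also have "a * (LINT \<xi>|lebesgue_on \<Omega>. g i \<xi> * \<phi> \<xi>) + b * (LINT \<xi>|lebesgue_on \<Omega>. h i \<xi> * \<phi> \<xi>)
     = (LINT \<xi>|lebesgue_on \<Omega>. (a * g i \<xi> + b * h i \<xi>) * \<phi> \<xi>)"
    using i by (simp add: distrib_right mult.assoc)
  finally show "(LINT \<xi>|lebesgue_on \<Omega>. (a * u \<xi> + b * v \<xi>) * hderiv i \<phi> \<xi>)
     = - (LINT \<xi>|lebesgue_on \<Omega>. (a * g i \<xi> + b * h i \<xi>) * \<phi> \<xi>)" .
qed (use u v in \<open>auto intro: L2_lincomb dest: sobolevD\<close>)

lemma integral_compact_support_eq:
  fixes c :: "'n heis \<Rightarrow> real"
  assumes "continuous_on UNIV c" "K \<subseteq> \<Omega>" "\<And>\<xi>. \<xi> \<notin> K \<Longrightarrow> c \<xi> = 0"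
  shows "(LINT \<xi>|lebesgue_on \<Omega>. c \<xi>) = (LINT \<xi>|lborel. c \<xi>)"
proof -
  have "borel_rep \<Omega> c c"
    using assms continuous_measurable_lebesgue_on[OF assms(1)] borel_measurable_continuous_onI[OF assms(1)]
    unfolding borel_rep_def by blast
  from borel_rep_integral[OF \<Omega>_borel this] show ?thesis by simp
qed

text \<open>The integrand is the derivative of T(m) \<phi> along the field, and such integrals
  vanish. The identity T gives integration by parts for smooth functions, a constant T gives
  derivative zero for constants, and general T feeds the chain rule.\<close>

lemma integral_chain_smooth_test:
  assumes T: "\<And>s. (T has_real_derivative T' s) (at s)" "continuous_on UNIV T'"
    and m: "smooth_fun_on UNIV m" and \<phi>: "\<phi> \<in> test_functions \<Omega>"
  shows "(LINT \<xi>|lebesgue_on \<Omega>. T (m \<xi>) * hderiv i \<phi> \<xi> + T' (m \<xi>) * hderiv i m \<xi> * \<phi> \<xi>) = 0"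
proof -
  obtain K B where K: "compact K" "K \<subseteq> \<Omega>" "\<And>\<xi>. \<xi> \<notin> K \<Longrightarrow> \<phi> \<xi> = 0" "\<And>\<xi> i. \<xi> \<notin> K \<Longrightarrow> hderiv i \<phi> \<xi> = 0"
    "continuous_on UNIV \<phi>" "\<And>i. continuous_on UNIV (hderiv i \<phi>)"
    by (rule test_hderiv[OF \<phi>]) (rule that)
  have Tc: "continuous_on UNIV T"
    using T(1) by (intro continuous_at_imp_continuous_on ballI DERIV_isCont)
  note mc = smooth_continuous[OF m]
  have c1: "continuous_on UNIV (\<lambda>\<xi>. T (m \<xi>))" "continuous_on UNIV (\<lambda>\<xi>. T' (m \<xi>))"
    by (rule continuous_on_compose2[OF Tc mc], simp, rule continuous_on_compose2[OF T(2) mc], simp)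
  let ?G = "\<lambda>\<xi>. T (m \<xi>) * hderiv i \<phi> \<xi> + T' (m \<xi>) * hderiv i m \<xi> * \<phi> \<xi>"
  have G: "continuous_on UNIV ?G"
    by (intro continuous_intros c1 K continuous_on_hderiv_smooth m)
  have D: "((\<lambda>s. T (m (\<xi> + s *\<^sub>R hfield i \<xi>)) * \<phi> (\<xi> + s *\<^sub>R hfield i \<xi>)) has_real_derivative ?G \<xi>) (at 0)" for \<xi>
  proof -
    have "((\<lambda>s. T (m (\<xi> + s *\<^sub>R hfield i \<xi>))) has_real_derivative T' (m \<xi>) * hderiv i m \<xi>) (at 0)"
      using DERIV_chain2[OF _ smooth_flow_derivative[OF m], of T "T' (m \<xi>)" \<xi> i] T(1) by simp
    from DERIV_mult[OF this smooth_flow_derivative[OF test_smooth[OF \<phi>], of \<xi> i]]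
    show ?thesis by (simp add: algebra_simps)
  qed
  have "(LINT \<xi>|lborel. ?G \<xi>) = 0"
    by (rule integral_flow_derivative_eq_0[of "\<lambda>\<xi>. T (m \<xi>) * \<phi> \<xi>" i, OF D _ G K(1)])
      (use K c1 in \<open>auto intro!: continuous_intros\<close>)
  moreover have "(LINT \<xi>|lebesgue_on \<Omega>. ?G \<xi>) = (LINT \<xi>|lborel. ?G \<xi>)"
    by (rule integral_compact_support_eq[OF G K(2)]) (simp add: K)
  ultimately show ?thesis by simp
qed

lemma sobolev_test:
  assumes \<phi>: "\<phi> \<in> test_functions \<Omega>"
  shows "sobolev \<Omega> \<phi> (\<lambda>i. hderiv i \<phi>)"
proof (rule sobolevI)
  fix i \<psi> assume \<psi>: "\<psi> \<in> test_functions \<Omega>"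
  have "(LINT \<xi>|lebesgue_on \<Omega>. \<phi> \<xi> * hderiv i \<psi> \<xi> + hderiv i \<phi> \<xi> * \<psi> \<xi>) = 0"
    using integral_chain_smooth_test[OF _ _ test_smooth[OF \<phi>] \<psi>, of "\<lambda>s. s" "\<lambda>_. 1" i] by simp
  then show "(LINT \<xi>|lebesgue_on \<Omega>. \<phi> \<xi> * hderiv i \<psi> \<xi>) = - (LINT \<xi>|lebesgue_on \<Omega>. hderiv i \<phi> \<xi> * \<psi> \<xi>)"
    using L2_integrable_mult[OF L2_test(1)[OF \<phi>] L2_test(2)[OF \<psi>]]
      L2_integrable_mult[OF L2_test(2)[OF \<phi>] L2_test(1)[OF \<psi>]] by simp
qed (use L2_test[OF \<phi>] in auto)

section \<open>Link between \<open>sobolev\<close> and the spaces \<open>W1p\<close> and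
  \<open>W1p_0\<close> for exponent 2\<close>

lemma Lp_2: "f \<in> Lp 2 \<Omega> \<longleftrightarrow> L2 (lebesgue_on \<Omega>) f"
  by (simp add: Lp_def L2_def)

lemma Lp_norm_2: "Lp_norm 2 \<Omega> f = sqrt (LINT \<xi>|lebesgue_on \<Omega>. (f \<xi>)\<^sup>2)"
  by (simp add: Lp_norm_def powr_half_sqrt)

text \<open>Uniqueness identifies the chosen derivative with g almost everywhere, and square
  integrability is inherited.\<close>

lemma sobolev_weak_hderiv:
  assumes u: "sobolev \<Omega> u g"
  shows "sobolev \<Omega> u (\<lambda>i. weak_hderiv \<Omega> i u)"
    "AE \<xi> in lebesgue_on \<Omega>. weak_hderiv \<Omega> i u \<xi> = g i \<xi>"
proof -
  have w: "has_weak_hderiv \<Omega> i u (weak_hderiv \<Omega> i u)" for i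
    unfolding weak_hderiv_def by (rule someI[of _ "g i"]) (rule sobolevD[OF u])
  show ae: "AE \<xi> in lebesgue_on \<Omega>. weak_hderiv \<Omega> i u \<xi> = g i \<xi>" for i
    by (rule has_weak_hderiv_unique[OF open_\<Omega> w sobolevD(3)[OF u]])
  have "L2 (lebesgue_on \<Omega>) (weak_hderiv \<Omega> i u)" for i
  proof -
    have *: "AE \<xi> in lebesgue_on \<Omega>. g i \<xi> = weak_hderiv \<Omega> i u \<xi>" using ae[of i] by eventually_elim simp
    have "weak_hderiv \<Omega> i u \<in> borel_measurable (lebesgue_on \<Omega>)"
      using loc_integrable_measurable[OF open_\<Omega>] w[of i] by (simp add: has_weak_hderiv_def)
    then show ?thesis by (rule L2_cong_AE(1)[OF sobolevD(2)[OF u, of i] _ *])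
  qed
  then show "sobolev \<Omega> u (\<lambda>i. weak_hderiv \<Omega> i u)"
    using w sobolevD(1)[OF u] by (simp add: sobolev_def)
qed


lemma sobolev_L2_weak_eq:
  assumes "sobolev \<Omega> u g"
  shows "(LINT \<xi>|lebesgue_on \<Omega>. (weak_hderiv \<Omega> i u \<xi>)\<^sup>2) = (LINT \<xi>|lebesgue_on \<Omega>. (g i \<xi>)\<^sup>2)"
  by (rule L2_cong_AE(2)[OF sobolevD(2)[OF sobolev_weak_hderiv(1)[OF assms]] L2_measurable[OF sobolevD(2)[OF assms]]
    sobolev_weak_hderiv(2)[OF assms]])

lemma W1p_2: "u \<in> W1p 2 \<Omega> \<longleftrightarrow> (\<exists>g. sobolev \<Omega> u g)"
  unfolding W1p_def sobolev_def mem_Collect_eq Lp_2 Bex_def by (auto simp: choice_iff[symmetric] dest: choice)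

lemma W1p_2_sobolev: "u \<in> W1p 2 \<Omega> \<Longrightarrow> sobolev \<Omega> u (\<lambda>i. weak_hderiv \<Omega> i u)"
  using sobolev_weak_hderiv(1) by (auto simp: W1p_2)

lemma sobolev_W1p: "sobolev \<Omega> u g \<Longrightarrow> u \<in> W1p 2 \<Omega>"
  by (auto simp: W1p_2)

lemma sobolev_diff: "sobolev \<Omega> u g \<Longrightarrow> sobolev \<Omega> v h \<Longrightarrow> sobolev \<Omega> (\<lambda>\<xi>. u \<xi> - v \<xi>) (\<lambda>i \<xi>. g i \<xi> - h i \<xi>)"
  using sobolev_lincomb[of u g v h 1 "-1"] by simp

lemma W1p_0_I:
  assumes u: "sobolev \<Omega> u g"
    and a: "\<And>e. e > 0 \<Longrightarrow> \<exists>\<phi>\<in>test_functions \<Omega>. (LINT \<xi>|lebesgue_on \<Omega>. (u \<xi> - \<phi> \<xi>)\<^sup>2) \<le> e \<and>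
      (\<forall>i. (LINT \<xi>|lebesgue_on \<Omega>. (g i \<xi> - hderiv i \<phi> \<xi>)\<^sup>2) \<le> e)"
  shows "u \<in> W1p_0 2 \<Omega>"
proof -
  have "\<exists>\<phi>\<in>test_functions \<Omega>. W1p_norm 2 \<Omega> (\<lambda>\<xi>. u \<xi> - \<phi> \<xi>) < e" if e: "e > 0" for e
  proof -
    define n where "n = real (card (UNIV :: ('n + 'n) set))"
    have n: "n \<ge> 0" by (simp add: n_def)
    define e' where "e' = (e / 2) / (1 + n)"
    have n1: "1 + n > 0" using n by simp
    \<comment> \<open>The norm has 1 + n terms, each at most \<open>e'\<close>; the half of e makes
      the final inequality strict.\<close>
    have e': "e' > 0" using e n1 by (simp add: e'_def)
    obtain \<phi> where \<phi>: "\<phi> \<in> test_functions \<Omega>" "(LINT \<xi>|lebesgue_on \<Omega>. (u \<xi> - \<phi> \<xi>)\<^sup>2) \<le> e'\<^sup>2"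
      "\<And>i. (LINT \<xi>|lebesgue_on \<Omega>. (g i \<xi> - hderiv i \<phi> \<xi>)\<^sup>2) \<le> e'\<^sup>2"
      using a[of "e'\<^sup>2"] e' by auto
    note s = sobolev_diff[OF u sobolev_test[OF \<phi>(1)]]
    have "Lp_norm 2 \<Omega> (\<lambda>\<xi>. u \<xi> - \<phi> \<xi>) \<le> e'"
      unfolding Lp_norm_2 using \<phi>(2) e' by (intro real_le_lsqrt) auto
    moreover have "Lp_norm 2 \<Omega> (weak_hderiv \<Omega> i (\<lambda>\<xi>. u \<xi> - \<phi> \<xi>)) \<le> e'" for i
      unfolding Lp_norm_2 sobolev_L2_weak_eq[OF s] using \<phi>(3)[of i] e' by (intro real_le_lsqrt) auto
    then have "(\<Sum>i\<in>UNIV. Lp_norm 2 \<Omega> (weak_hderiv \<Omega> i (\<lambda>\<xi>. u \<xi> - \<phi> \<xi>))) \<le> n * e'"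
      unfolding n_def by (intro sum_bounded_above)
    ultimately have "W1p_norm 2 \<Omega> (\<lambda>\<xi>. u \<xi> - \<phi> \<xi>) \<le> (1 + n) * e'"
      unfolding W1p_norm_def by (simp add: distrib_right)
    also have "\<dots> = e / 2" using n1 unfolding e'_def by (metis less_irrefl nonzero_eq_divide_eq mult.commute)
    also have "\<dots> < e" using e by simp
    finally show ?thesis using \<phi>(1) by blast
  qed
  then show ?thesis using u by (auto simp: W1p_0_def W1p_2)
qed

lemma W1p_0_D:
  assumes u: "u \<in> W1p_0 2 \<Omega>" "sobolev \<Omega> u g" and e: "e > 0"
  obtains \<phi> where "\<phi> \<in> test_functions \<Omega>" "(LINT \<xi>|lebesgue_on \<Omega>. (u \<xi> - \<phi> \<xi>)\<^sup>2) \<le> e"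
      "\<And>i. (LINT \<xi>|lebesgue_on \<Omega>. (g i \<xi> - hderiv i \<phi> \<xi>)\<^sup>2) \<le> e"
proof -
  obtain \<phi> where \<phi>: "\<phi> \<in> test_functions \<Omega>" "W1p_norm 2 \<Omega> (\<lambda>\<xi>. u \<xi> - \<phi> \<xi>) < sqrt e"
  proof -
    have "sqrt e > 0" using e by simp
    then show ?thesis using u(1) that unfolding W1p_0_def by blast
  qed
  note s = sobolev_diff[OF u(2) sobolev_test[OF \<phi>(1)]]
  have nn: "Lp_norm 2 \<Omega> f \<ge> 0" for f by (simp add: Lp_norm_2)
  let ?S = "\<Sum>i\<in>UNIV. Lp_norm 2 \<Omega> (weak_hderiv \<Omega> i (\<lambda>\<xi>. u \<xi> - \<phi> \<xi>))"
  have S: "?S \<ge> 0" by (intro sum_nonneg nn)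
  show ?thesis
  proof (rule that[OF \<phi>(1)])
    have "Lp_norm 2 \<Omega> (\<lambda>\<xi>. u \<xi> - \<phi> \<xi>) \<le> sqrt e" using \<phi>(2) S by (simp add: W1p_norm_def)
    then show "(LINT \<xi>|lebesgue_on \<Omega>. (u \<xi> - \<phi> \<xi>)\<^sup>2) \<le> e" by (simp add: Lp_norm_2)
    fix i
    have "Lp_norm 2 \<Omega> (weak_hderiv \<Omega> i (\<lambda>\<xi>. u \<xi> - \<phi> \<xi>)) \<le> ?S"
      by (rule member_le_sum) (simp_all add: nn)
    then have "Lp_norm 2 \<Omega> (weak_hderiv \<Omega> i (\<lambda>\<xi>. u \<xi> - \<phi> \<xi>)) \<le> sqrt e"
      using \<phi>(2) nn[of "\<lambda>\<xi>. u \<xi> - \<phi> \<xi>"] by (simp add: W1p_norm_def)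
    then show "(LINT \<xi>|lebesgue_on \<Omega>. (g i \<xi> - hderiv i \<phi> \<xi>)\<^sup>2) \<le> e"
      by (simp add: Lp_norm_2 sobolev_L2_weak_eq[OF s])
  qed
qed

lemma integral_lincomb_square_le:
  assumes "L2 M f" "L2 M g" "(LINT x|M. (f x)\<^sup>2) \<le> e" "(LINT x|M. (g x)\<^sup>2) \<le> e"
  shows "(LINT x|M. (a * f x + b * g x)\<^sup>2) \<le> (2 * a\<^sup>2 + 2 * b\<^sup>2) * e"
proof -
  have "(LINT x|M. (a * f x + b * g x)\<^sup>2) \<le> (LINT x|M. 2 * a\<^sup>2 * (f x)\<^sup>2 + 2 * b\<^sup>2 * (g x)\<^sup>2)"
  proof (rule integral_mono)
    show "integrable M (\<lambda>x. (a * f x + b * g x)\<^sup>2)" by (rule L2_integrable_square[OF L2_lincomb[OF assms(1,2)]])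
    show "integrable M (\<lambda>x. 2 * a\<^sup>2 * (f x)\<^sup>2 + 2 * b\<^sup>2 * (g x)\<^sup>2)"
      using L2_integrable_square[OF assms(1)] L2_integrable_square[OF assms(2)] by simp
    show "(a * f x + b * g x)\<^sup>2 \<le> 2 * a\<^sup>2 * (f x)\<^sup>2 + 2 * b\<^sup>2 * (g x)\<^sup>2" for x
      using power2_diff_le[of "a * f x" "- (b * g x)"] by (simp add: power_mult_distrib)
  qed
  also have "\<dots> = 2 * a\<^sup>2 * (LINT x|M. (f x)\<^sup>2) + 2 * b\<^sup>2 * (LINT x|M. (g x)\<^sup>2)"
    using L2_integrable_square[OF assms(1)] L2_integrable_square[OF assms(2)] by simp
  also have "\<dots> \<le> 2 * a\<^sup>2 * e + 2 * b\<^sup>2 * e"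
    using assms by (intro add_mono mult_left_mono) auto
  finally show ?thesis by (simp add: distrib_right)
qed

text \<open>Ensures that perturbed minimizers and midpoints of two minimizers stay in the class with
  boundary values v.\<close>

lemma W1p_0_lincomb:
  assumes u: "u \<in> W1p_0 2 \<Omega>" and v: "v \<in> W1p_0 2 \<Omega>"
  shows "(\<lambda>\<xi>. a * u \<xi> + b * v \<xi>) \<in> W1p_0 2 \<Omega>"
proof -
  obtain g h where g: "sobolev \<Omega> u g" and h: "sobolev \<Omega> v h" using u v by (auto simp: W1p_0_def W1p_2)
  show ?thesis
  proof (rule W1p_0_I[OF sobolev_lincomb[OF g h]])
    fix e :: real assume e: "e > 0"
    define c where "c = 2 * a\<^sup>2 + 2 * b\<^sup>2"
    have c: "c \<ge> 0" by (simp add: c_def)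
    define e' where "e' = e / (c + 1)"
    have e': "e' > 0" "c * e' \<le> e" using e c by (auto simp: e'_def field_simps)
    obtain \<phi> where \<phi>: "\<phi> \<in> test_functions \<Omega>" "(LINT \<xi>|lebesgue_on \<Omega>. (u \<xi> - \<phi> \<xi>)\<^sup>2) \<le> e'"
      "\<And>i. (LINT \<xi>|lebesgue_on \<Omega>. (g i \<xi> - hderiv i \<phi> \<xi>)\<^sup>2) \<le> e'"
      by (rule W1p_0_D[OF u g e'(1)]) (rule that)
    obtain \<psi> where \<psi>: "\<psi> \<in> test_functions \<Omega>" "(LINT \<xi>|lebesgue_on \<Omega>. (v \<xi> - \<psi> \<xi>)\<^sup>2) \<le> e'"
      "\<And>i. (LINT \<xi>|lebesgue_on \<Omega>. (h i \<xi> - hderiv i \<psi> \<xi>)\<^sup>2) \<le> e'"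
      by (rule W1p_0_D[OF v h e'(1)]) (rule that)
    note t = test_lincomb[OF \<phi>(1) \<psi>(1), of a b]
    have hd: "hderiv i (\<lambda>x. a * \<phi> x + b * \<psi> x) \<xi> = a * hderiv i \<phi> \<xi> + b * hderiv i \<psi> \<xi>" for i \<xi>
      using DERIV_unique[OF smooth_flow_derivative[OF test_smooth[OF t]]
        DERIV_add[OF DERIV_cmult[OF smooth_flow_derivative[OF test_smooth[OF \<phi>(1)]]]
          DERIV_cmult[OF smooth_flow_derivative[OF test_smooth[OF \<psi>(1)]]]]] .
    note su = sobolev_diff[OF g sobolev_test[OF \<phi>(1)]] and sv = sobolev_diff[OF h sobolev_test[OF \<psi>(1)]]
    show "\<exists>\<phi>\<in>test_functions \<Omega>. (LINT \<xi>|lebesgue_on \<Omega>. (a * u \<xi> + b * v \<xi> - \<phi> \<xi>)\<^sup>2) \<le> e \<and>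
      (\<forall>i. (LINT \<xi>|lebesgue_on \<Omega>. (a * g i \<xi> + b * h i \<xi> - hderiv i \<phi> \<xi>)\<^sup>2) \<le> e)"
    proof (intro bexI[OF _ t] conjI allI)
      have "(LINT \<xi>|lebesgue_on \<Omega>. (a * (u \<xi> - \<phi> \<xi>) + b * (v \<xi> - \<psi> \<xi>))\<^sup>2) \<le> c * e'"
        unfolding c_def by (rule integral_lincomb_square_le[OF sobolevD(1)[OF su] sobolevD(1)[OF sv] \<phi>(2) \<psi>(2)])
      then show "(LINT \<xi>|lebesgue_on \<Omega>. (a * u \<xi> + b * v \<xi> - (a * \<phi> \<xi> + b * \<psi> \<xi>))\<^sup>2) \<le> e"
        using e'(2) by (simp add: algebra_simps)
      fix i
      have "(LINT \<xi>|lebesgue_on \<Omega>. (a * (g i \<xi> - hderiv i \<phi> \<xi>) + b * (h i \<xi> - hderiv i \<psi> \<xi>))\<^sup>2) \<le> c * e'"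
        unfolding c_def by (rule integral_lincomb_square_le[OF sobolevD(2)[OF su] sobolevD(2)[OF sv] \<phi>(3) \<psi>(3)])
      then show "(LINT \<xi>|lebesgue_on \<Omega>. (a * g i \<xi> + b * h i \<xi> - hderiv i (\<lambda>\<xi>. a * \<phi> \<xi> + b * \<psi> \<xi>) \<xi>)\<^sup>2) \<le> e"
        unfolding hd using e'(2) by (simp add: algebra_simps)
    qed
  qed
qed

section \<open>Approximation by smooth functions\<close>

text \<open>A function and all its horizontal derivatives must be mollified by the same kernel. As
  the family is finite, the minimum of the admissible radii is positive.\<close>

lemma common_mollifier:
  fixes f :: "'k::finite \<Rightarrow> 'n heis \<Rightarrow> real"
  assumes f: "\<And>k. integrable lborel (f k)" "\<And>k. integrable lborel (\<lambda>\<xi>. (f k \<xi>)\<^sup>2)" and e: "e > 0" and d: "d > 0"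
  obtains \<rho> where "mollifier d \<rho>" "\<And>k. (\<integral>\<^sup>+\<xi>. ennreal ((moll \<rho> (f k) \<xi> - f k \<xi>)\<^sup>2) \<partial>lborel) \<le> ennreal e"
proof -
  have "\<forall>k. \<exists>d>0. \<forall>\<rho>. mollifier d \<rho> \<longrightarrow> (\<integral>\<^sup>+\<xi>. ennreal ((moll \<rho> (f k) \<xi> - f k \<xi>)\<^sup>2) \<partial>lborel) \<le> ennreal e"
    using moll_L2[OF f e] by blast
  from choice[OF this] obtain D where D': "\<forall>k. D k > 0 \<and> (\<forall>\<rho>. mollifier (D k) \<rho> \<longrightarrow>
      (\<integral>\<^sup>+\<xi>. ennreal ((moll \<rho> (f k) \<xi> - f k \<xi>)\<^sup>2) \<partial>lborel) \<le> ennreal e)" by (elim exE)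
  have D: "\<And>k. D k > 0"
      "\<And>k \<rho>. mollifier (D k) \<rho> \<Longrightarrow> (\<integral>\<^sup>+\<xi>. ennreal ((moll \<rho> (f k) \<xi> - f k \<xi>)\<^sup>2) \<partial>lborel) \<le> ennreal e"
    using D' by blast+
  define d' where "d' = Min (insert d (range D))"
  have d': "d' > 0" "d' \<le> d" "\<And>k. d' \<le> D k"
  proof -
    show "d' > 0" using D(1) d by (simp add: d'_def)
    show "d' \<le> d" "d' \<le> D k" for k unfolding d'_def by (rule Min_le; simp)+
  qed
  obtain \<rho> :: "'n heis \<Rightarrow> real" where \<rho>: "mollifier d' \<rho>" by (rule mollifier_exists[OF d'(1)]) (rule that)
  show ?thesis by (rule that[OF mollifier_mono[OF \<rho> d'(2)] D(2)[OF mollifier_mono[OF \<rho> d'(3)]]])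
qed

lemma L2_borel_rep:
  assumes "L2 (lebesgue_on \<Omega>) u" "borel_rep \<Omega> u u'"
  shows "integrable lborel u'" "integrable lborel (\<lambda>\<xi>. (u' \<xi>)\<^sup>2)" "bounded {\<xi>. u' \<xi> \<noteq> 0}"
proof -
  show "integrable lborel u'" using borel_rep_integrable[OF \<Omega>_borel assms(2)] \<Omega>.L2_integrable[OF assms(1)] by simp
  show "integrable lborel (\<lambda>\<xi>. (u' \<xi>)\<^sup>2)"
    using borel_rep_integrable[OF \<Omega>_borel borel_rep_square[OF assms(2)]] L2_integrable_square[OF assms(1)] by simp
  show "bounded {\<xi>. u' \<xi> \<noteq> 0}"
    by (rule bounded_subset[OF bounded_\<Omega>]) (use assms(2) in \<open>auto simp: borel_rep_def\<close>)
qed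

text \<open>Convolution commutes with the field wherever the kernel section is a test function on
  \<Omega>. Two minus signs cancel: one from moving the derivative onto \<zeta>, one from the weak
  derivative.\<close>

lemma hderiv_moll_sobolev:
  assumes s: "sobolev \<Omega> u g" and u': "borel_rep \<Omega> u u'" and g': "borel_rep \<Omega> (g i) g'"
    and \<rho>: "mollifier d \<rho>" and t: "(\<lambda>\<zeta>. \<rho> (hmul \<xi> (- \<zeta>))) \<in> test_functions \<Omega>" (is "?\<phi> \<in> _")
  shows "hderiv i (moll \<rho> u') \<xi> = moll \<rho> g' \<xi>"
proof -
  have m: "?\<phi> \<in> borel_measurable borel" "hderiv i ?\<phi> \<in> borel_measurable borel"
    using smooth_continuous continuous_on_hderiv_smooth test_smooth[OF t]
    by (auto intro: borel_measurable_continuous_onI)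
  have "hderiv i (moll \<rho> u') \<xi> = - (LINT \<zeta>|lborel. hderiv i ?\<phi> \<zeta> * u' \<zeta>)"
    by (rule hderiv_moll[OF mollifierD(1)[OF \<rho>] L2_borel_rep(1,3)[OF sobolevD(1)[OF s] u']])
  also have "(LINT \<zeta>|lborel. hderiv i ?\<phi> \<zeta> * u' \<zeta>) = (LINT \<zeta>|lebesgue_on \<Omega>. u \<zeta> * hderiv i ?\<phi> \<zeta>)"
    using borel_rep_integral[OF \<Omega>_borel borel_rep_mult[OF u' m(2)]] by (simp add: mult.commute)
  also have "\<dots> = - (LINT \<zeta>|lebesgue_on \<Omega>. g i \<zeta> * ?\<phi> \<zeta>)" by (rule sobolevD(4)[OF s t])
  also have "(LINT \<zeta>|lebesgue_on \<Omega>. g i \<zeta> * ?\<phi> \<zeta>) = moll \<rho> g' \<xi>"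
    using borel_rep_integral[OF \<Omega>_borel borel_rep_mult[OF g' m(1)]] by (simp add: moll_def mult.commute)
  finally show ?thesis by simp
qed

lemma integral_square_diff_le:
  assumes v: "borel_rep \<Omega> v v'" and w: "borel_rep \<Omega> w w'"
    and b: "\<And>\<xi>. \<bar>v' \<xi> - w' \<xi>\<bar> \<le> \<bar>h \<xi>\<bar>" and h: "(\<integral>\<^sup>+\<xi>. ennreal ((h \<xi>)\<^sup>2) \<partial>lborel) \<le> ennreal e" and e: "e > 0"
  shows "(LINT \<xi>|lebesgue_on \<Omega>. (v \<xi> - w \<xi>)\<^sup>2) \<le> e"
proof -
  have "(\<integral>\<^sup>+\<xi>. ennreal ((v' \<xi> - w' \<xi>)\<^sup>2) \<partial>lborel) \<le> (\<integral>\<^sup>+\<xi>. ennreal ((h \<xi>)\<^sup>2) \<partial>lborel)"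
    using b by (intro nn_integral_mono ennreal_leI) (simp add: abs_le_square_iff)
  also have "\<dots> \<le> ennreal e" by (rule h)
  finally have "(LINT \<xi>|lborel. (v' \<xi> - w' \<xi>)\<^sup>2) \<le> e"
    using e by (intro integral_real_bounded) auto
  then show ?thesis using borel_rep_integral[OF \<Omega>_borel borel_rep_diff_square[OF v w]] by simp
qed

lemma sobolev_borel_rep:
  assumes "sobolev \<Omega> u g"
  obtains u' g' where "borel_rep \<Omega> u u'" "\<And>i. borel_rep \<Omega> (g i) (g' i)"
proof -
  have "\<exists>v. borel_rep \<Omega> f v" if "L2 (lebesgue_on \<Omega>) f" for f
    using borel_rep_exists[OF \<Omega>_borel L2_measurable[OF that]] by metis
  then have "\<exists>u'. borel_rep \<Omega> u u'" "\<forall>i. \<exists>v. borel_rep \<Omega> (g i) v"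
    using sobolevD(1,2)[OF assms] by blast+
  then show ?thesis using that by metis
qed

text \<open>The zero extension of u may fail to be weakly differentiable across the boundary. Hence
  derivatives are controlled only on K, where the kernel stays inside \<Omega>, while the function
  itself is controlled on all of \<Omega>.\<close>

lemma sobolev_smooth_approx:
  assumes s: "sobolev \<Omega> u g" and K: "compact K" "K \<subseteq> \<Omega>" and e: "e > 0"
  obtains m where "smooth_fun_on UNIV m" "(LINT \<xi>|lebesgue_on \<Omega>. (m \<xi> - u \<xi>)\<^sup>2) \<le> e"
    "\<And>i. (LINT \<xi>|lebesgue_on \<Omega>. (hderiv i m \<xi> * indicator K \<xi> - g i \<xi> * indicator K \<xi>)\<^sup>2) \<le> e"
proof -
  obtain u' g' where r: "borel_rep \<Omega> u u'" "\<And>i. borel_rep \<Omega> (g i) (g' i)"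
    by (rule sobolev_borel_rep[OF s]) (rule that)
  obtain d K' where K': "d > 0" "compact K'" "K \<subseteq> K'" "K' \<subseteq> \<Omega>"
      "\<And>\<eta> \<xi>. norm \<eta> \<le> d \<Longrightarrow> \<xi> \<in> K \<Longrightarrow> hmul \<eta> \<xi> \<in> K'"
    by (rule hmul_enlarge[OF K(1) open_\<Omega> K(2)]) (rule that)
  \<comment> \<open>The function sits at \<open>None\<close> and its derivatives at
    \<open>Some i\<close>, which makes a single finite family.\<close>
  let ?f = "\<lambda>k. case k of None \<Rightarrow> u' | Some i \<Rightarrow> g' i"
  obtain \<rho> where \<rho>: "mollifier d \<rho>" "\<And>k. (\<integral>\<^sup>+\<xi>. ennreal ((moll \<rho> (?f k) \<xi> - ?f k \<xi>)\<^sup>2) \<partial>lborel) \<le> ennreal e"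
  proof (rule common_mollifier[of ?f e d])
    show "integrable lborel (?f k)" "integrable lborel (\<lambda>\<xi>. (?f k \<xi>)\<^sup>2)" for k
      using L2_borel_rep[OF sobolevD(1)[OF s] r(1)] L2_borel_rep[OF sobolevD(2)[OF s] r(2)] by (cases k; simp)+
  qed (use e K' in auto)
  define m where "m = moll \<rho> u'"
  have sm: "smooth_fun_on UNIV m"
    unfolding m_def by (rule smooth_moll[OF mollifierD(1)[OF \<rho>(1)] L2_borel_rep(1,3)[OF sobolevD(1)[OF s] r(1)]])
  have mb: "m \<in> borel_measurable borel" "hderiv i m \<in> borel_measurable borel" for i
    using smooth_continuous[OF sm] continuous_on_hderiv_smooth[OF sm] by (auto intro: borel_measurable_continuous_onI)
  have Kb: "indicator K \<in> borel_measurable (borel :: 'n heis measure)"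
    by (rule borel_measurable_indicator) (simp add: borel_compact K)
  show ?thesis
  proof (rule that[OF sm])
    show "(LINT \<xi>|lebesgue_on \<Omega>. (m \<xi> - u \<xi>)\<^sup>2) \<le> e"
    proof (rule integral_square_diff_le[OF borel_rep_indicator[OF \<Omega>_borel mb(1)] r(1) _ _ e])
      show "(\<integral>\<^sup>+\<xi>. ennreal ((m \<xi> - u' \<xi>)\<^sup>2) \<partial>lborel) \<le> ennreal e" using \<rho>(2)[of None] by (simp add: m_def)
      show "\<bar>indicator \<Omega> \<xi> * m \<xi> - u' \<xi>\<bar> \<le> \<bar>m \<xi> - u' \<xi>\<bar>" for \<xi>
        using borel_rep_outside[OF r(1), of \<xi>] by (cases "\<xi> \<in> \<Omega>") simp_all
    qed
    fix i
    have hd: "hderiv i m \<xi> = moll \<rho> (g' i) \<xi>" if "\<xi> \<in> K" for \<xi>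
      unfolding m_def by (rule hderiv_moll_sobolev[OF s r \<rho>(1) kernel_section_test[OF \<rho>(1) K'(5)[OF _ that] K'(2,4)]])
    show "(LINT \<xi>|lebesgue_on \<Omega>. (hderiv i m \<xi> * indicator K \<xi> - g i \<xi> * indicator K \<xi>)\<^sup>2) \<le> e"
    proof (rule integral_square_diff_le[OF borel_rep_mult[OF borel_rep_indicator[OF \<Omega>_borel mb(2)] Kb] borel_rep_mult[OF r(2) Kb] _ _ e])
      show "(\<integral>\<^sup>+\<xi>. ennreal ((moll \<rho> (g' i) \<xi> - g' i \<xi>)\<^sup>2) \<partial>lborel) \<le> ennreal e" using \<rho>(2)[of "Some i"] by simp
      show "\<bar>indicator \<Omega> \<xi> * hderiv i m \<xi> * indicator K \<xi> - g' i \<xi> * indicator K \<xi>\<bar> \<le> \<bar>moll \<rho> (g' i) \<xi> - g' i \<xi>\<bar>" for \<xi>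
      proof (cases "\<xi> \<in> K")
        case True
        then show ?thesis using hd[OF True] K(2) by (simp add: subsetD)
      qed simp
    qed
  qed
qed

end

lemma integral_lincomb3:
  fixes f g h :: "'a \<Rightarrow> real"
  assumes "integrable M f" "integrable M g" "integrable M h"
  shows "integrable M (\<lambda>x. a * f x + b * g x + c * h x)"
    "(LINT x|M. a * f x + b * g x + c * h x) = a * (LINT x|M. f x) + b * (LINT x|M. g x) + c * (LINT x|M. h x)"
  using assms by simp_all

context bounded_open
begin

lemma L2_indicator_mult:
  assumes "L2 (lebesgue_on \<Omega>) f" and [measurable]: "K \<in> sets borel"
  shows "L2 (lebesgue_on \<Omega>) (\<lambda>\<xi>. f \<xi> * indicator K \<xi>)"
proof (rule L2_bound[OF assms(1), of _ 1])
  have "(indicator K :: _ \<Rightarrow> real) \<in> borel_measurable (lebesgue_on \<Omega>)"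
    by (rule borel_measurable_lebesgue_on) measurable
  then show "(\<lambda>\<xi>. f \<xi> * indicator K \<xi>) \<in> borel_measurable (lebesgue_on \<Omega>)"
    using L2_measurable[OF assms(1)] by (rule borel_measurable_times[rotated])
  show "\<bar>f \<xi> * indicator K \<xi>\<bar> \<le> 1 * \<bar>f \<xi>\<bar>" for \<xi> by (cases "\<xi> \<in> K") simp_all
qed

text \<open>Weak derivatives are local: for a test function supported in \<Omega> - K, the product
  of u with its derivative vanishes identically.\<close>

lemma sobolev_AE_0_outside:
  assumes s: "sobolev \<Omega> u g" and K: "compact K" and z: "\<And>\<xi>. \<xi> \<in> \<Omega> \<Longrightarrow> \<xi> \<notin> K \<Longrightarrow> u \<xi> = 0"
  shows "AE \<xi> in lebesgue_on \<Omega>. \<xi> \<notin> K \<longrightarrow> g i \<xi> = 0"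
proof -
  have o: "open (\<Omega> - K)" using open_\<Omega> K by (simp add: open_Diff compact_imp_closed)
  have ob: "\<Omega> - K \<in> sets borel" using o by simp
  have li: "loc_integrable \<Omega> (g i)" by (rule L2_loc_integrable[OF sobolevD(2)[OF s]])
  have "AE \<xi> in lebesgue_on (\<Omega> - K). g i \<xi> = 0"
  proof (rule loc_integrable_AE_0[OF o])
    show li': "loc_integrable (\<Omega> - K) (g i)" using li unfolding loc_integrable_def by blast
    fix \<phi> assume \<phi>: "\<phi> \<in> test_functions (\<Omega> - K)"
    have \<phi>': "\<phi> \<in> test_functions \<Omega>" using \<phi> test_functions_mono[of "\<Omega> - K" \<Omega>] by blast
    obtain L where L: "compact L" "L \<subseteq> \<Omega> - K" "\<And>\<xi>. \<xi> \<notin> L \<Longrightarrow> \<phi> \<xi> = 0" "\<And>\<xi> i. \<xi> \<notin> L \<Longrightarrow> hderiv i \<phi> \<xi> = 0"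
      by (rule test_hderiv[OF \<phi>]) (rule that)
    note c = smooth_continuous[OF test_smooth[OF \<phi>]]
    have L': "L \<subseteq> \<Omega>" using L(2) by blast
    have "(LINT \<xi>|lebesgue_on (\<Omega> - K). g i \<xi> * \<phi> \<xi>) = (LINT \<xi>|lebesgue_on L. g i \<xi> * \<phi> \<xi>)"
      by (rule loc_integrable_mult(2)[OF li' L(1,2) ob c L(3)])
    also have "\<dots> = (LINT \<xi>|lebesgue_on \<Omega>. g i \<xi> * \<phi> \<xi>)"
      by (rule loc_integrable_mult(2)[OF li L(1) L' \<Omega>_borel c L(3), symmetric])
    also have "\<dots> = - (LINT \<xi>|lebesgue_on \<Omega>. u \<xi> * hderiv i \<phi> \<xi>)"
      using sobolevD(4)[OF s \<phi>', of i] by simp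
    also have "(LINT \<xi>|lebesgue_on \<Omega>. u \<xi> * hderiv i \<phi> \<xi>) = (LINT \<xi>|lebesgue_on \<Omega>. 0)"
    proof (rule Bochner_Integration.integral_cong[OF refl])
      fix \<xi> assume "\<xi> \<in> space (lebesgue_on \<Omega>)"
      then have "\<xi> \<in> \<Omega>" by (simp add: space_restrict_space)
      then show "u \<xi> * hderiv i \<phi> \<xi> = 0" using z[of \<xi>] L(4)[of \<xi> i] L(2) by (cases "\<xi> \<in> K") auto
    qed
    finally show "(LINT \<xi>|lebesgue_on (\<Omega> - K). g i \<xi> * \<phi> \<xi>) = 0" by simp
  qed
  then show ?thesis unfolding AE_lebesgue_on[OF ob] AE_lebesgue_on[OF \<Omega>_borel]
    by eventually_elim simp
qed

text \<open>With support compactly inside \<Omega>, a fine mollification of the zero extension is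
  itself a test function, and it commutes with the fields at every point.\<close>

lemma sobolev_compact_support_W1p_0:
  assumes s: "sobolev \<Omega> u g" and K: "compact K" "K \<subseteq> \<Omega>" and z: "\<And>\<xi>. \<xi> \<in> \<Omega> \<Longrightarrow> \<xi> \<notin> K \<Longrightarrow> u \<xi> = 0"
  shows "u \<in> W1p_0 2 \<Omega>"
proof (rule W1p_0_I[OF s])
  fix e :: real assume e: "e > 0"
  have Kb: "(indicator K :: _ \<Rightarrow> real) \<in> borel_measurable borel"
    by (rule borel_measurable_indicator) (simp add: borel_compact K)
  \<comment> \<open>The representatives vanish everywhere off K, not just almost everywhere, so that
    supports of convolutions can be located pointwise.\<close>
  have rep: "\<exists>v. borel_rep \<Omega> f v \<and> (\<forall>\<xi>. \<xi> \<notin> K \<longrightarrow> v \<xi> = 0)"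
    if f: "L2 (lebesgue_on \<Omega>) f" "AE \<xi> in lebesgue_on \<Omega>. \<xi> \<notin> K \<longrightarrow> f \<xi> = 0" for f
  proof -
    obtain v where v: "borel_rep \<Omega> f v" by (rule borel_rep_exists[OF \<Omega>_borel L2_measurable[OF f(1)]]) (rule that)
    have ae: "AE \<xi> in lebesgue_on \<Omega>. f \<xi> = v \<xi>" and vb: "v \<in> borel_measurable borel"
      using v unfolding borel_rep_def by blast+
    have "AE \<xi> in lebesgue_on \<Omega>. f \<xi> = v \<xi> * indicator K \<xi>"
      using ae f(2) by eventually_elim (auto simp: indicator_def)
    moreover have "v \<xi> * indicator K \<xi> = 0" if "\<xi> \<notin> \<Omega>" for \<xi> using borel_rep_outside[OF v that] by simp
    ultimately have "borel_rep \<Omega> f (\<lambda>\<xi>. v \<xi> * indicator K \<xi>)"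
      unfolding borel_rep_def using L2_measurable[OF f(1)] borel_measurable_times[OF vb Kb] by blast
    then show ?thesis by (intro exI[of _ "\<lambda>\<xi>. v \<xi> * indicator K \<xi>"]) simp
  qed
  have "AE \<xi> in lebesgue_on \<Omega>. \<xi> \<notin> K \<longrightarrow> u \<xi> = 0"
    by (rule AE_I2) (simp add: z space_restrict_space)
  from rep[OF sobolevD(1)[OF s] this] obtain u' where u': "borel_rep \<Omega> u u'" "\<And>\<xi>. \<xi> \<notin> K \<Longrightarrow> u' \<xi> = 0" by blast
  have "\<forall>i. \<exists>v. borel_rep \<Omega> (g i) v \<and> (\<forall>\<xi>. \<xi> \<notin> K \<longrightarrow> v \<xi> = 0)"
    using rep[OF sobolevD(2)[OF s] sobolev_AE_0_outside[OF s K(1) z]] by blast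
  from choice[OF this] obtain g' where "\<forall>i. borel_rep \<Omega> (g i) (g' i) \<and> (\<forall>\<xi>. \<xi> \<notin> K \<longrightarrow> g' i \<xi> = 0)" by (elim exE)
  then have g': "borel_rep \<Omega> (g i) (g' i)" "\<And>\<xi>. \<xi> \<notin> K \<Longrightarrow> g' i \<xi> = 0" for i by blast+
  \<comment> \<open>Two enlargements: K1 contains the support of the mollified functions, and K2
    contains the kernel sections at points of K1.\<close>
  obtain d1 K1 where K1: "d1 > 0" "compact K1" "K \<subseteq> K1" "K1 \<subseteq> \<Omega>"
      "\<And>\<eta> \<xi>. norm \<eta> \<le> d1 \<Longrightarrow> \<xi> \<in> K \<Longrightarrow> hmul \<eta> \<xi> \<in> K1"
    by (rule hmul_enlarge[OF K(1) open_\<Omega> K(2)]) (rule that)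
  obtain d2 K2 where K2: "d2 > 0" "compact K2" "K1 \<subseteq> K2" "K2 \<subseteq> \<Omega>"
      "\<And>\<eta> \<xi>. norm \<eta> \<le> d2 \<Longrightarrow> \<xi> \<in> K1 \<Longrightarrow> hmul \<eta> \<xi> \<in> K2"
    by (rule hmul_enlarge[OF K1(2) open_\<Omega> K1(4)]) (rule that)
  let ?f = "\<lambda>k. case k of None \<Rightarrow> u' | Some i \<Rightarrow> g' i"
  obtain \<rho> where \<rho>: "mollifier (min d1 d2) \<rho>"
    "\<And>k. (\<integral>\<^sup>+\<xi>. ennreal ((moll \<rho> (?f k) \<xi> - ?f k \<xi>)\<^sup>2) \<partial>lborel) \<le> ennreal e"
  proof (rule common_mollifier[of ?f e "min d1 d2"])
    show "integrable lborel (?f k)" "integrable lborel (\<lambda>\<xi>. (?f k \<xi>)\<^sup>2)" for k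
      using L2_borel_rep[OF sobolevD(1)[OF s] u'(1)] L2_borel_rep[OF sobolevD(2)[OF s] g'(1)] by (cases k; simp)+
  qed (use e K1 K2 in auto)
  define m where "m = moll \<rho> u'"
  have sm: "smooth_fun_on UNIV m"
    unfolding m_def by (rule smooth_moll[OF mollifierD(1)[OF \<rho>(1)] L2_borel_rep(1,3)[OF sobolevD(1)[OF s] u'(1)]])
  have mb: "m \<in> borel_measurable borel" "hderiv i m \<in> borel_measurable borel" for i
    using smooth_continuous[OF sm] continuous_on_hderiv_smooth[OF sm] by (auto intro: borel_measurable_continuous_onI)
  have z1: "moll \<rho> v \<xi> = 0" if v: "\<And>\<xi>. \<xi> \<notin> K \<Longrightarrow> v \<xi> = 0" and \<xi>: "\<xi> \<notin> K1" for v \<xi>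
  proof -
    have "\<rho> (hmul \<xi> (- \<zeta>)) * v \<zeta> = 0" for \<zeta>
    proof (cases "\<zeta> \<in> K")
      case True
      have "hmul (hmul \<xi> (- \<zeta>)) \<zeta> = \<xi>" by (simp add: hmul_assoc)
      then have "\<not> norm (hmul \<xi> (- \<zeta>)) \<le> d1" using K1(5)[of "hmul \<xi> (- \<zeta>)" \<zeta>] True \<xi> by metis
      then have "\<rho> (hmul \<xi> (- \<zeta>)) = 0" by (intro mollifierD(4)[OF \<rho>(1)]) simp
      then show ?thesis by simp
    qed (simp add: v)
    then have "(\<lambda>\<zeta>. \<rho> (hmul \<xi> (- \<zeta>)) * v \<zeta>) = (\<lambda>_. 0)" by (rule ext)
    then show ?thesis unfolding moll_def by simp
  qed
  have mt: "m \<in> test_functions \<Omega>"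
    by (rule test_functionsI[OF sm K1(2,4)]) (simp add: m_def z1[OF u'(2)])
  have hd: "hderiv i m \<xi> = moll \<rho> (g' i) \<xi>" for i \<xi>
  proof (cases "\<xi> \<in> K1")
    case True
    have "hmul \<eta> \<xi> \<in> K2" if "norm \<eta> \<le> min d1 d2" for \<eta> using K2(5)[OF _ True] that by simp
    then show ?thesis
      unfolding m_def by (intro hderiv_moll_sobolev[OF s u'(1) g'(1) \<rho>(1)] kernel_section_test[OF \<rho>(1) _ K2(2,4)])
  next
    case False
    have "frechet_derivative m (at \<xi>) = (\<lambda>_. 0)"
      by (rule frechet_derivative_eq_0[OF compact_imp_closed[OF K1(2)] _ False]) (simp add: m_def z1[OF u'(2)])
    then show ?thesis using z1[OF g'(2) False] by (simp add: hderiv_smooth[OF sm])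
  qed
  show "\<exists>\<phi>\<in>test_functions \<Omega>. (LINT \<xi>|lebesgue_on \<Omega>. (u \<xi> - \<phi> \<xi>)\<^sup>2) \<le> e \<and>
      (\<forall>i. (LINT \<xi>|lebesgue_on \<Omega>. (g i \<xi> - hderiv i \<phi> \<xi>)\<^sup>2) \<le> e)"
  proof (intro bexI[OF _ mt] conjI allI)
    show "(LINT \<xi>|lebesgue_on \<Omega>. (u \<xi> - m \<xi>)\<^sup>2) \<le> e"
    proof (rule integral_square_diff_le[OF u'(1) borel_rep_indicator[OF \<Omega>_borel mb(1)] _ _ e])
      show "(\<integral>\<^sup>+\<xi>. ennreal ((m \<xi> - u' \<xi>)\<^sup>2) \<partial>lborel) \<le> ennreal e" using \<rho>(2)[of None] by (simp add: m_def)
      show "\<bar>u' \<xi> - indicator \<Omega> \<xi> * m \<xi>\<bar> \<le> \<bar>m \<xi> - u' \<xi>\<bar>" for \<xi>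
        using borel_rep_outside[OF u'(1), of \<xi>] by (cases "\<xi> \<in> \<Omega>") (simp_all add: abs_minus_commute)
    qed
    show "(LINT \<xi>|lebesgue_on \<Omega>. (g i \<xi> - hderiv i m \<xi>)\<^sup>2) \<le> e" for i
    proof (rule integral_square_diff_le[OF g'(1) borel_rep_indicator[OF \<Omega>_borel mb(2)] _ _ e])
      show "(\<integral>\<^sup>+\<xi>. ennreal ((moll \<rho> (g' i) \<xi> - g' i \<xi>)\<^sup>2) \<partial>lborel) \<le> ennreal e" using \<rho>(2)[of "Some i"] by simp
      show "\<bar>g' i \<xi> - indicator \<Omega> \<xi> * hderiv i m \<xi>\<bar> \<le> \<bar>moll \<rho> (g' i) \<xi> - g' i \<xi>\<bar>" for \<xi>
        using borel_rep_outside[OF g'(1), of \<xi>] by (cases "\<xi> \<in> \<Omega>") (simp_all add: hd abs_minus_commute)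
    qed
  qed
qed

section \<open>The chain rule and truncation\<close>

text \<open>The identity is exact for a smooth m, and the error of replacing f by m is a multiple of
  \<open>sqrt e\<close>. The Lipschitz bound on T' controls T'(f) - T'(m) by f - m, so
  Cauchy-Schwarz suffices and no subsequence converging almost everywhere is extracted.\<close>

lemma sobolev_chain_rule:
  assumes s: "sobolev \<Omega> f g"
    and T: "\<And>s. (T has_real_derivative T' s) (at s)" "\<And>s. \<bar>T' s\<bar> \<le> 1" "\<And>a b. \<bar>T' a - T' b\<bar> \<le> C * \<bar>a - b\<bar>"
    and \<phi>: "\<phi> \<in> test_functions \<Omega>"
  shows "(LINT \<xi>|lebesgue_on \<Omega>. T (f \<xi>) * hderiv i \<phi> \<xi>) = - (LINT \<xi>|lebesgue_on \<Omega>. T' (f \<xi>) * g i \<xi> * \<phi> \<xi>)"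
proof -
  let ?M = "lebesgue_on \<Omega>"
  have Tl: "\<bar>T a - T b\<bar> \<le> \<bar>a - b\<bar>" for a b
    using field_differentiable_bound[of UNIV T T' 1 a b] T(1,2) by simp
  have C: "C \<ge> 0" using T(3)[of 1 0] abs_ge_zero[of "T' 1 - T' 0"] by simp
  have T'c: "continuous_on UNIV T'"
    by (rule lipschitz_on_continuous_on[of C]) (use T(3) C in \<open>auto simp: lipschitz_on_def dist_real_def\<close>)
  have Tc: "continuous_on UNIV T"
    using T(1) by (intro continuous_at_imp_continuous_on ballI DERIV_isCont)
  have [measurable]: "T \<in> borel_measurable borel" "T' \<in> borel_measurable borel"
    using Tc T'c by (auto intro: borel_measurable_continuous_onI)
  obtain K B where K: "compact K" "K \<subseteq> \<Omega>" "\<And>\<xi>. \<xi> \<notin> K \<Longrightarrow> \<phi> \<xi> = 0" "\<And>\<xi> i. \<xi> \<notin> K \<Longrightarrow> hderiv i \<phi> \<xi> = 0"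
    "B \<ge> 0" "\<And>\<xi>. \<bar>\<phi> \<xi>\<bar> \<le> B" "\<And>\<xi> i. \<bar>hderiv i \<phi> \<xi>\<bar> \<le> B"
    by (rule test_hderiv[OF \<phi>]) (rule that)
  have Kb: "K \<in> sets borel" by (simp add: borel_compact K)
  note fL = sobolevD(1)[OF s] and gL = sobolevD(2)[OF s, of i]
  note [measurable] = L2_measurable[OF fL] L2_measurable[OF gL]
  have TL: "L2 ?M (\<lambda>\<xi>. T (h \<xi>))" if h: "L2 ?M h" for h
  proof -
    note [measurable] = L2_measurable[OF h]
    have "L2 ?M (\<lambda>\<xi>. T (h \<xi>) - T 0)"
      by (rule L2_bound[OF h, of _ 1]) (use Tl[of _ 0] in auto)
    from L2_add[OF this \<Omega>.L2_const[of "T 0"]] show ?thesis by simp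
  qed
  have T'L: "L2 ?M (\<lambda>\<xi>. T' (h \<xi>) * k \<xi>)" if h: "L2 ?M h" and k: "L2 ?M k" for h k
  proof (rule L2_bound[OF k, of _ 1])
    note [measurable] = L2_measurable[OF h] L2_measurable[OF k]
    show "(\<lambda>\<xi>. T' (h \<xi>) * k \<xi>) \<in> borel_measurable ?M" by measurable
    show "\<bar>T' (h \<xi>) * k \<xi>\<bar> \<le> 1 * \<bar>k \<xi>\<bar>" for \<xi>
      unfolding abs_mult by (intro mult_right_mono T(2)) simp
  qed
  define V where "V = (LINT \<xi>|?M. (1::real)\<^sup>2)"
  define G where "G = (LINT \<xi>|?M. (g i \<xi>)\<^sup>2)"
  define D where "D = (LINT \<xi>|?M. T (f \<xi>) * hderiv i \<phi> \<xi>) + (LINT \<xi>|?M. T' (f \<xi>) * g i \<xi> * \<phi> \<xi>)"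
  have VG: "V \<ge> 0" "G \<ge> 0" by (simp_all add: V_def G_def)
  have key: "\<bar>D\<bar> \<le> (2 * B * sqrt V + B * C * sqrt G) * sqrt e" if e: "e > 0" for e
  proof -
    obtain m where m: "smooth_fun_on UNIV m" "(LINT \<xi>|?M. (m \<xi> - f \<xi>)\<^sup>2) \<le> e"
      "\<And>i. (LINT \<xi>|?M. (hderiv i m \<xi> * indicator K \<xi> - g i \<xi> * indicator K \<xi>)\<^sup>2) \<le> e"
      by (rule sobolev_smooth_approx[OF s K(1,2) e]) (rule that)
    have mL: "L2 ?M m" "L2 ?M (hderiv i m)"
      by (rule L2_continuous[OF smooth_continuous[OF m(1)]], rule L2_continuous[OF continuous_on_hderiv_smooth[OF m(1)]])
    note p = L2_test(1)[OF \<phi>] L2_test(2)[OF \<phi>, of i]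
    note i1 = L2_integrable_mult[OF TL[OF fL] p(2)] L2_integrable_mult[OF T'L[OF fL gL] p(1)]
      L2_integrable_mult[OF TL[OF mL(1)] p(2)] L2_integrable_mult[OF T'L[OF mL(1) mL(2)] p(1)]
    let ?a = "\<lambda>\<xi>. m \<xi> - f \<xi>" and ?b = "\<lambda>\<xi>. hderiv i m \<xi> * indicator K \<xi> - g i \<xi> * indicator K \<xi>"
    have aL: "L2 ?M ?a" by (rule L2_diff[OF mL(1) fL])
    have bL: "L2 ?M ?b" by (intro L2_diff L2_indicator_mult mL gL Kb)
    have J: "integrable ?M (\<lambda>\<xi>. \<bar>?a \<xi>\<bar> * \<bar>1\<bar>)" "integrable ?M (\<lambda>\<xi>. \<bar>?b \<xi>\<bar> * \<bar>1\<bar>)"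
        "integrable ?M (\<lambda>\<xi>. \<bar>?a \<xi>\<bar> * \<bar>g i \<xi>\<bar>)"
      unfolding abs_one mult_1_right abs_mult[symmetric]
      by (intro integrable_abs \<Omega>.L2_integrable aL, intro integrable_abs \<Omega>.L2_integrable bL,
        intro integrable_abs L2_integrable_mult aL gL)
    let ?I = "\<lambda>\<xi>. (T (f \<xi>) * hderiv i \<phi> \<xi> + T' (f \<xi>) * g i \<xi> * \<phi> \<xi>) - (T (m \<xi>) * hderiv i \<phi> \<xi> + T' (m \<xi>) * hderiv i m \<xi> * \<phi> \<xi>)"
    have DI: "D = (LINT \<xi>|?M. ?I \<xi>)"
      using i1 integral_chain_smooth_test[OF T(1) T'c m(1) \<phi>, of i] by (simp add: D_def)
    have "\<bar>D\<bar> \<le> (LINT \<xi>|?M. B * (\<bar>?a \<xi>\<bar> * \<bar>1\<bar>) + B * (\<bar>?b \<xi>\<bar> * \<bar>1\<bar>) + B * C * (\<bar>?a \<xi>\<bar> * \<bar>g i \<xi>\<bar>))"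
      unfolding DI
    proof (rule integral_abs_bound_integral)
      show "integrable ?M ?I" using i1 by simp
      show "integrable ?M (\<lambda>\<xi>. B * (\<bar>?a \<xi>\<bar> * \<bar>1\<bar>) + B * (\<bar>?b \<xi>\<bar> * \<bar>1\<bar>) + B * C * (\<bar>?a \<xi>\<bar> * \<bar>g i \<xi>\<bar>))"
        by (rule integral_lincomb3(1)[OF J])
      fix \<xi>
      have e1: "\<bar>(T (f \<xi>) - T (m \<xi>)) * hderiv i \<phi> \<xi>\<bar> \<le> B * \<bar>?a \<xi>\<bar>"
        using mult_mono[OF Tl[of "f \<xi>" "m \<xi>"] K(7)[of i \<xi>]] by (simp add: abs_mult abs_minus_commute mult.commute)
      have e2: "\<bar>T' (m \<xi>) * ?b \<xi> * \<phi> \<xi>\<bar> \<le> B * \<bar>?b \<xi>\<bar>"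
      proof -
        have "\<bar>T' (m \<xi>)\<bar> * \<bar>?b \<xi>\<bar> * \<bar>\<phi> \<xi>\<bar> \<le> 1 * \<bar>?b \<xi>\<bar> * B"
          by (intro mult_mono T(2) K(6)) auto
        then show ?thesis unfolding abs_mult by (simp only: mult_1_left mult.commute[of B])
      qed
      have e3: "\<bar>(T' (f \<xi>) - T' (m \<xi>)) * g i \<xi> * \<phi> \<xi>\<bar> \<le> B * C * (\<bar>?a \<xi>\<bar> * \<bar>g i \<xi>\<bar>)"
      proof -
        have "\<bar>T' (f \<xi>) - T' (m \<xi>)\<bar> * \<bar>g i \<xi>\<bar> * \<bar>\<phi> \<xi>\<bar> \<le> C * \<bar>f \<xi> - m \<xi>\<bar> * \<bar>g i \<xi>\<bar> * B"
          by (intro mult_mono T(3) K(6)) (auto simp: C)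
        then show ?thesis unfolding abs_mult by (simp only: abs_minus_commute[of "f \<xi>"] mult_ac)
      qed
      \<comment> \<open>Each summand carries one small factor. The indicator of K hidden in
        \<open>?b\<close> may be inserted because \<phi> vanishes off K.\<close>
      have "?I \<xi> = (T (f \<xi>) - T (m \<xi>)) * hderiv i \<phi> \<xi> + (T' (f \<xi>) - T' (m \<xi>)) * g i \<xi> * \<phi> \<xi> - T' (m \<xi>) * ?b \<xi> * \<phi> \<xi>"
        using K(3)[of \<xi>] by (cases "\<xi> \<in> K") (simp_all add: algebra_simps)
      then show "\<bar>?I \<xi>\<bar> \<le> B * (\<bar>?a \<xi>\<bar> * \<bar>1\<bar>) + B * (\<bar>?b \<xi>\<bar> * \<bar>1\<bar>) + B * C * (\<bar>?a \<xi>\<bar> * \<bar>g i \<xi>\<bar>)"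
        using e1 e2 e3 by (simp only: abs_one mult_1_right) linarith
    qed
    also have "\<dots> = B * (LINT \<xi>|?M. \<bar>?a \<xi>\<bar> * \<bar>1\<bar>) + B * (LINT \<xi>|?M. \<bar>?b \<xi>\<bar> * \<bar>1\<bar>) + B * C * (LINT \<xi>|?M. \<bar>?a \<xi>\<bar> * \<bar>g i \<xi>\<bar>)"
      by (rule integral_lincomb3(2)[OF J])
    also have "\<dots> \<le> B * (sqrt e * sqrt V) + B * (sqrt e * sqrt V) + B * C * (sqrt e * sqrt G)"
    proof (intro add_mono mult_left_mono)
      note cs = L2_Cauchy_Schwarz_abs
      have sa: "sqrt (LINT \<xi>|?M. (?a \<xi>)\<^sup>2) \<le> sqrt e" using m(2) by simp
      have sb: "sqrt (LINT \<xi>|?M. (?b \<xi>)\<^sup>2) \<le> sqrt e" using m(3) by simp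
      show "(LINT \<xi>|?M. \<bar>?a \<xi>\<bar> * \<bar>1\<bar>) \<le> sqrt e * sqrt V"
        by (rule order_trans[OF cs[OF aL \<Omega>.L2_const]]) (unfold V_def, intro mult_right_mono sa, simp)
      show "(LINT \<xi>|?M. \<bar>?b \<xi>\<bar> * \<bar>1\<bar>) \<le> sqrt e * sqrt V"
        by (rule order_trans[OF cs[OF bL \<Omega>.L2_const]]) (unfold V_def, intro mult_right_mono sb, simp)
      show "(LINT \<xi>|?M. \<bar>?a \<xi>\<bar> * \<bar>g i \<xi>\<bar>) \<le> sqrt e * sqrt G"
        by (rule order_trans[OF cs[OF aL gL]]) (unfold G_def, intro mult_right_mono sa, simp)
    qed (use K(5) C in auto)
    also have "\<dots> = (2 * B * sqrt V + B * C * sqrt G) * sqrt e" by (simp add: algebra_simps)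
    finally show ?thesis .
  qed
  have "D = 0"
  proof (rule ccontr)
    assume D: "D \<noteq> 0"
    define c where "c = 2 * B * sqrt V + B * C * sqrt G + 1"
    have c: "c > 0" using K(5) C VG by (simp add: c_def add_nonneg_pos)
    \<comment> \<open>The estimate is used with e chosen so that its right side is |D|/2.\<close>
    have "\<bar>D\<bar> \<le> c * sqrt ((\<bar>D\<bar> / (2 * c))\<^sup>2)"
      by (rule order_trans[OF key mult_right_mono]) (use D c in \<open>auto simp: c_def\<close>)
    also have "\<dots> = \<bar>D\<bar> / 2" using c by simp
    finally show False using D by simp
  qed
  then show ?thesis by (simp add: D_def)
qed


text \<open>The absolute value is regularized by the square root of the sum of the squares of s and
  \<delta>. Its derivative s / R tends to sgn s, including the value 0 at s = 0, so the formula
  holds without studying the gradient on the zero set of f.\<close>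

lemma sobolev_abs:
  assumes s: "sobolev \<Omega> f g"
  shows "sobolev \<Omega> (\<lambda>\<xi>. \<bar>f \<xi>\<bar>) (\<lambda>i \<xi>. sgn (f \<xi>) * g i \<xi>)"
proof (rule sobolevI)
  let ?M = "lebesgue_on \<Omega>"
  note fL = sobolevD(1)[OF s] and gL = sobolevD(2)[OF s]
  note [measurable] = L2_measurable[OF fL] L2_measurable[OF gL]
  have sgnm: "(\<lambda>\<xi>. sgn (f \<xi>)) \<in> borel_measurable ?M"
    by (rule measurable_compose[OF L2_measurable[OF fL]]) simp
  show absL: "L2 ?M (\<lambda>\<xi>. \<bar>f \<xi>\<bar>)" by (rule L2_bound[OF fL, of _ 1]) simp_all
  show sgnL: "L2 ?M (\<lambda>\<xi>. sgn (f \<xi>) * g i \<xi>)" for i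
  proof (rule L2_bound[OF gL, of _ 1])
    show "(\<lambda>\<xi>. sgn (f \<xi>) * g i \<xi>) \<in> borel_measurable ?M" by (rule borel_measurable_times[OF sgnm L2_measurable[OF gL]])
    show "\<bar>sgn (f \<xi>) * g i \<xi>\<bar> \<le> 1 * \<bar>g i \<xi>\<bar>" for \<xi> by (cases "f \<xi> = 0") (simp_all add: abs_mult abs_sgn_eq)
  qed
  fix i \<phi> assume \<phi>: "\<phi> \<in> test_functions \<Omega>"
  define \<delta> where "\<delta> n = 1 / real (Suc n)" for n
  have \<delta>: "\<delta> n > 0" "\<delta> n \<le> 1" for n by (simp_all add: \<delta>_def)
  have \<delta>0: "\<delta> \<longlonglongrightarrow> 0" unfolding \<delta>_def using LIMSEQ_inverse_real_of_nat by (simp add: inverse_eq_divide)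
  define R where "R n s = sqrt (s\<^sup>2 + (\<delta> n)\<^sup>2)" for n and s :: real
  have Rpos: "R n s > 0" for n s unfolding R_def using \<delta>(1)[of n] by (simp add: add_nonneg_pos)
  have R2: "R n s * R n s = s\<^sup>2 + (\<delta> n)\<^sup>2" for n s unfolding R_def by simp
  have Rge: "\<bar>s\<bar> \<le> R n s" "\<delta> n \<le> R n s" for n s
    unfolding R_def using \<delta>(1)[of n] by (auto intro!: real_le_rsqrt)
  have Rle: "R n s \<le> \<bar>s\<bar> + 1" for n s
  proof -
    have "R n s \<le> \<bar>s\<bar> + \<delta> n"
      unfolding R_def using \<delta>(1)[of n] by (intro real_le_lsqrt) (auto simp: power2_eq_square algebra_simps)
    then show ?thesis using \<delta>(2)[of n] by simp
  qed
  have DR: "(R n has_real_derivative s / R n s) (at s)" for n s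
    unfolding R_def[abs_def] using Rpos[of n s]
    by (auto intro!: derivative_eq_intros simp: R_def field_simps)
  have D2: "((\<lambda>s. s / R n s) has_real_derivative (\<delta> n)\<^sup>2 / (R n s * R n s * R n s)) (at s)" for n s
  proof -
    have "((\<lambda>s. s / R n s) has_real_derivative (1 * R n s - s * (s / R n s)) / (R n s * R n s)) (at s)"
      using Rpos[of n s] by (intro DERIV_divide DERIV_ident DR) simp
    moreover have "(1 * R n s - s * (s / R n s)) / (R n s * R n s) = (\<delta> n)\<^sup>2 / (R n s * R n s * R n s)"
    proof -
      have "1 * R n s - s * (s / R n s) = (R n s * R n s - s * s) / R n s"
        using Rpos[of n s] by (simp add: field_simps)
      also have "\<dots> = (\<delta> n)\<^sup>2 / R n s" unfolding R2 by (simp add: power2_eq_square)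
      finally show ?thesis by (simp add: mult.assoc)
    qed
    ultimately show ?thesis by simp
  qed
  have T1: "\<bar>s / R n s\<bar> \<le> 1" for n s using Rge(1)[of s n] Rpos[of n s] by (simp add: abs_divide)
  have T2: "\<bar>a / R n a - b / R n b\<bar> \<le> 1 / \<delta> n * \<bar>a - b\<bar>" for n a b
  proof -
    have "norm ((\<delta> n)\<^sup>2 / (R n s * R n s * R n s)) \<le> 1 / \<delta> n" for s
    proof -
      \<comment> \<open>From R \<ge> \<delta>. The resulting Lipschitz constant 1/\<delta> blows up
        with n, which is harmless: the chain rule is an exact identity for each n.\<close>
      have "(\<delta> n)\<^sup>2 * \<delta> n \<le> R n s * R n s * R n s"
        unfolding power2_eq_square using \<delta>(1)[of n] Rge(2)[of n s] by (intro mult_mono) auto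
      then show ?thesis using \<delta>(1)[of n] Rpos[of n s] by (simp add: field_simps)
    qed
    then show ?thesis
      using field_differentiable_bound[of UNIV "\<lambda>s. s / R n s" "\<lambda>s. (\<delta> n)\<^sup>2 / (R n s * R n s * R n s)" "1 / \<delta> n" a b] D2
      by simp
  qed
  have eq: "(LINT \<xi>|?M. R n (f \<xi>) * hderiv i \<phi> \<xi>) = - (LINT \<xi>|?M. f \<xi> / R n (f \<xi>) * g i \<xi> * \<phi> \<xi>)" for n
    by (rule sobolev_chain_rule[OF s DR T1 T2 \<phi>])
  have Rlim: "(\<lambda>n. R n s) \<longlonglongrightarrow> \<bar>s\<bar>" for s
  proof -
    have "(\<lambda>n. sqrt (s\<^sup>2 + (\<delta> n)\<^sup>2)) \<longlonglongrightarrow> sqrt (s\<^sup>2 + 0\<^sup>2)" by (intro tendsto_intros \<delta>0)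
    then show ?thesis by (simp add: R_def)
  qed
  have Rm: "(\<lambda>\<xi>. R n (f \<xi>)) \<in> borel_measurable ?M" for n unfolding R_def by measurable
  obtain K B where B: "B \<ge> 0" "\<And>\<xi>. \<bar>\<phi> \<xi>\<bar> \<le> B" "\<And>\<xi> i. \<bar>hderiv i \<phi> \<xi>\<bar> \<le> B"
    by (rule test_hderiv[OF \<phi>]) (rule that)
  note pm = L2_measurable[OF L2_test(1)[OF \<phi>]] L2_measurable[OF L2_test(2)[OF \<phi>, of i]]
  have l1: "(\<lambda>n. LINT \<xi>|?M. R n (f \<xi>) * hderiv i \<phi> \<xi>) \<longlonglongrightarrow> (LINT \<xi>|?M. \<bar>f \<xi>\<bar> * hderiv i \<phi> \<xi>)"
  proof (rule integral_dominated_convergence[where w="\<lambda>\<xi>. (\<bar>f \<xi>\<bar> + 1) * B"])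
    show "integrable ?M (\<lambda>\<xi>. (\<bar>f \<xi>\<bar> + 1) * B)"
      using \<Omega>.L2_integrable[OF absL] by simp
    show "(\<lambda>\<xi>. \<bar>f \<xi>\<bar> * hderiv i \<phi> \<xi>) \<in> borel_measurable ?M"
      by (rule borel_measurable_times[OF L2_measurable[OF absL] pm(2)])
    show "(\<lambda>\<xi>. R n (f \<xi>) * hderiv i \<phi> \<xi>) \<in> borel_measurable ?M" for n
      by (rule borel_measurable_times[OF Rm pm(2)])
    show "AE \<xi> in ?M. (\<lambda>n. R n (f \<xi>) * hderiv i \<phi> \<xi>) \<longlonglongrightarrow> \<bar>f \<xi>\<bar> * hderiv i \<phi> \<xi>"
      by (rule AE_I2) (intro tendsto_intros Rlim)
    show "AE \<xi> in ?M. norm (R n (f \<xi>) * hderiv i \<phi> \<xi>) \<le> (\<bar>f \<xi>\<bar> + 1) * B" for n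
    proof (rule AE_I2)
      fix \<xi>
      show "norm (R n (f \<xi>) * hderiv i \<phi> \<xi>) \<le> (\<bar>f \<xi>\<bar> + 1) * B"
        unfolding real_norm_def abs_mult using Rle[of n "f \<xi>"] Rpos[of n "f \<xi>"] B(3)[of i \<xi>]
        by (intro mult_mono) auto
    qed
  qed
  have l2: "(\<lambda>n. LINT \<xi>|?M. f \<xi> / R n (f \<xi>) * g i \<xi> * \<phi> \<xi>) \<longlonglongrightarrow> (LINT \<xi>|?M. sgn (f \<xi>) * g i \<xi> * \<phi> \<xi>)"
  proof (rule integral_dominated_convergence[where w="\<lambda>\<xi>. \<bar>g i \<xi>\<bar> * B"])
    show "integrable ?M (\<lambda>\<xi>. \<bar>g i \<xi>\<bar> * B)"
      using \<Omega>.L2_integrable[OF gL] by simp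
    show "(\<lambda>\<xi>. sgn (f \<xi>) * g i \<xi> * \<phi> \<xi>) \<in> borel_measurable ?M"
      by (rule borel_measurable_times[OF L2_measurable[OF sgnL] pm(1)])
    show "(\<lambda>\<xi>. f \<xi> / R n (f \<xi>) * g i \<xi> * \<phi> \<xi>) \<in> borel_measurable ?M" for n
      by (intro borel_measurable_times borel_measurable_divide L2_measurable[OF fL] Rm pm(1) L2_measurable[OF gL])
    show "AE \<xi> in ?M. (\<lambda>n. f \<xi> / R n (f \<xi>) * g i \<xi> * \<phi> \<xi>) \<longlonglongrightarrow> sgn (f \<xi>) * g i \<xi> * \<phi> \<xi>"
    proof (rule AE_I2, intro tendsto_mult tendsto_const)
      fix \<xi>
      show "(\<lambda>n. f \<xi> / R n (f \<xi>)) \<longlonglongrightarrow> sgn (f \<xi>)"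
      proof (cases "f \<xi> = 0")
        case False
        then have "(\<lambda>n. f \<xi> / R n (f \<xi>)) \<longlonglongrightarrow> f \<xi> / \<bar>f \<xi>\<bar>" by (intro tendsto_intros Rlim) simp
        then show ?thesis by (simp add: sgn_real_def abs_if split: if_splits)
      qed simp
    qed
    show "AE \<xi> in ?M. norm (f \<xi> / R n (f \<xi>) * g i \<xi> * \<phi> \<xi>) \<le> \<bar>g i \<xi>\<bar> * B" for n
    proof (rule AE_I2)
      fix \<xi>
      have "\<bar>f \<xi> / R n (f \<xi>)\<bar> * \<bar>g i \<xi>\<bar> * \<bar>\<phi> \<xi>\<bar> \<le> 1 * \<bar>g i \<xi>\<bar> * B"
        by (intro mult_mono T1 B(2)) auto
      then show "norm (f \<xi> / R n (f \<xi>) * g i \<xi> * \<phi> \<xi>) \<le> \<bar>g i \<xi>\<bar> * B"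
        unfolding real_norm_def abs_mult by (simp only: mult_1_left)
    qed
  qed
  show "(LINT \<xi>|?M. \<bar>f \<xi>\<bar> * hderiv i \<phi> \<xi>) = - (LINT \<xi>|?M. sgn (f \<xi>) * g i \<xi> * \<phi> \<xi>)"
    by (rule LIMSEQ_unique[OF l1]) (unfold eq, intro tendsto_minus l2)
qed

text \<open>The positive part is half of f + |f|, so its derivative is g times a weight 0, 1/2 or 1.
  The pointwise bound is what keeps truncation from raising the Dirichlet energy.\<close>

lemma sobolev_positive_part:
  assumes s: "sobolev \<Omega> f g"
  obtains h where "sobolev \<Omega> (\<lambda>\<xi>. max (f \<xi>) 0) h" "\<And>i \<xi>. \<bar>h i \<xi>\<bar> \<le> \<bar>g i \<xi>\<bar>"
proof
  have "sobolev \<Omega> (\<lambda>\<xi>. 1/2 * f \<xi> + 1/2 * \<bar>f \<xi>\<bar>) (\<lambda>i \<xi>. 1/2 * g i \<xi> + 1/2 * (sgn (f \<xi>) * g i \<xi>))"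
    by (rule sobolev_lincomb[OF s sobolev_abs[OF s]])
  also have "(\<lambda>\<xi>. 1/2 * f \<xi> + 1/2 * \<bar>f \<xi>\<bar>) = (\<lambda>\<xi>. max (f \<xi>) 0)" by (auto simp: fun_eq_iff max_def)
  finally show "sobolev \<Omega> (\<lambda>\<xi>. max (f \<xi>) 0) (\<lambda>i \<xi>. 1/2 * g i \<xi> + 1/2 * (sgn (f \<xi>) * g i \<xi>))" .
  show "\<bar>1/2 * g i \<xi> + 1/2 * (sgn (f \<xi>) * g i \<xi>)\<bar> \<le> \<bar>g i \<xi>\<bar>" for i \<xi>
    by (cases "f \<xi>" "0::real" rule: linorder_cases) simp_all
qed

lemma sobolev_const: "sobolev \<Omega> (\<lambda>_. c) (\<lambda>_ _. 0)"
proof (rule sobolevI)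
  fix i \<phi> assume \<phi>: "\<phi> \<in> test_functions \<Omega>"
  have "(LINT \<xi>|lebesgue_on \<Omega>. c * hderiv i \<phi> \<xi>) = 0"
    using integral_chain_smooth_test[of "\<lambda>_. c" "\<lambda>_. 0", OF _ _ test_smooth[OF \<phi>] \<phi>, of i] by simp
  then show "(LINT \<xi>|lebesgue_on \<Omega>. c * hderiv i \<phi> \<xi>) = - (LINT \<xi>|lebesgue_on \<Omega>. 0 * \<phi> \<xi>)" by simp
qed (rule \<Omega>.L2_const)+

end

section \<open>Completeness of square integrable functions\<close>

lemma (in finite_measure) L2_bounded_on_space:
  assumes "f \<in> borel_measurable M" "\<And>x. x \<in> space M \<Longrightarrow> \<bar>f x\<bar> \<le> B"
  shows "L2 M f"
proof -
  have "integrable M (\<lambda>x. (f x)\<^sup>2)"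
  proof (rule integrable_const_bound[of _ "B\<^sup>2"])
    show "AE x in M. norm ((f x)\<^sup>2) \<le> B\<^sup>2"
    proof (rule AE_I2)
      fix x assume "x \<in> space M"
      from power_mono[OF assms(2)[OF this], of 2] show "norm ((f x)\<^sup>2) \<le> B\<^sup>2" by simp
    qed
  qed (use assms in simp)
  then show ?thesis using assms by (simp add: L2_def)
qed

text \<open>The Riesz-Fischer argument: a rapidly Cauchy subsequence has increments summable in L1,
  hence converges almost everywhere, and Fatou's lemma turns the Cauchy bounds into distances to the
  limit.\<close>

lemma (in finite_measure) L2_complete:
  fixes g :: "nat \<Rightarrow> 'a \<Rightarrow> real"
  assumes g: "\<And>k. L2 M (g k)"
    and C: "\<And>e. e > 0 \<Longrightarrow> \<exists>N. \<forall>k\<ge>N. \<forall>m\<ge>N. (LINT x|M. (g k x - g m x)\<^sup>2) \<le> e"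
  obtains G where "L2 M G" "\<And>e. e > 0 \<Longrightarrow> \<exists>N. \<forall>k\<ge>N. (LINT x|M. (g k x - G x)\<^sup>2) \<le> e"
proof -
  \<comment> \<open>Powers of 1/4, since square roots are taken and powers of 1/2 are
    summable.\<close>
  have "\<forall>j::nat. \<exists>N. \<forall>k\<ge>N. \<forall>m\<ge>N. (LINT x|M. (g k x - g m x)\<^sup>2) \<le> (1/4) ^ j"
    using C by simp
  from choice[OF this] obtain N where N: "\<forall>j. \<forall>k\<ge>N j. \<forall>m\<ge>N j. (LINT x|M. (g k x - g m x)\<^sup>2) \<le> (1/4) ^ j"
    by (elim exE)
  \<comment> \<open>Summing the thresholds gives an index that dominates every earlier threshold,
    with no need for N to be monotone.\<close>
  define r where "r j = (\<Sum>i\<le>j. N i)" for j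
  have rN: "N i \<le> r j" if "i \<le> j" for i j unfolding r_def using that by (intro member_le_sum) auto
  have rd: "(LINT x|M. (g k x - g (r j) x)\<^sup>2) \<le> (1/4) ^ i" if "N i \<le> k" "i \<le> j" for i j k
    using N rN[OF that(2)] that(1) by blast
  note [measurable] = L2_measurable[OF g]
  let ?d = "\<lambda>j x. g (r (Suc j)) x - g (r j) x"
  define V where "V = (LINT x|M. (1::real)\<^sup>2)"
  have V: "V \<ge> 0" by (simp add: V_def)
  have dL1: "(\<integral>\<^sup>+x. ennreal \<bar>?d j x\<bar> \<partial>M) \<le> ennreal (sqrt V * (1/2) ^ j)" for j
  proof -
    have dL: "L2 M (?d j)" by (intro L2_diff g)
    have "(LINT x|M. \<bar>?d j x\<bar> * \<bar>1\<bar>) \<le> sqrt (LINT x|M. (?d j x)\<^sup>2) * sqrt (LINT x|M. (1::real)\<^sup>2)"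
      by (rule L2_Cauchy_Schwarz_abs[OF dL L2_const])
    also have "\<dots> \<le> sqrt ((1/4) ^ j) * sqrt V"
      unfolding V_def using rd[of j "r (Suc j)" j] rN[of j "Suc j"] by (intro mult_right_mono) simp_all
    also have "sqrt ((1/4) ^ j) = (1/2::real) ^ j"
      by (simp add: real_sqrt_power real_sqrt_divide)
    finally have "(LINT x|M. \<bar>?d j x\<bar>) \<le> sqrt V * (1/2) ^ j" by (simp add: mult.commute)
    moreover have "(\<integral>\<^sup>+x. ennreal \<bar>?d j x\<bar> \<partial>M) = ennreal (LINT x|M. \<bar>?d j x\<bar>)"
      by (rule nn_integral_eq_integral[OF integrable_abs[OF L2_integrable[OF dL]]]) simp
    ultimately show ?thesis by (simp add: ennreal_leI)
  qed
  have "(\<integral>\<^sup>+x. (\<Sum>j. ennreal \<bar>?d j x\<bar>) \<partial>M) = (\<Sum>j. \<integral>\<^sup>+x. ennreal \<bar>?d j x\<bar> \<partial>M)"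
    by (rule nn_integral_suminf) measurable
  also have "\<dots> \<le> (\<Sum>j. ennreal (sqrt V * (1/2) ^ j))"
    by (intro suminf_le dL1) auto
  also have "\<dots> = ennreal (\<Sum>j. sqrt V * (1/2) ^ j)"
    using V by (intro suminf_ennreal2 summable_mult summable_geometric) auto
  also have "\<dots> < \<infinity>" by simp
  finally have "AE x in M. (\<Sum>j. ennreal \<bar>?d j x\<bar>) \<noteq> \<infinity>"
    by (intro nn_integral_PInf_AE) auto
  then have conv: "AE x in M. convergent (\<lambda>j. g (r j) x)"
  proof eventually_elim
    case (elim x)
    have "summable (\<lambda>j. \<bar>?d j x\<bar>)"
      by (rule summable_suminf_not_top) (use elim in auto)
    then have "summable (\<lambda>j. ?d j x)" by (rule summable_rabs_cancel)
    then have "(\<lambda>n. g (r 0) x + (\<Sum>j<n. ?d j x)) \<longlonglongrightarrow> g (r 0) x + (\<Sum>j. ?d j x)"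
      by (intro tendsto_intros summable_LIMSEQ)
    moreover have "(\<Sum>j<n. ?d j x) = g (r n) x - g (r 0) x" for n
      by (rule sum_lessThan_telescope)
    ultimately show ?case by (auto intro: convergentI)
  qed
  \<comment> \<open>Outside a null set the limit exists; elsewhere \<open>lim\<close> returns some
    value, and G stays measurable.\<close>
  define G where "G x = lim (\<lambda>j. g (r j) x)" for x
  have Gm[measurable]: "G \<in> borel_measurable M" unfolding G_def[abs_def] by measurable
  have lim: "AE x in M. (\<lambda>j. g (r j) x) \<longlonglongrightarrow> G x"
    using conv unfolding G_def by eventually_elim (simp add: convergent_LIMSEQ_iff)
  have bd: "(\<integral>\<^sup>+x. ennreal ((g k x - G x)\<^sup>2) \<partial>M) \<le> ennreal ((1/4) ^ i)" if k: "N i \<le> k" for i k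
  proof -
    \<comment> \<open>Fatou along the subsequence, with k fixed beyond the i-th threshold.\<close>
    have "(\<integral>\<^sup>+x. ennreal ((g k x - G x)\<^sup>2) \<partial>M) = (\<integral>\<^sup>+x. liminf (\<lambda>j. ennreal ((g k x - g (r j) x)\<^sup>2)) \<partial>M)"
    proof (rule nn_integral_cong_AE)
      show "AE x in M. ennreal ((g k x - G x)\<^sup>2) = liminf (\<lambda>j. ennreal ((g k x - g (r j) x)\<^sup>2))"
        using lim
      proof eventually_elim
        case (elim x)
        have "(\<lambda>j. ennreal ((g k x - g (r j) x)\<^sup>2)) \<longlonglongrightarrow> ennreal ((g k x - G x)\<^sup>2)"
          by (intro tendsto_ennrealI tendsto_intros elim)
        then show ?case using lim_imp_Liminf[OF sequentially_bot] by fastforce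
      qed
    qed
    also have "\<dots> \<le> liminf (\<lambda>j. \<integral>\<^sup>+x. ennreal ((g k x - g (r j) x)\<^sup>2) \<partial>M)"
      by (rule nn_integral_liminf) measurable
    also have "\<dots> \<le> liminf (\<lambda>j. ennreal ((1/4) ^ i))"
    proof (rule Liminf_mono, rule eventually_sequentiallyI[of i])
      fix j assume "i \<le> j"
      then show "(\<integral>\<^sup>+x. ennreal ((g k x - g (r j) x)\<^sup>2) \<partial>M) \<le> ennreal ((1/4) ^ i)"
        using rd[OF k] L2_integrable_square[OF L2_diff[OF g g]]
        by (subst nn_integral_eq_integral) (auto intro: ennreal_leI)
    qed
    also have "\<dots> = ennreal ((1/4) ^ i)" by (simp add: Liminf_const)
    finally show ?thesis .
  qed
  have dG: "L2 M (\<lambda>x. g (N 0) x - G x)"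
    unfolding L2_def
  proof (intro conjI integrableI_bounded)
    have "(\<integral>\<^sup>+x. ennreal (norm ((g (N 0) x - G x)\<^sup>2)) \<partial>M) \<le> ennreal ((1/4) ^ 0)"
      using bd[of 0 "N 0"] by simp
    also have "\<dots> < \<infinity>" by simp
    finally show "(\<integral>\<^sup>+x. ennreal (norm ((g (N 0) x - G x)\<^sup>2)) \<partial>M) < \<infinity>" .
  qed measurable
  show ?thesis
  proof (rule that)
    show "L2 M G" using L2_diff[OF g[of "N 0"] dG] by simp
    fix e :: real assume e: "e > 0"
    obtain i where i: "(1/4::real) ^ i < e" using real_arch_pow_inv[OF e, of "1/4"] by auto
    have "(LINT x|M. (g k x - G x)\<^sup>2) \<le> e" if "N i \<le> k" for k
    proof -
      have "(LINT x|M. (g k x - G x)\<^sup>2) \<le> (1/4) ^ i" using bd[OF that] by (intro integral_real_bounded) auto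
      then show ?thesis using i by simp
    qed
    then show "\<exists>N. \<forall>k\<ge>N. (LINT x|M. (g k x - G x)\<^sup>2) \<le> e" by blast
  qed
qed

lemma L2_limit_integral_mult:
  assumes g: "\<And>k. L2 M (g k)" and G: "L2 M G" and h: "L2 M h"
    and l: "\<And>e. e > 0 \<Longrightarrow> \<exists>N. \<forall>k\<ge>N. (LINT x|M. (g k x - G x)\<^sup>2) \<le> e"
  shows "(\<lambda>k. LINT x|M. g k x * h x) \<longlonglongrightarrow> (LINT x|M. G x * h x)"
proof -
  define H where "H = sqrt (LINT x|M. (h x)\<^sup>2)"
  have H: "H \<ge> 0" by (simp add: H_def)
  have "(\<lambda>k. LINT x|M. (g k x - G x)\<^sup>2) \<longlonglongrightarrow> 0"
  proof (rule LIMSEQ_I)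
    fix e :: real assume e: "e > 0"
    obtain N where "\<forall>k\<ge>N. (LINT x|M. (g k x - G x)\<^sup>2) \<le> e / 2" using l[of "e/2"] e by auto
    then show "\<exists>N. \<forall>k\<ge>N. norm ((LINT x|M. (g k x - G x)\<^sup>2) - 0) < e"
      using e by (intro exI[of _ N]) fastforce
  qed
  then have "(\<lambda>k. sqrt (LINT x|M. (g k x - G x)\<^sup>2) * H) \<longlonglongrightarrow> sqrt 0 * H"
    by (intro tendsto_intros)
  then have z: "(\<lambda>k. sqrt (LINT x|M. (g k x - G x)\<^sup>2) * H) \<longlonglongrightarrow> 0" by simp
  have "(\<lambda>k. (LINT x|M. g k x * h x) - (LINT x|M. G x * h x)) \<longlonglongrightarrow> 0"
  proof (rule Lim_null_comparison[OF always_eventually z], rule allI)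
    fix k
    have "(LINT x|M. g k x * h x) - (LINT x|M. G x * h x) = (LINT x|M. (g k x - G x) * h x)"
      using L2_integrable_mult[OF g h] L2_integrable_mult[OF G h] by (simp add: left_diff_distrib)
    then show "norm ((LINT x|M. g k x * h x) - (LINT x|M. G x * h x)) \<le> sqrt (LINT x|M. (g k x - G x)\<^sup>2) * H"
      using L2_Cauchy_Schwarz[OF L2_diff[OF g G] h] by (simp add: H_def)
  qed
  then show ?thesis by (simp add: LIM_zero_iff)
qed

section \<open>Variations of a minimizer\<close>

text \<open>Twice the gradient part of the energy. It takes a family of derivatives instead of a
  function, so any representatives can be inserted.\<close>

definition dirichlet :: "'n::finite heis set \<Rightarrow> ('n + 'n \<Rightarrow> 'n heis \<Rightarrow> real) \<Rightarrow> real" where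
  "dirichlet \<Omega> g = (\<Sum>i\<in>UNIV. LINT \<xi>|lebesgue_on \<Omega>. (g i \<xi>)\<^sup>2)"

lemma flux_2: "e > 0 \<Longrightarrow> flux 2 e q = q"
  using add_pos_nonneg[of e "(norm q)\<^sup>2"] by (simp add: flux_def)

section \<open>The energy and the bound h for exponent 2\<close>

lemma obstacle_bound_2:
  assumes "e > 0"
  shows "obstacle_bound 2 e \<psi> = (\<lambda>\<xi>. max (\<Sum>i\<in>UNIV. hderiv i (hderiv i \<psi>) \<xi>) 0)"
  by (simp add: obstacle_bound_def[abs_def] hdiv_def flux_2[OF assms] hgrad_def)

lemma continuous_on_obstacle_bound_2:
  assumes "e > 0" "hC2 \<psi>"
  shows "continuous_on UNIV (obstacle_bound 2 e \<psi>)"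
  unfolding obstacle_bound_2[OF assms(1)] using assms(2)
  by (intro continuous_intros) (simp add: hC2_def hC1_def)

lemma energy_density_2:
  assumes "e > 0"
  shows "energy_density 2 e \<Omega> F u \<xi> = 1/2 * (e + (\<Sum>i\<in>UNIV. (weak_hderiv \<Omega> i u \<xi>)\<^sup>2)) + F (u \<xi>) \<xi>"
proof -
  have "(norm (weak_hgrad \<Omega> u \<xi>))\<^sup>2 = (\<Sum>i\<in>UNIV. (weak_hderiv \<Omega> i u \<xi>)\<^sup>2)"
    unfolding power2_norm_eq_inner inner_vec_def by (simp add: weak_hgrad_def power2_eq_square)
  moreover have "(\<Sum>i\<in>UNIV. (weak_hderiv \<Omega> i u \<xi>)\<^sup>2) \<ge> 0" by (intro sum_nonneg) simp
  ultimately show ?thesis using assms by (simp add: energy_density_def powr_one)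
qed

text \<open>The mean value theorem turns the bounds on the derivative in r into bounds on
  increments, the form in which potential energies are compared below.\<close>

lemma admissible_integrand_diff:
  assumes F: "admissible_integrand p e \<Omega> \<psi> M F" and \<xi>: "\<xi> \<in> \<Omega>" and ab: "a \<in> {-M..M}" "b \<in> {-M..M}" "a \<le> b"
  shows "0 \<le> F b \<xi> - F a \<xi>" "F b \<xi> - F a \<xi> \<le> obstacle_bound p e \<psi> \<xi> * (b - a)"
proof -
  obtain F' where F': "\<And>r. r \<in> {-M..M} \<Longrightarrow> ((\<lambda>r. F r \<xi>) has_real_derivative F' r) (at r within {-M..M})"
      "\<And>r. r \<in> {-M..M} \<Longrightarrow> 0 \<le> F' r \<and> F' r \<le> obstacle_bound p e \<psi> \<xi>"
    using F \<xi> unfolding admissible_integrand_def by meson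
  have "0 \<le> F b \<xi> - F a \<xi> \<and> F b \<xi> - F a \<xi> \<le> obstacle_bound p e \<psi> \<xi> * (b - a)"
  proof (cases "a = b")
    case False
    then have "a < b" using ab by simp
    moreover have "((\<lambda>r. F r \<xi>) has_derivative (*) (F' r)) (at r within {a..b})" if "a \<le> r" "r \<le> b" for r
      using F'(1)[of r] ab that unfolding has_field_derivative_def
      by (auto intro: has_derivative_subset)
    ultimately obtain r where r: "r \<in> {a<..<b}" "F b \<xi> - F a \<xi> = F' r * (b - a)"
      using mvt_simple[of a b "\<lambda>r. F r \<xi>" "\<lambda>r. (*) (F' r)"] by auto
    then have "r \<in> {-M..M}" using ab by auto
    from F'(2)[OF this] show ?thesis using r(2) ab(3) by (auto intro: mult_right_mono)
  qed simp
  then show "0 \<le> F b \<xi> - F a \<xi>" "F b \<xi> - F a \<xi> \<le> obstacle_bound p e \<psi> \<xi> * (b - a)" by auto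
qed

context bounded_open
begin

text \<open>Adding M turns the truncation at - M into a positive part without changing derivatives.
  Applied to - u, the same lemma provides the truncation from above.\<close>

lemma sobolev_truncate:
  assumes s: "sobolev \<Omega> u g" and M: "\<And>\<xi>. \<xi> \<in> \<Omega> \<Longrightarrow> - M \<le> u \<xi>" and \<phi>: "\<phi> \<in> test_functions \<Omega>"
  obtains h where "sobolev \<Omega> (\<lambda>\<xi>. max (u \<xi> - t * \<phi> \<xi>) (- M)) h"
    "(\<lambda>\<xi>. u \<xi> - max (u \<xi> - t * \<phi> \<xi>) (- M)) \<in> W1p_0 2 \<Omega>"
    "dirichlet \<Omega> h \<le> dirichlet \<Omega> (\<lambda>i \<xi>. g i \<xi> - t * hderiv i \<phi> \<xi>)"
proof -
  have s1: "sobolev \<Omega> (\<lambda>\<xi>. u \<xi> - t * \<phi> \<xi>) (\<lambda>i \<xi>. g i \<xi> - t * hderiv i \<phi> \<xi>)"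
    using sobolev_lincomb[OF s sobolev_test[OF \<phi>], of 1 "- t"] by simp
  have s2: "sobolev \<Omega> (\<lambda>\<xi>. u \<xi> - t * \<phi> \<xi> + M) (\<lambda>i \<xi>. g i \<xi> - t * hderiv i \<phi> \<xi>)"
    using sobolev_lincomb[OF s1 sobolev_const[of M], of 1 1] by simp
  obtain h where h: "sobolev \<Omega> (\<lambda>\<xi>. max (u \<xi> - t * \<phi> \<xi> + M) 0) h"
      "\<And>i \<xi>. \<bar>h i \<xi>\<bar> \<le> \<bar>g i \<xi> - t * hderiv i \<phi> \<xi>\<bar>"
    by (rule sobolev_positive_part[OF s2]) (rule that)
  have eq: "(\<lambda>\<xi>. max (u \<xi> - t * \<phi> \<xi> + M) 0 - M) = (\<lambda>\<xi>. max (u \<xi> - t * \<phi> \<xi>) (- M))"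
    by (auto simp: fun_eq_iff max_def)
  have s3: "sobolev \<Omega> (\<lambda>\<xi>. max (u \<xi> - t * \<phi> \<xi>) (- M)) h"
    using sobolev_lincomb[OF h(1) sobolev_const[of M], of 1 "-1"] unfolding eq[symmetric] by simp
  obtain K where K: "compact K" "K \<subseteq> \<Omega>" "\<And>\<xi>. \<xi> \<notin> K \<Longrightarrow> \<phi> \<xi> = 0"
    by (rule test_support[OF \<phi>]) (rule that)
  show ?thesis
  proof (rule that[OF s3])
    show "(\<lambda>\<xi>. u \<xi> - max (u \<xi> - t * \<phi> \<xi>) (- M)) \<in> W1p_0 2 \<Omega>"
      \<comment> \<open>Off the support of \<phi> the truncation leaves u alone, because u \<ge> -
        M. The difference thus has compact support in \<Omega>.\<close>
      by (rule sobolev_compact_support_W1p_0[OF sobolev_diff[OF s s3] K(1,2)])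
        (simp add: K(3) max_absorb1 M)
    show "dirichlet \<Omega> h \<le> dirichlet \<Omega> (\<lambda>i \<xi>. g i \<xi> - t * hderiv i \<phi> \<xi>)"
      unfolding dirichlet_def
    proof (intro sum_mono integral_mono)
      show "integrable (lebesgue_on \<Omega>) (\<lambda>\<xi>. (h i \<xi>)\<^sup>2)" for i by (rule L2_integrable_square[OF sobolevD(2)[OF h(1)]])
      show "integrable (lebesgue_on \<Omega>) (\<lambda>\<xi>. (g i \<xi> - t * hderiv i \<phi> \<xi>)\<^sup>2)" for i by (rule L2_integrable_square[OF sobolevD(2)[OF s1]])
      show "(h i \<xi>)\<^sup>2 \<le> (g i \<xi> - t * hderiv i \<phi> \<xi>)\<^sup>2" for i \<xi> using h(2)[of i \<xi>] by (simp add: abs_le_square_iff)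
    qed
  qed
qed

lemma dirichlet_add:
  assumes g: "\<And>i. L2 (lebesgue_on \<Omega>) (g i)" and h: "\<And>i. L2 (lebesgue_on \<Omega>) (h i)"
  shows "dirichlet \<Omega> (\<lambda>i \<xi>. a * g i \<xi> + b * h i \<xi>) = a\<^sup>2 * dirichlet \<Omega> g
    + 2 * a * b * (\<Sum>i\<in>UNIV. LINT \<xi>|lebesgue_on \<Omega>. g i \<xi> * h i \<xi>) + b\<^sup>2 * dirichlet \<Omega> h"
proof -
  have "(LINT \<xi>|lebesgue_on \<Omega>. (a * g i \<xi> + b * h i \<xi>)\<^sup>2) = a\<^sup>2 * (LINT \<xi>|lebesgue_on \<Omega>. (g i \<xi>)\<^sup>2)
     + 2 * a * b * (LINT \<xi>|lebesgue_on \<Omega>. g i \<xi> * h i \<xi>) + b\<^sup>2 * (LINT \<xi>|lebesgue_on \<Omega>. (h i \<xi>)\<^sup>2)" for i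
  proof -
    have "(\<lambda>\<xi>. (a * g i \<xi> + b * h i \<xi>)\<^sup>2) = (\<lambda>\<xi>. a\<^sup>2 * (g i \<xi>)\<^sup>2 + 2 * a * b * (g i \<xi> * h i \<xi>) + b\<^sup>2 * (h i \<xi>)\<^sup>2)"
      by (auto simp: fun_eq_iff power2_eq_square algebra_simps)
    then show ?thesis
      by (simp only: integral_lincomb3(2)[OF L2_integrable_square[OF g] L2_integrable_mult[OF g h] L2_integrable_square[OF h]])
  qed
  then show ?thesis by (simp add: dirichlet_def sum.distrib sum_distrib_left)
qed

lemma dirichlet_weak_hderiv:
  assumes "sobolev \<Omega> u g"
  shows "dirichlet \<Omega> (\<lambda>i. weak_hderiv \<Omega> i u) = dirichlet \<Omega> g"
  by (simp add: dirichlet_def sobolev_L2_weak_eq[OF assms])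

lemma continuous_bounded_on:
  assumes "continuous_on UNIV (c :: 'n heis \<Rightarrow> real)"
  obtains B where "B \<ge> 0" "\<And>\<xi>. \<xi> \<in> \<Omega> \<Longrightarrow> \<bar>c \<xi>\<bar> \<le> B"
proof -
  have "bounded (c ` closure \<Omega>)"
    using assms bounded_\<Omega> by (intro compact_imp_bounded compact_continuous_image) (auto intro: continuous_on_subset)
  then obtain B where B: "B > 0" "\<And>x. x \<in> closure \<Omega> \<Longrightarrow> \<bar>c x\<bar> \<le> B" unfolding bounded_pos by auto
  then show ?thesis using closure_subset[of \<Omega>] by (intro that[of B]) auto
qed

lemma admissible_integrand_measurable:
  assumes F: "admissible_integrand p e \<Omega> \<psi> M F" and w: "w \<in> borel_measurable (lebesgue_on \<Omega>)"
    and M: "\<And>\<xi>. \<xi> \<in> \<Omega> \<Longrightarrow> w \<xi> \<in> {-M..M}"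
  shows "(\<lambda>\<xi>. F (w \<xi>) \<xi>) \<in> borel_measurable (lebesgue_on \<Omega>)"
proof -
  \<comment> \<open>F is continuous only on this product, so joint Borel measurability is obtained
    after extension by zero.\<close>
  let ?G = "\<lambda>z. if z \<in> {-M..M} \<times> \<Omega> then (\<lambda>(r, \<xi>). F r \<xi>) z else 0"
  have G: "?G \<in> borel_measurable borel"
  proof (rule borel_measurable_continuous_on_if)
    show "{-M..M} \<times> \<Omega> \<in> sets borel" using \<Omega>_borel by (intro borel_Times) auto
    show "continuous_on ({-M..M} \<times> \<Omega>) (\<lambda>(r, \<xi>). F r \<xi>)" using F by (simp add: admissible_integrand_def)
  qed simp
  have "(\<lambda>\<xi>. (w \<xi>, \<xi>)) \<in> borel_measurable (lebesgue_on \<Omega>)"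
    using borel_measurable_Pair[OF w borel_measurable_lebesgue_on[of "\<lambda>\<xi>. \<xi>"]] by simp
  from measurable_compose[OF this G]
  have "(\<lambda>\<xi>. ?G (w \<xi>, \<xi>)) \<in> borel_measurable (lebesgue_on \<Omega>)" .
  moreover have "(\<lambda>\<xi>. ?G (w \<xi>, \<xi>)) \<in> borel_measurable (lebesgue_on \<Omega>) \<longleftrightarrow>
      (\<lambda>\<xi>. F (w \<xi>) \<xi>) \<in> borel_measurable (lebesgue_on \<Omega>)"
    by (rule measurable_cong) (use M in \<open>simp add: space_restrict_space\<close>)
  ultimately show ?thesis by simp
qed


lemma competitorsD:
  assumes "w \<in> competitors 2 \<Omega> v M"
  shows "sobolev \<Omega> w (\<lambda>i. weak_hderiv \<Omega> i w)" "(\<lambda>\<xi>. w \<xi> - v \<xi>) \<in> W1p_0 2 \<Omega>" "\<And>\<xi>. \<xi> \<in> \<Omega> \<Longrightarrow> w \<xi> \<in> {-M..M}"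
  using assms W1p_2_sobolev unfolding competitors_def by blast+

text \<open>The potential energies of two competitors are compared through their difference, which is
  bounded even if the potential energies themselves are not.\<close>

lemma minimizer_comparison:
  assumes e: "e > 0" and \<psi>: "hC2 \<psi>" and F: "admissible_integrand 2 e \<Omega> \<psi> M F"
    and min: "is_minimizer 2 e \<Omega> v M F u" and w: "w \<in> competitors 2 \<Omega> v M" and h: "sobolev \<Omega> w h"
    and b: "L2 (lebesgue_on \<Omega>) b" "\<And>\<xi>. \<xi> \<in> \<Omega> \<Longrightarrow> F (w \<xi>) \<xi> - F (u \<xi>) \<xi> \<le> b \<xi>"
  shows "dirichlet \<Omega> (\<lambda>i. weak_hderiv \<Omega> i u) \<le> dirichlet \<Omega> h + 2 * (LINT \<xi>|lebesgue_on \<Omega>. b \<xi>)"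
proof -
  let ?M = "lebesgue_on \<Omega>" and ?q = "\<lambda>u \<xi>. 1/2 * (e + (\<Sum>i\<in>UNIV. (weak_hderiv \<Omega> i u \<xi>)\<^sup>2))"
  have u: "u \<in> competitors 2 \<Omega> v M" and Eu: "integrable ?M (energy_density 2 e \<Omega> F u)"
    using min by (auto simp: is_minimizer_def)
  note cu = competitorsD[OF u] and cw = competitorsD[OF w]
  have E: "energy_density 2 e \<Omega> F w = (\<lambda>\<xi>. ?q w \<xi> + F (w \<xi>) \<xi>)" for w
    using energy_density_2[OF e] by (intro ext)
  have qi: "integrable ?M (?q w)" "(LINT \<xi>|?M. ?q w \<xi>) = 1/2 * ((LINT \<xi>|?M. e) + dirichlet \<Omega> (\<lambda>i. weak_hderiv \<Omega> i w))"
    if "w \<in> competitors 2 \<Omega> v M" for w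
    using L2_integrable_square[OF sobolevD(2)[OF competitorsD(1)[OF that]]]
    by (simp_all add: dirichlet_def)
  \<comment> \<open>Here the finite energy of the minimizer is used; integrability along w then
    follows from the bounded difference.\<close>
  have Fui: "integrable ?M (\<lambda>\<xi>. F (u \<xi>) \<xi>)"
    using Bochner_Integration.integrable_diff[OF Eu qi(1)[OF u]] unfolding E by simp
  obtain H where H: "H \<ge> 0" "\<And>\<xi>. \<xi> \<in> \<Omega> \<Longrightarrow> \<bar>obstacle_bound 2 e \<psi> \<xi>\<bar> \<le> H"
    by (rule continuous_bounded_on[OF continuous_on_obstacle_bound_2[OF e \<psi>]]) (rule that)
  have Fd: "L2 ?M (\<lambda>\<xi>. F (w \<xi>) \<xi> - F (u \<xi>) \<xi>)"
  proof (rule \<Omega>.L2_bounded_on_space)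
    show "(\<lambda>\<xi>. F (w \<xi>) \<xi> - F (u \<xi>) \<xi>) \<in> borel_measurable ?M"
      by (intro borel_measurable_diff admissible_integrand_measurable[OF F] L2_measurable sobolevD(1)[OF cu(1)]
          sobolevD(1)[OF cw(1)] cu(3) cw(3))
    fix \<xi> assume "\<xi> \<in> space ?M"
    then have \<xi>: "\<xi> \<in> \<Omega>" by (simp add: space_restrict_space)
    note d = admissible_integrand_diff[OF F \<xi>]
    have ob: "obstacle_bound 2 e \<psi> \<xi> \<le> H" using H(2)[OF \<xi>] by simp
    have *: "\<bar>F b \<xi> - F a \<xi>\<bar> \<le> H * (2 * M)" if ab: "a \<in> {-M..M}" "b \<in> {-M..M}" "a \<le> b" for a b
    proof -
      have "F b \<xi> - F a \<xi> \<le> H * (b - a)" using d(2)[OF ab] mult_right_mono[OF ob, of "b - a"] ab(3) by simp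
      also have "\<dots> \<le> H * (2 * M)" using ab H(1) by (intro mult_left_mono) auto
      finally show ?thesis using d(1)[OF ab] by simp
    qed
    show "\<bar>F (w \<xi>) \<xi> - F (u \<xi>) \<xi>\<bar> \<le> H * (2 * M)"
      using *[OF cu(3)[OF \<xi>] cw(3)[OF \<xi>]] *[OF cw(3)[OF \<xi>] cu(3)[OF \<xi>]]
      by (cases "u \<xi> \<le> w \<xi>") (simp_all add: abs_minus_commute)
  qed
  have Fwi: "integrable ?M (\<lambda>\<xi>. F (w \<xi>) \<xi>)"
    using Bochner_Integration.integrable_add[OF \<Omega>.L2_integrable[OF Fd] Fui] by simp
  have Ew: "integrable ?M (energy_density 2 e \<Omega> F w)"
    unfolding E by (rule Bochner_Integration.integrable_add[OF qi(1)[OF w] Fwi])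
  have half_le: "a \<le> b + 2 * (y - x)" if "1/2 * (c + a) + x \<le> 1/2 * (c + b) + y" for a b c x y :: real
    using that by argo
  have "(LINT \<xi>|?M. energy_density 2 e \<Omega> F u \<xi>) \<le> (LINT \<xi>|?M. energy_density 2 e \<Omega> F w \<xi>)"
    using min w Ew by (simp add: is_minimizer_def)
  then have "(LINT \<xi>|?M. ?q u \<xi>) + (LINT \<xi>|?M. F (u \<xi>) \<xi>) \<le> (LINT \<xi>|?M. ?q w \<xi>) + (LINT \<xi>|?M. F (w \<xi>) \<xi>)"
    unfolding E by (simp only: Bochner_Integration.integral_add[OF qi(1)[OF u] Fui] Bochner_Integration.integral_add[OF qi(1)[OF w] Fwi])
  then have "dirichlet \<Omega> (\<lambda>i. weak_hderiv \<Omega> i u) \<le> dirichlet \<Omega> (\<lambda>i. weak_hderiv \<Omega> i w)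
      + 2 * (LINT \<xi>|?M. F (w \<xi>) \<xi> - F (u \<xi>) \<xi>)"
    unfolding qi(2)[OF u] qi(2)[OF w] Bochner_Integration.integral_diff[OF Fwi Fui] by (rule half_le)
  also have "(LINT \<xi>|?M. F (w \<xi>) \<xi> - F (u \<xi>) \<xi>) \<le> (LINT \<xi>|?M. b \<xi>)"
    by (rule integral_mono[OF \<Omega>.L2_integrable[OF Fd] \<Omega>.L2_integrable[OF b(1)]])
      (simp add: b(2) space_restrict_space)
  finally show ?thesis by (simp add: dirichlet_weak_hderiv[OF h])
qed

lemma quadratic_slope_le:
  fixes a q :: real
  assumes "\<And>t. t > 0 \<Longrightarrow> t * a \<le> t\<^sup>2 * q"
  shows "a \<le> 0"
proof (rule ccontr)
  assume "\<not> a \<le> 0"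
  then have a: "a > 0" by simp
  have le: "a \<le> t * q" if "t > 0" for t
    using assms[OF that] that by (simp add: power2_eq_square)
  have "q > 0" using le[of 1] a by simp
  \<comment> \<open>The choice t = a / (2q) makes the right side of \<open>le\<close> equal to
    a/2.\<close>
  then have "a \<le> a / 2" using le[of "a / (2 * q)"] a by simp
  then show False using a by simp
qed

text \<open>A nonnegative \<phi> separates the two bounds on the derivative of F: moving down never
  raises F, and moving up costs at most h per unit. The sign of the coefficient linear in t is then
  read off by \<open>quadratic_slope_le\<close>.\<close>

lemma minimizer_variation:
  assumes e: "e > 0" and M: "M > 0" and \<psi>: "hC2 \<psi>" and F: "admissible_integrand 2 e \<Omega> \<psi> M F"
    and min: "is_minimizer 2 e \<Omega> v M F u" and \<phi>: "\<phi> \<in> test_functions \<Omega>" "\<And>\<xi>. 0 \<le> \<phi> \<xi>"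
  shows "(\<Sum>i\<in>UNIV. LINT \<xi>|lebesgue_on \<Omega>. weak_hderiv \<Omega> i u \<xi> * hderiv i \<phi> \<xi>) \<le> 0" (is "?A \<le> 0")
    "- (\<Sum>i\<in>UNIV. LINT \<xi>|lebesgue_on \<Omega>. weak_hderiv \<Omega> i u \<xi> * hderiv i \<phi> \<xi>)
      \<le> (LINT \<xi>|lebesgue_on \<Omega>. obstacle_bound 2 e \<psi> \<xi> * \<phi> \<xi>)"
proof -
  let ?M = "lebesgue_on \<Omega>" and ?h = "obstacle_bound 2 e \<psi>" and ?g = "\<lambda>i. weak_hderiv \<Omega> i u"
  define Q where "Q = dirichlet \<Omega> (\<lambda>i. hderiv i \<phi>)"
  have u: "u \<in> competitors 2 \<Omega> v M" using min by (simp add: is_minimizer_def)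
  note cu = competitorsD[OF u]
  note gL = sobolevD(2)[OF cu(1)]
  note min_le = minimizer_comparison[OF e \<psi> F min]
  have "t * (2 * ?A) \<le> t\<^sup>2 * Q" if t: "t > 0" for t
  proof -
    have lo: "- M \<le> u \<xi>" if "\<xi> \<in> \<Omega>" for \<xi> using cu(3)[OF that] by simp
    let ?w = "\<lambda>\<xi>. max (u \<xi> - t * \<phi> \<xi>) (- M)"
    obtain h where h: "sobolev \<Omega> ?w h" "(\<lambda>\<xi>. u \<xi> - ?w \<xi>) \<in> W1p_0 2 \<Omega>"
        "dirichlet \<Omega> h \<le> dirichlet \<Omega> (\<lambda>i \<xi>. ?g i \<xi> - t * hderiv i \<phi> \<xi>)"
      by (rule sobolev_truncate[OF cu(1) lo \<phi>(1), of t]) (assumption, rule that)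
    have t\<phi>: "0 \<le> t * \<phi> \<xi>" for \<xi> using t \<phi>(2) by simp
    have range: "?w \<xi> \<in> {-M..M}" "?w \<xi> \<le> u \<xi>" if "\<xi> \<in> \<Omega>" for \<xi>
      using cu(3)[OF that] M t\<phi>[of \<xi>] by (auto simp: max_def)
    have "(\<lambda>\<xi>. 1 * (u \<xi> - v \<xi>) + (-1) * (u \<xi> - ?w \<xi>)) \<in> W1p_0 2 \<Omega>" by (rule W1p_0_lincomb[OF cu(2) h(2)])
    then have w: "?w \<in> competitors 2 \<Omega> v M"
      using range(1) sobolev_W1p[OF h(1)] unfolding competitors_def by simp
    have "dirichlet \<Omega> ?g \<le> dirichlet \<Omega> h + 2 * (LINT \<xi>|?M. 0)"
    proof (rule min_le[OF w h(1) \<Omega>.L2_const])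
      fix \<xi> assume \<xi>: "\<xi> \<in> \<Omega>"
      \<comment> \<open>F is nondecreasing in r and the competitor lies below u.\<close>
      show "F (?w \<xi>) \<xi> - F (u \<xi>) \<xi> \<le> 0"
        using admissible_integrand_diff(1)[OF F \<xi> range(1)[OF \<xi>] cu(3)[OF \<xi>] range(2)[OF \<xi>]] by simp
    qed
    also have "dirichlet \<Omega> h \<le> dirichlet \<Omega> ?g - 2 * t * ?A + t\<^sup>2 * Q"
      using h(3) dirichlet_add[OF gL L2_test(2)[OF \<phi>(1)], where a=1 and b="- t"] by (simp add: Q_def)
    finally show ?thesis by simp
  qed
  then have "2 * ?A \<le> 0" by (rule quadratic_slope_le)
  then show "?A \<le> 0" by simp
  let ?I = "LINT \<xi>|?M. ?h \<xi> * \<phi> \<xi>"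
  have hc: "continuous_on UNIV ?h" by (rule continuous_on_obstacle_bound_2[OF e \<psi>])
  have hL: "L2 ?M (\<lambda>\<xi>. ?h \<xi> * \<phi> \<xi>)"
    by (rule L2_continuous) (intro continuous_intros hc smooth_continuous test_smooth[OF \<phi>(1)])
  \<comment> \<open>The upper truncation min (u + t\<phi>) M is minus the lower truncation of - u -
    t\<phi>.\<close>
  have s': "sobolev \<Omega> (\<lambda>\<xi>. - u \<xi>) (\<lambda>i \<xi>. - ?g i \<xi>)"
    using sobolev_lincomb[OF cu(1) cu(1), of "-1" 0] by simp
  have "t * (2 * (- ?A - ?I)) \<le> t\<^sup>2 * Q" if t: "t > 0" for t
  proof -
    have lo: "- M \<le> - u \<xi>" if "\<xi> \<in> \<Omega>" for \<xi> using cu(3)[OF that] by simp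
    let ?w' = "\<lambda>\<xi>. max (- u \<xi> - t * \<phi> \<xi>) (- M)" and ?w = "\<lambda>\<xi>. - max (- u \<xi> - t * \<phi> \<xi>) (- M)"
    obtain h where h: "sobolev \<Omega> ?w' h" "(\<lambda>\<xi>. - u \<xi> - ?w' \<xi>) \<in> W1p_0 2 \<Omega>"
        "dirichlet \<Omega> h \<le> dirichlet \<Omega> (\<lambda>i \<xi>. - ?g i \<xi> - t * hderiv i \<phi> \<xi>)"
      by (rule sobolev_truncate[OF s' lo \<phi>(1), of t]) (assumption, rule that)
    have t\<phi>: "0 \<le> t * \<phi> \<xi>" for \<xi> using t \<phi>(2) by simp
    have range: "?w \<xi> \<in> {-M..M}" "u \<xi> \<le> ?w \<xi>" "?w \<xi> - u \<xi> \<le> t * \<phi> \<xi>" if "\<xi> \<in> \<Omega>" for \<xi>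
      using cu(3)[OF that] M t\<phi>[of \<xi>] by (auto simp: max_def)
    have "(\<lambda>\<xi>. 1 * (u \<xi> - v \<xi>) + 1 * (- u \<xi> - ?w' \<xi>)) \<in> W1p_0 2 \<Omega>" by (rule W1p_0_lincomb[OF cu(2) h(2)])
    moreover have "(\<lambda>\<xi>. 1 * (u \<xi> - v \<xi>) + 1 * (- u \<xi> - ?w' \<xi>)) = (\<lambda>\<xi>. ?w \<xi> - v \<xi>)" by auto
    moreover have hw: "sobolev \<Omega> ?w (\<lambda>i \<xi>. - h i \<xi>)"
      using sobolev_lincomb[OF h(1) h(1), of "-1" 0] by simp
    ultimately have w: "?w \<in> competitors 2 \<Omega> v M"
      using range(1) sobolev_W1p[OF hw] unfolding competitors_def by simp
    have "dirichlet \<Omega> ?g \<le> dirichlet \<Omega> (\<lambda>i \<xi>. - h i \<xi>) + 2 * (LINT \<xi>|?M. t * (?h \<xi> * \<phi> \<xi>))"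
    proof (rule min_le[OF w hw L2_cmult[OF hL]])
      fix \<xi> assume \<xi>: "\<xi> \<in> \<Omega>"
      have "F (?w \<xi>) \<xi> - F (u \<xi>) \<xi> \<le> ?h \<xi> * (?w \<xi> - u \<xi>)"
        by (rule admissible_integrand_diff(2)[OF F \<xi> cu(3)[OF \<xi>] range(1,2)[OF \<xi>]])
      \<comment> \<open>Truncation only shortens the upward move, and h is nonnegative.\<close>
      also have "\<dots> \<le> ?h \<xi> * (t * \<phi> \<xi>)"
        using range(3)[OF \<xi>] by (intro mult_left_mono) (simp_all add: obstacle_bound_def)
      finally show "F (?w \<xi>) \<xi> - F (u \<xi>) \<xi> \<le> t * (?h \<xi> * \<phi> \<xi>)" by (simp add: mult_ac)
    qed
    also have "(LINT \<xi>|?M. t * (?h \<xi> * \<phi> \<xi>)) = t * ?I" by simp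
    also have "dirichlet \<Omega> (\<lambda>i \<xi>. - h i \<xi>) = dirichlet \<Omega> h" by (simp add: dirichlet_def)
    also have "dirichlet \<Omega> h \<le> dirichlet \<Omega> ?g + 2 * t * ?A + t\<^sup>2 * Q"
      using h(3) dirichlet_add[OF gL L2_test(2)[OF \<phi>(1)], where a="-1" and b="- t"] by (simp add: Q_def)
    finally show ?thesis by (simp add: algebra_simps)
  qed
  then have "2 * (- ?A - ?I) \<le> 0" by (rule quadratic_slope_le)
  then show "- ?A \<le> ?I" by simp
qed

text \<open>The class of competitors is convex, so the midpoint is admissible for both functionals.
  In each of them it changes the potential by at most H times d pointwise, however different F and
  F' may be.\<close>

lemma minimizer_difference:
  assumes e: "e > 0" and \<psi>: "hC2 \<psi>" and H: "\<And>\<xi>. \<xi> \<in> \<Omega> \<Longrightarrow> \<bar>obstacle_bound 2 e \<psi> \<xi>\<bar> \<le> H"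
    and F: "admissible_integrand 2 e \<Omega> \<psi> M F" "admissible_integrand 2 e \<Omega> \<psi> M F'"
    and min: "is_minimizer 2 e \<Omega> v M F u" "is_minimizer 2 e \<Omega> v M F' u'"
    and d: "\<And>\<xi>. \<xi> \<in> \<Omega> \<Longrightarrow> \<bar>u \<xi> - u' \<xi>\<bar> \<le> d"
  shows "(LINT \<xi>|lebesgue_on \<Omega>. (weak_hderiv \<Omega> i u \<xi> - weak_hderiv \<Omega> i u' \<xi>)\<^sup>2)
    \<le> 8 * (LINT \<xi>|lebesgue_on \<Omega>. H * d)"
proof -
  let ?M = "lebesgue_on \<Omega>" and ?g = "\<lambda>i. weak_hderiv \<Omega> i u" and ?g' = "\<lambda>i. weak_hderiv \<Omega> i u'"
  have u: "u \<in> competitors 2 \<Omega> v M" "u' \<in> competitors 2 \<Omega> v M" using min by (simp_all add: is_minimizer_def)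
  note c = competitorsD[OF u(1)] and c' = competitorsD[OF u(2)]
  note L = sobolevD(2)[OF c(1)] sobolevD(2)[OF c'(1)]
  let ?w = "\<lambda>\<xi>. 1/2 * u \<xi> + 1/2 * u' \<xi>" and ?k = "\<lambda>i \<xi>. 1/2 * ?g i \<xi> + 1/2 * ?g' i \<xi>"
  have k: "sobolev \<Omega> ?w ?k" by (rule sobolev_lincomb[OF c(1) c'(1)])
  have range: "?w \<xi> \<in> {-M..M}" if "\<xi> \<in> \<Omega>" for \<xi> using c(3)[OF that] c'(3)[OF that] by auto
  have "(\<lambda>\<xi>. 1/2 * (u \<xi> - v \<xi>) + 1/2 * (u' \<xi> - v \<xi>)) \<in> W1p_0 2 \<Omega>" by (rule W1p_0_lincomb[OF c(2) c'(2)])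
  moreover have "(\<lambda>\<xi>. 1/2 * (u \<xi> - v \<xi>) + 1/2 * (u' \<xi> - v \<xi>)) = (\<lambda>\<xi>. ?w \<xi> - v \<xi>)" by (auto simp: fun_eq_iff field_simps)
  ultimately have w: "?w \<in> competitors 2 \<Omega> v M"
    using range sobolev_W1p[OF k] unfolding competitors_def by simp
  have Fle: "F (?w \<xi>) \<xi> - F (u \<xi>) \<xi> \<le> H * d" "F (?w \<xi>) \<xi> - F (u' \<xi>) \<xi> \<le> H * d"
    if F: "admissible_integrand 2 e \<Omega> \<psi> M F" and \<xi>: "\<xi> \<in> \<Omega>" for F \<xi>
  proof -
    have d0: "0 \<le> d" "\<bar>?w \<xi> - u \<xi>\<bar> \<le> d" "\<bar>?w \<xi> - u' \<xi>\<bar> \<le> d" using d[OF \<xi>] by linarith+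
    have H0: "0 \<le> H" "obstacle_bound 2 e \<psi> \<xi> \<le> H" "0 \<le> obstacle_bound 2 e \<psi> \<xi>"
      using H[OF \<xi>] by (simp_all add: obstacle_bound_def)
    have *: "F b \<xi> - F a \<xi> \<le> H * d" if ab: "a \<in> {-M..M}" "b \<in> {-M..M}" "\<bar>b - a\<bar> \<le> d" for a b
    proof (cases "a \<le> b")
      case True
      have "F b \<xi> - F a \<xi> \<le> obstacle_bound 2 e \<psi> \<xi> * (b - a)"
        by (rule admissible_integrand_diff(2)[OF F \<xi> ab(1,2) True])
      also have "\<dots> \<le> H * d" using H0 ab(3) True by (intro mult_mono) auto
      finally show ?thesis .
    next
      case False
      then have "F b \<xi> - F a \<xi> \<le> 0" using admissible_integrand_diff(1)[OF F \<xi> ab(2,1)] by simp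
      then show ?thesis using H0(1) d0(1) by (meson mult_nonneg_nonneg order_trans)
    qed
    show "F (?w \<xi>) \<xi> - F (u \<xi>) \<xi> \<le> H * d" by (rule *[OF c(3)[OF \<xi>] range[OF \<xi>] d0(2)])
    show "F (?w \<xi>) \<xi> - F (u' \<xi>) \<xi> \<le> H * d" by (rule *[OF c'(3)[OF \<xi>] range[OF \<xi>] d0(3)])
  qed
  have "dirichlet \<Omega> ?g \<le> dirichlet \<Omega> ?k + 2 * (LINT \<xi>|?M. H * d)"
    by (rule minimizer_comparison[OF e \<psi> F(1) min(1) w k \<Omega>.L2_const Fle(1)[OF F(1)]])
  moreover have "dirichlet \<Omega> ?g' \<le> dirichlet \<Omega> ?k + 2 * (LINT \<xi>|?M. H * d)"
    by (rule minimizer_comparison[OF e \<psi> F(2) min(2) w k \<Omega>.L2_const Fle(2)[OF F(2)]])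
  moreover define P where "P = (\<Sum>i\<in>UNIV. LINT \<xi>|?M. ?g i \<xi> * ?g' i \<xi>)"
  have "dirichlet \<Omega> ?k = (1/2)\<^sup>2 * dirichlet \<Omega> ?g + 2 * (1/2) * (1/2) * P + (1/2)\<^sup>2 * dirichlet \<Omega> ?g'"
    unfolding P_def by (rule dirichlet_add[OF L])
  moreover have "dirichlet \<Omega> (\<lambda>i \<xi>. ?g i \<xi> - ?g' i \<xi>) = dirichlet \<Omega> ?g - 2 * P + dirichlet \<Omega> ?g'"
    unfolding P_def using dirichlet_add[OF L, where a=1 and b="-1"] by simp
  \<comment> \<open>The parallelogram law gives 2D(g) + 2D(g') - 4D(k), where k is the midpoint
    gradient. Each of the first two exceeds 2D(k) by at most four times the integral of Hd, hence
    8.\<close>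
  ultimately have "dirichlet \<Omega> (\<lambda>i \<xi>. ?g i \<xi> - ?g' i \<xi>) \<le> 8 * (LINT \<xi>|?M. H * d)"
    by (simp add: power2_eq_square) 
  moreover have "(LINT \<xi>|?M. (?g i \<xi> - ?g' i \<xi>)\<^sup>2) \<le> dirichlet \<Omega> (\<lambda>i \<xi>. ?g i \<xi> - ?g' i \<xi>)"
    unfolding dirichlet_def by (rule member_le_sum) simp_all
  ultimately show ?thesis by simp
qed

end

section \<open>Passage to the limit\<close>

context bounded_open
begin

text \<open>Uniform closeness of the minimizers makes each gradient component Cauchy in L2. The
  identity defining weak derivatives passes to the limit on both sides, which identifies the limit
  components as derivatives of u_inf.\<close>

lemma minimizers_limit:
  assumes e: "e > 0" and \<psi>: "hC2 \<psi>"
    and F: "\<And>k. admissible_integrand 2 e \<Omega> \<psi> M (F k)"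
    and min: "\<And>k. is_minimizer 2 e \<Omega> v M (F k) (u k)"
    and lim: "uniform_limit \<Omega> u u_inf sequentially"
  obtains G where "sobolev \<Omega> u_inf G"
    "\<And>i h. L2 (lebesgue_on \<Omega>) h \<Longrightarrow> (\<lambda>k. LINT \<xi>|lebesgue_on \<Omega>. weak_hderiv \<Omega> i (u k) \<xi> * h \<xi>)
      \<longlonglongrightarrow> (LINT \<xi>|lebesgue_on \<Omega>. G i \<xi> * h \<xi>)"
proof -
  let ?M = "lebesgue_on \<Omega>" and ?g = "\<lambda>i k. weak_hderiv \<Omega> i (u k)"
  have u: "u k \<in> competitors 2 \<Omega> v M" for k using min[of k] by (simp add: is_minimizer_def)
  note c = competitorsD[OF u]
  obtain H where H: "H \<ge> 0" "\<And>\<xi>. \<xi> \<in> \<Omega> \<Longrightarrow> \<bar>obstacle_bound 2 e \<psi> \<xi>\<bar> \<le> H"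
    by (rule continuous_bounded_on[OF continuous_on_obstacle_bound_2[OF e \<psi>]]) (rule that)
  define V where "V = (LINT \<xi>|?M. (1::real))"
  have V: "V \<ge> 0" by (simp add: V_def)
  have close: "\<exists>N. \<forall>k\<ge>N. \<forall>\<xi>\<in>\<Omega>. \<bar>u k \<xi> - u_inf \<xi>\<bar> < d" if "d > 0" for d
    using lim that unfolding uniform_limit_iff eventually_sequentially dist_real_def by blast
  have Cauchy: "\<exists>N. \<forall>k\<ge>N. \<forall>m\<ge>N. (LINT \<xi>|?M. (?g i k \<xi> - ?g i m \<xi>)\<^sup>2) \<le> r" if r: "r > 0" for i r
  proof -
    \<comment> \<open>Two minimizers within d of u_inf differ by at most 2d, so 8 times the integral
      of H(2d) is 16HVd; the added 1 makes C positive.\<close>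
    define C where "C = 16 * H * V + 1"
    have C: "C > 0" using H(1) V by (simp add: C_def add_nonneg_pos)
    define d where "d = r / C"
    have d: "d > 0" using r C by (simp add: d_def)
    obtain N where N: "\<forall>k\<ge>N. \<forall>\<xi>\<in>\<Omega>. \<bar>u k \<xi> - u_inf \<xi>\<bar> < d" using close[OF d] by blast
    have "(LINT \<xi>|?M. (?g i k \<xi> - ?g i m \<xi>)\<^sup>2) \<le> r" if km: "k \<ge> N" "m \<ge> N" for k m
    proof -
      have d2: "\<bar>u k \<xi> - u m \<xi>\<bar> \<le> 2 * d" if "\<xi> \<in> \<Omega>" for \<xi>
      proof -
        have "\<bar>u k \<xi> - u_inf \<xi>\<bar> < d" "\<bar>u m \<xi> - u_inf \<xi>\<bar> < d" using N km that by blast+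
        then show ?thesis by linarith
      qed
      have "(LINT \<xi>|?M. (?g i k \<xi> - ?g i m \<xi>)\<^sup>2) \<le> 8 * (LINT \<xi>|?M. H * (2 * d))"
        by (rule minimizer_difference[OF e \<psi> H(2) F F min min d2])
      also have "\<dots> = 16 * H * V * d" by (simp add: V_def)
      also have "\<dots> \<le> C * d" using d by (intro mult_right_mono) (auto simp: C_def)
      also have "\<dots> = r" using C by (simp add: d_def)
      finally show ?thesis .
    qed
    then show ?thesis by blast
  qed
  have "\<forall>i. \<exists>G. L2 ?M G \<and> (\<forall>r>0. \<exists>N. \<forall>k\<ge>N. (LINT \<xi>|?M. (?g i k \<xi> - G \<xi>)\<^sup>2) \<le> r)"
  proof
    fix i
    obtain G where "L2 ?M G" "\<And>r. r > 0 \<Longrightarrow> \<exists>N. \<forall>k\<ge>N. (LINT \<xi>|?M. (?g i k \<xi> - G \<xi>)\<^sup>2) \<le> r"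
      by (rule \<Omega>.L2_complete[OF sobolevD(2)[OF c(1)] Cauchy]) (assumption, rule that)
    then show "\<exists>G. L2 ?M G \<and> (\<forall>r>0. \<exists>N. \<forall>k\<ge>N. (LINT \<xi>|?M. (?g i k \<xi> - G \<xi>)\<^sup>2) \<le> r)" by blast
  qed
  from choice[OF this] obtain G where
    "\<forall>i. L2 ?M (G i) \<and> (\<forall>r>0. \<exists>N. \<forall>k\<ge>N. (LINT \<xi>|?M. (?g i k \<xi> - G i \<xi>)\<^sup>2) \<le> r)" by (elim exE)
  then have GL: "L2 ?M (G i)" and Glim: "\<And>r. r > 0 \<Longrightarrow> \<exists>N. \<forall>k\<ge>N. (LINT \<xi>|?M. (?g i k \<xi> - G i \<xi>)\<^sup>2) \<le> r" for i
    by blast+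
  have conv: "(\<lambda>k. LINT \<xi>|?M. ?g i k \<xi> * h \<xi>) \<longlonglongrightarrow> (LINT \<xi>|?M. G i \<xi> * h \<xi>)" if "L2 ?M h" for i h
    by (rule L2_limit_integral_mult[OF sobolevD(2)[OF c(1)] GL that Glim])
  have ptw: "(\<lambda>k. u k \<xi>) \<longlonglongrightarrow> u_inf \<xi>" if "\<xi> \<in> \<Omega>" for \<xi>
    by (rule tendsto_uniform_limitI[OF lim that])
  have um: "u k \<in> borel_measurable ?M" for k by (rule L2_measurable[OF sobolevD(1)[OF c(1)]])
  have uim: "u_inf \<in> borel_measurable ?M"
    by (rule borel_measurable_LIMSEQ_metric[where f=u and g=u_inf, OF um]) (simp add: ptw space_restrict_space)
  have ub: "\<bar>u k \<xi>\<bar> \<le> M" if "\<xi> \<in> \<Omega>" for k \<xi> using c(3)[OF that, of k] by auto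
  \<comment> \<open>The constraint survives the limit and yields square integrability of u_inf as
    well as a dominating constant below.\<close>
  have uib: "\<bar>u_inf \<xi>\<bar> \<le> M" if "\<xi> \<in> \<Omega>" for \<xi>
    by (rule LIMSEQ_le_const2[OF tendsto_rabs[OF ptw[OF that]]]) (use ub[OF that] in blast)
  have "sobolev \<Omega> u_inf G"
  proof (rule sobolevI)
    show "L2 ?M u_inf" by (rule \<Omega>.L2_bounded_on_space[where B=M, OF uim]) (simp add: uib space_restrict_space)
    show "L2 ?M (G i)" for i by (rule GL)
    fix i \<phi> assume \<phi>: "\<phi> \<in> test_functions \<Omega>"
    obtain K B where B: "B \<ge> 0" "\<And>\<xi> i. \<bar>hderiv i \<phi> \<xi>\<bar> \<le> B"
      by (rule test_hderiv[OF \<phi>]) (rule that)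
    note pm = L2_measurable[OF L2_test(2)[OF \<phi>, of i]]
    have l: "(\<lambda>k. LINT \<xi>|?M. u k \<xi> * hderiv i \<phi> \<xi>) \<longlonglongrightarrow> (LINT \<xi>|?M. u_inf \<xi> * hderiv i \<phi> \<xi>)"
    proof (rule integral_dominated_convergence[where w="\<lambda>_. M * B"])
      show "AE \<xi> in ?M. (\<lambda>k. u k \<xi> * hderiv i \<phi> \<xi>) \<longlonglongrightarrow> u_inf \<xi> * hderiv i \<phi> \<xi>"
        by (rule AE_I2) (auto intro!: tendsto_mult ptw simp: space_restrict_space)
      show "AE \<xi> in ?M. norm (u k \<xi> * hderiv i \<phi> \<xi>) \<le> M * B" for k
      proof (rule AE_I2)
        fix \<xi> assume "\<xi> \<in> space ?M"
        then have "\<xi> \<in> \<Omega>" by (simp add: space_restrict_space)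
        from ub[OF this, of k] show "norm (u k \<xi> * hderiv i \<phi> \<xi>) \<le> M * B"
          unfolding real_norm_def abs_mult by (intro mult_mono B(2)) auto
      qed
    qed (intro borel_measurable_times uim um pm, intro borel_measurable_times uim um pm, simp)
    have "(\<lambda>k. LINT \<xi>|?M. u k \<xi> * hderiv i \<phi> \<xi>) \<longlonglongrightarrow> - (LINT \<xi>|?M. G i \<xi> * \<phi> \<xi>)"
      unfolding sobolevD(4)[OF c(1) \<phi>] by (intro tendsto_minus conv L2_test(1)[OF \<phi>])
    with l show "(LINT \<xi>|?M. u_inf \<xi> * hderiv i \<phi> \<xi>) = - (LINT \<xi>|?M. G i \<xi> * \<phi> \<xi>)"
      by (rule LIMSEQ_unique)
  qed
  then show ?thesis by (rule that) (rule conv)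
qed

lemma integral_flux_2:
  assumes e: "e > 0" and s: "sobolev \<Omega> u G" and \<phi>: "\<phi> \<in> test_functions \<Omega>"
  shows "(LINT \<xi>|lebesgue_on \<Omega>. flux 2 e (weak_hgrad \<Omega> u \<xi>) \<bullet> hgrad \<phi> \<xi>)
    = (\<Sum>i\<in>UNIV. LINT \<xi>|lebesgue_on \<Omega>. G i \<xi> * hderiv i \<phi> \<xi>)"
proof -
  note w = sobolev_weak_hderiv(1)[OF s]
  note p = L2_test(2)[OF \<phi>]
  have "(LINT \<xi>|lebesgue_on \<Omega>. flux 2 e (weak_hgrad \<Omega> u \<xi>) \<bullet> hgrad \<phi> \<xi>)
      = (LINT \<xi>|lebesgue_on \<Omega>. (\<Sum>i\<in>UNIV. weak_hderiv \<Omega> i u \<xi> * hderiv i \<phi> \<xi>))"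
    by (simp add: flux_2[OF e] inner_vec_def weak_hgrad_def hgrad_def)
  also have "\<dots> = (\<Sum>i\<in>UNIV. LINT \<xi>|lebesgue_on \<Omega>. weak_hderiv \<Omega> i u \<xi> * hderiv i \<phi> \<xi>)"
    by (rule Bochner_Integration.integral_sum[OF L2_integrable_mult[OF sobolevD(2)[OF w] p]])
  also have "\<dots> = (\<Sum>i\<in>UNIV. LINT \<xi>|lebesgue_on \<Omega>. G i \<xi> * hderiv i \<phi> \<xi>)"
  proof (rule sum.cong[OF refl])
    fix i
    have "AE \<xi> in lebesgue_on \<Omega>. weak_hderiv \<Omega> i u \<xi> * hderiv i \<phi> \<xi> = G i \<xi> * hderiv i \<phi> \<xi>"
      using sobolev_weak_hderiv(2)[OF s, of i] by eventually_elim simp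
    then show "(LINT \<xi>|lebesgue_on \<Omega>. weak_hderiv \<Omega> i u \<xi> * hderiv i \<phi> \<xi>) = (LINT \<xi>|lebesgue_on \<Omega>. G i \<xi> * hderiv i \<phi> \<xi>)"
      by (intro integral_cong_AE borel_measurable_times L2_measurable[OF sobolevD(2)[OF w]]
          L2_measurable[OF sobolevD(2)[OF s]] L2_measurable[OF p])
  qed
  finally show ?thesis .
qed

lemma minimizers_limit_bounds:
  assumes e: "e > 0" and M: "M > 0" and \<psi>: "hC2 \<psi>"
    and F: "\<And>k. admissible_integrand 2 e \<Omega> \<psi> M (F k)"
    and min: "\<And>k. is_minimizer 2 e \<Omega> v M (F k) (u k)"
    and lim: "uniform_limit \<Omega> u u_inf sequentially"
  shows "u_inf \<in> W1p 2 \<Omega> \<and>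
      (\<forall>\<phi>\<in>test_functions \<Omega>. (\<forall>\<xi>. 0 \<le> \<phi> \<xi>) \<longrightarrow>
        0 \<le> - (LINT \<xi>|lebesgue_on \<Omega>. flux 2 e (weak_hgrad \<Omega> u_inf \<xi>) \<bullet> hgrad \<phi> \<xi>) \<and>
        - (LINT \<xi>|lebesgue_on \<Omega>. flux 2 e (weak_hgrad \<Omega> u_inf \<xi>) \<bullet> hgrad \<phi> \<xi>)
          \<le> (LINT \<xi>|lebesgue_on \<Omega>. obstacle_bound 2 e \<psi> \<xi> * \<phi> \<xi>))"
proof -
  obtain G where G: "sobolev \<Omega> u_inf G"
    "\<And>i h. L2 (lebesgue_on \<Omega>) h \<Longrightarrow> (\<lambda>k. LINT \<xi>|lebesgue_on \<Omega>. weak_hderiv \<Omega> i (u k) \<xi> * h \<xi>)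
      \<longlonglongrightarrow> (LINT \<xi>|lebesgue_on \<Omega>. G i \<xi> * h \<xi>)"
    by (rule minimizers_limit[OF e \<psi> F min lim]) (rule that)
  have "0 \<le> - (LINT \<xi>|lebesgue_on \<Omega>. flux 2 e (weak_hgrad \<Omega> u_inf \<xi>) \<bullet> hgrad \<phi> \<xi>) \<and>
        - (LINT \<xi>|lebesgue_on \<Omega>. flux 2 e (weak_hgrad \<Omega> u_inf \<xi>) \<bullet> hgrad \<phi> \<xi>)
          \<le> (LINT \<xi>|lebesgue_on \<Omega>. obstacle_bound 2 e \<psi> \<xi> * \<phi> \<xi>)"
    if \<phi>: "\<phi> \<in> test_functions \<Omega>" "\<forall>\<xi>. 0 \<le> \<phi> \<xi>" for \<phi>
  proof -
    note nn = \<phi>(2)[rule_format]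
    let ?A = "\<lambda>k. \<Sum>i\<in>UNIV. LINT \<xi>|lebesgue_on \<Omega>. weak_hderiv \<Omega> i (u k) \<xi> * hderiv i \<phi> \<xi>"
    have l: "?A \<longlonglongrightarrow> (LINT \<xi>|lebesgue_on \<Omega>. flux 2 e (weak_hgrad \<Omega> u_inf \<xi>) \<bullet> hgrad \<phi> \<xi>)"
      unfolding integral_flux_2[OF e G(1) \<phi>(1)] by (intro tendsto_sum G(2) L2_test(2)[OF \<phi>(1)])
    note var = minimizer_variation[OF e M \<psi> F min \<phi>(1) nn]
    \<comment> \<open>Both inequalities are closed conditions on numbers, and the right side does
      not depend on k.\<close>
    show ?thesis
      using LIMSEQ_le_const2[OF l, of 0] LIMSEQ_le_const2[OF tendsto_minus[OF l]] var by auto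
  qed
  then show ?thesis using sobolev_W1p[OF G(1)] by blast
qed

end

theorem lemma12:
  fixes \<psi> :: "'n::finite heis \<Rightarrow> real" and \<Omega> :: "'n heis set"
  assumes "open \<Omega>" and "bounded \<Omega>" and "smooth_boundary \<Omega>"
    and "hC2 \<psi>"
  shows "2 \<in> LS_exponents \<psi> \<Omega>"
proof -
  interpret bounded_open \<Omega> using assms by unfold_locales
  show ?thesis
    unfolding LS_exponents_def mem_Collect_eq
  proof (rule conjI, simp, intro allI impI ballI)
    fix \<epsilon> v and M :: real and F :: "nat \<Rightarrow> real \<Rightarrow> 'n heis \<Rightarrow> real" and u u_inf
    assume "0 < \<epsilon>" "0 < M" "\<forall>k. admissible_integrand 2 \<epsilon> \<Omega> \<psi> M (F k)" "\<forall>k. is_minimizer 2 \<epsilon> \<Omega> v M (F k) (u k)"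
      "uniform_limit \<Omega> u u_inf sequentially"
    then show "u_inf \<in> W1p 2 \<Omega> \<and>
      (\<forall>\<phi>\<in>test_functions \<Omega>. (\<forall>\<xi>. 0 \<le> \<phi> \<xi>) \<longrightarrow>
        0 \<le> - (LINT \<xi>|lebesgue_on \<Omega>. flux 2 \<epsilon> (weak_hgrad \<Omega> u_inf \<xi>) \<bullet> hgrad \<phi> \<xi>) \<and>
        - (LINT \<xi>|lebesgue_on \<Omega>. flux 2 \<epsilon> (weak_hgrad \<Omega> u_inf \<xi>) \<bullet> hgrad \<phi> \<xi>)
          \<le> (LINT \<xi>|lebesgue_on \<Omega>. obstacle_bound 2 \<epsilon> \<psi> \<xi> * \<phi> \<xi>))"
      using minimizers_limit_bounds[OF _ _ assms(4)] by blast
  qed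
qed

end
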